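(* Let $L$ be a Lévy basis on $\mathbb{R}^d$ with characteristic triplet $(a,\gamma,\nu)$ such that $\int_{\mathbb{R}}\mathbf{1}_{|r|>1}\log(|r|)^d\nu(dr)<\infty$. Let $p,q$ be polynomials on $\mathbb{R}^d$ with real coefficients and assume there is $\varepsilon>0$ with $$\sup_{\eta\in\mathbb{R}^d,\ \|\eta\|<\varepsilon}\left\|\frac{q(i\cdot+\eta)}{p(i\cdot+\eta)}\right\|_{L^2(\mathbb{R}^d)}<\infty.$$ Then there exists a mild solution of $p(D)X=q(D)\,dL$, given by $$X_t=\int_{\mathbb{R}^d}\mathcal{F}^{-1}\!\left(\frac{q(i\cdot)}{p(i\cdot)}\right)(t-x)\,dL(x),\qquad t\in\mathbb{R}^d.$$
   Context: $D^\alpha=\partial_{x_1}^{\alpha_1}\cdots\partial_{x_d}^{\alpha_d}$ and $p(D)=\sum p_\alpha D^\alpha$. The Fourier transform is $\mathcal{F}f(x)=\int e^{-i\langle z,x\rangle}f(z)\,dz$ (extended to $L^2$), $\mathcal{F}^{-1}$ its inverse. Given a locally integrable real function $G$ which is a fundamental solution of $p(D)u=q(D)\delta_0$, meaning $p(D)(G\ast\varphi)=q(D)\varphi$ for all $\varphi\in\mathcal{D}(\mathbb{R}^d)$, the random field $X_t=\int_{\mathbb{R}^d}G(t-s)\,dL(s)$ is called the mild solution of $p(D)X=q(D)dL$, provided the integrals exist. A Lévy basis with triplet $(a,\gamma,\nu)$ is an independently scattered, countably additive family $(L(A))$ over bounded Borel sets with $\mathbb{E}e^{izL(A)}=\exp(\psi(z)\lambda^d(A))$,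 $\psi(z)=i\gamma z-\tfrac12az^2+\int(e^{ixz}-1-ixz\mathbf{1}_{[-1,1]}(x))\nu(dx)$; integrals are in the sense of Rajput and Rosiński. *)

theory Defs
  imports "HOL-Probability.Probability"
begin

definition enum_list :: "'n::finite list" where
  "enum_list = (SOME xs. distinct xs \<and> set xs = UNIV)"

definition dirs :: "('n::finite \<Rightarrow> nat) \<Rightarrow> 'n list" where
  "dirs \<alpha> = concat (map (\<lambda>i. replicate (\<alpha> i) i) enum_list)"

definition partial_deriv :: "'n::finite \<Rightarrow> (real^'n \<Rightarrow> real) \<Rightarrow> real^'n \<Rightarrow> real" where
  "partial_deriv i f x = deriv (\<lambda>t. f (x + t *\<^sub>R axis i 1)) 0"

fun partials :: "'n::finite list \<Rightarrow> (real^'n \<Rightarrow> real) \<Rightarrow> real^'n \<Rightarrow> real" where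
  "partials [] f = f"
| "partials (i # is) f = partial_deriv i (partials is f)"

definition Dmulti :: "('n::finite \<Rightarrow> nat) \<Rightarrow> (real^'n \<Rightarrow> real) \<Rightarrow> real^'n \<Rightarrow> real" where
  "Dmulti \<alpha> f = partials (dirs \<alpha>) f"

definition is_poly :: "(('n::finite \<Rightarrow> nat) \<Rightarrow> real) \<Rightarrow> bool" where
  "is_poly c \<longleftrightarrow> finite {\<alpha>. c \<alpha> \<noteq> 0}"

definition poly_eval :: "(('n::finite \<Rightarrow> nat) \<Rightarrow> real) \<Rightarrow> ('n \<Rightarrow> complex) \<Rightarrow> complex" where
  "poly_eval c z = (\<Sum>\<alpha>\<in>{\<alpha>. c \<alpha> \<noteq> 0}. complex_of_real (c \<alpha>) * (\<Prod>i\<in>UNIV. z i ^ \<alpha> i))"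

definition poly_diff_op :: "(('n::finite \<Rightarrow> nat) \<Rightarrow> real) \<Rightarrow> (real^'n \<Rightarrow> real) \<Rightarrow> real^'n \<Rightarrow> real" where
  "poly_diff_op c f x = (\<Sum>\<alpha>\<in>{\<alpha>. c \<alpha> \<noteq> 0}. c \<alpha> * Dmulti \<alpha> f x)"

definition symbol_ratio :: "(('n::finite \<Rightarrow> nat) \<Rightarrow> real) \<Rightarrow> (('n \<Rightarrow> nat) \<Rightarrow> real)
    \<Rightarrow> real^'n \<Rightarrow> real^'n \<Rightarrow> complex" where
  "symbol_ratio q p \<eta> \<xi> =
     poly_eval q (\<lambda>k. \<i> * of_real (\<xi>$k) + of_real (\<eta>$k)) /
     poly_eval p (\<lambda>k. \<i> * of_real (\<xi>$k) + of_real (\<eta>$k))"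

definition test_function :: "(real^'n::finite \<Rightarrow> real) \<Rightarrow> bool" where
  "test_function \<phi> \<longleftrightarrow>
     (\<exists>K. compact K \<and> (\<forall>x. x \<notin> K \<longrightarrow> \<phi> x = 0)) \<and>
     (\<forall>ks. continuous_on UNIV (partials ks \<phi>) \<and>
        (\<forall>i x. (\<lambda>t. partials ks \<phi> (x + t *\<^sub>R axis i 1)) differentiable (at 0)))"

definition locally_integrable :: "(real^'n::finite \<Rightarrow> real) \<Rightarrow> bool" where
  "locally_integrable G \<longleftrightarrow> G \<in> borel_measurable lborel \<and>
     (\<forall>K. compact K \<longrightarrow> set_integrable lborel K G)"

definition convolution :: "(real^'n::finite \<Rightarrow> real) \<Rightarrow> (real^'n \<Rightarrow> real) \<Rightarrow> real^'n \<Rightarrow> real" where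
  "convolution G \<phi> x = (\<integral>y. G (x - y) * \<phi> y \<partial>lborel)"

text \<open>G is a fundamental solution of p(D)u = q(D) delta_0.\<close>
definition fundamental_solution :: "(('n::finite \<Rightarrow> nat) \<Rightarrow> real) \<Rightarrow> (('n \<Rightarrow> nat) \<Rightarrow> real)
    \<Rightarrow> (real^'n \<Rightarrow> real) \<Rightarrow> bool" where
  "fundamental_solution p q G \<longleftrightarrow>
     (\<forall>\<phi>. test_function \<phi> \<longrightarrow> poly_diff_op p (convolution G \<phi>) = poly_diff_op q \<phi>)"

definition inv_fourier :: "(real^'n::finite \<Rightarrow> complex) \<Rightarrow> real^'n \<Rightarrow> complex" where
  "inv_fourier g t = complex_of_real (1 / (2 * pi) ^ CARD('n)) *
      (\<integral>x. exp (\<i> * complex_of_real (x \<bullet> t)) * g x \<partial>lborel)"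

definition L2_dist :: "(real^'n::finite \<Rightarrow> complex) \<Rightarrow> (real^'n \<Rightarrow> complex) \<Rightarrow> ennreal" where
  "L2_dist f g = (\<integral>\<^sup>+x. ennreal ((cmod (f x - g x))\<^sup>2) \<partial>lborel)"

text \<open>inv_fourier_L2 g G: G is (a representative of) the L2-inverse Fourier transform of g,
  obtained by extending from L1 \<inter> L2 (Plancherel).\<close>
definition inv_fourier_L2 :: "(real^'n::finite \<Rightarrow> complex) \<Rightarrow> (real^'n \<Rightarrow> complex) \<Rightarrow> bool" where
  "inv_fourier_L2 g G \<longleftrightarrow>
     g \<in> borel_measurable lborel \<and> G \<in> borel_measurable lborel \<and>
     (\<exists>gs. (\<forall>n. integrable lborel (gs n) \<and>
                 (\<integral>\<^sup>+x. ennreal ((cmod (gs n x))\<^sup>2) \<partial>lborel) < \<infinity>) \<and>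
           (\<lambda>n. L2_dist (gs n) g) \<longlonglongrightarrow> 0 \<and>
           (\<lambda>n. L2_dist (inv_fourier (gs n)) G) \<longlonglongrightarrow> 0)"

definition levy_measure :: "real measure \<Rightarrow> bool" where
  "levy_measure \<nu> \<longleftrightarrow> sets \<nu> = sets borel \<and> emeasure \<nu> {0} = 0 \<and>
     (\<integral>\<^sup>+x. ennreal (min 1 (x\<^sup>2)) \<partial>\<nu>) < \<infinity>"

definition levy_exponent :: "real \<Rightarrow> real \<Rightarrow> real measure \<Rightarrow> real \<Rightarrow> complex" where
  "levy_exponent a \<gamma> \<nu> z =
     \<i> * complex_of_real (\<gamma> * z) - complex_of_real (a * z\<^sup>2 / 2) +
     (\<integral>x. exp (\<i> * complex_of_real (x * z)) - 1
            - \<i> * complex_of_real (x * z * indicator {-1..1} x) \<partial>\<nu>)"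

definition bounded_borel :: "(real^'n::finite) set \<Rightarrow> bool" where
  "bounded_borel A \<longleftrightarrow> A \<in> sets lborel \<and> bounded A"

definition levy_basis :: "'w measure \<Rightarrow> ((real^'n::finite) set \<Rightarrow> 'w \<Rightarrow> real)
    \<Rightarrow> real \<Rightarrow> real \<Rightarrow> real measure \<Rightarrow> bool" where
  "levy_basis M L a \<gamma> \<nu> \<longleftrightarrow>
     prob_space M \<and> a \<ge> 0 \<and> levy_measure \<nu> \<and>
     (\<forall>A. bounded_borel A \<longrightarrow> L A \<in> borel_measurable M) \<and>
     (\<forall>(I::nat set) A. finite I \<and> (\<forall>i\<in>I. bounded_borel (A i)) \<and> disjoint_family_on A I \<longrightarrow>
         prob_space.indep_vars M (\<lambda>_. borel) (\<lambda>i. L (A i)) I) \<and>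
     (\<forall>A::nat \<Rightarrow> (real^'n) set. (\<forall>n. bounded_borel (A n)) \<and> disjoint_family A \<and>
         bounded (\<Union>n. A n) \<longrightarrow>
         (AE \<omega> in M. (\<lambda>n. L (A n) \<omega>) sums L (\<Union>n. A n) \<omega>)) \<and>
     (\<forall>A z. bounded_borel A \<longrightarrow>
         (\<integral>\<omega>. exp (\<i> * complex_of_real (z * L A \<omega>)) \<partial>M) =
         exp (levy_exponent a \<gamma> \<nu> z * complex_of_real (measure lborel A)))"

definition conv_in_prob :: "'w measure \<Rightarrow> (nat \<Rightarrow> 'w \<Rightarrow> real) \<Rightarrow> ('w \<Rightarrow> real) \<Rightarrow> bool" where
  "conv_in_prob M Y Z \<longleftrightarrow>
     (\<forall>n. Y n \<in> borel_measurable M) \<and> Z \<in> borel_measurable M \<and>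
     (\<forall>e>0. (\<lambda>n. measure M {\<omega>\<in>space M. \<bar>Y n \<omega> - Z \<omega>\<bar> > e}) \<longlonglongrightarrow> 0)"

definition simple_eval :: "(real \<times> (real^'n::finite) set) list \<Rightarrow> real^'n \<Rightarrow> real" where
  "simple_eval s x = (\<Sum>(c, B)\<leftarrow>s. c * indicator B x)"

definition simple_int :: "((real^'n::finite) set \<Rightarrow> 'w \<Rightarrow> real) \<Rightarrow> (real \<times> (real^'n) set) list
    \<Rightarrow> (real^'n) set \<Rightarrow> 'w \<Rightarrow> real" where
  "simple_int L s A \<omega> = (\<Sum>(c, B)\<leftarrow>s. c * L (A \<inter> B) \<omega>)"

text \<open>f is L-integrable in the sense of Rajput and Rosinski with integral Y.\<close>
definition rr_has_integral :: "'w measure \<Rightarrow> ((real^'n::finite) set \<Rightarrow> 'w \<Rightarrow> real)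
    \<Rightarrow> (real^'n \<Rightarrow> real) \<Rightarrow> ('w \<Rightarrow> real) \<Rightarrow> bool" where
  "rr_has_integral M L f Y \<longleftrightarrow>
     (\<exists>s :: nat \<Rightarrow> (real \<times> (real^'n) set) list.
        (\<forall>n. \<forall>(c, B)\<in>set (s n). bounded_borel B) \<and>
        (AE x in lborel. (\<lambda>n. simple_eval (s n) x) \<longlonglongrightarrow> f x) \<and>
        (\<forall>A\<in>sets lborel. \<exists>Z. conv_in_prob M (\<lambda>n. simple_int L (s n) A) Z) \<and>
        conv_in_prob M (\<lambda>n. simple_int L (s n) UNIV) Y)"

end

theory Submission
  imports Defs
    "HOL-Complex_Analysis.Complex_Analysis"
    "HOL-Computational_Algebra.Fundamental_Theorem_Algebra"
    "HOL-Real_Asymp.Real_Asymp"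
begin

text \<open>
  On almost every complex line parallel to a coordinate axis the symbol \<open>q / p\<close> is a rational function
  of one variable that is square integrable on a strip around the imaginary axis, hence free of poles there.
  Shifting the contour in one coordinate, with a Gaussian factor for convergence, shows that \<open>exp (- s x\<^sub>k) G(x)\<close>
  is up to regularisation the inverse Fourier transform of the shifted symbol. By the Plancherel
  inequality it is square integrable for \<open>\<bar>s\<bar> < \<epsilon>\<close>, so \<open>exp (c \<bar>x\<bar>) G(x)\<close> is integrable for some
  \<open>c > 0\<close>. Only real shifts along the axes are used, so no several variable complex analysis is needed.

  For the fundamental solution, Parseval's identity gives
  \<open>(2 \<pi>)\<^sup>d (G * p(D)\<phi>)(x) = \<integral> exp (i x \<bullet> \<xi>) q(i \<xi>) F\<phi>(\<xi>) d\<xi>\<close>, as \<open>p(i \<xi>) \<noteq> 0\<close> almost everywhere.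

  For the stochastic integral, the exponent of the Levy basis is dominated by a function of the modulus
  whose composition with \<open>G\<close> is integrable: jumps of size \<open>r > 1\<close> contribute the volume of a ball of
  radius proportional to \<open>log r\<close> and, outside of it, a constant by exponential decay. Dominated convergence
  in the exponent then makes the integrals of simple approximations Cauchy in probability.
\<close>

subsection \<open>Fourier transform and Plancherel inequality\<close>

text \<open>The hypothesis controls only square integrals, so the kernel is not given by an
  absolutely convergent integral. Every statement is therefore proved first for the symbol times a
  Gaussian factor, and the factor is removed at the end. Plancherel's inequality carries L2
  convergence of the symbols over to the kernels, and along a fast subsequence all errors lie below
  one square integrable function; the later limits are then instances of Fatou's lemma or dominated
  convergence. On the probabilistic side the jumps have only a logarithmic moment, so L may have no
  mean, and distances between integrals cannot be measured by moments. They are measured by the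
  expectation of \<open>1 - exp (- Y^2 / 2)\<close>, which tends to 0 exactly under convergence in
  probability and is an average of values of the characteristic function.\<close>

lemma nn_integral_lborel_affine:
  fixes t :: "'a::euclidean_space"
  assumes [measurable]: "f \<in> borel_measurable borel" and c: "c \<noteq> 0"
  shows "(\<integral>\<^sup>+x. f x \<partial>lborel) = ennreal (\<bar>c\<bar> ^ DIM('a)) * (\<integral>\<^sup>+x. f (t + c *\<^sub>R x) \<partial>lborel)"
  by (subst lborel_affine[OF c, of t])
     (simp add: nn_integral_density nn_integral_distr nn_integral_cmult)

lemma nn_integral_lborel_translate:
  fixes t :: "'a::euclidean_space"
  assumes "f \<in> borel_measurable borel"
  shows "(\<integral>\<^sup>+x. f (t + x) \<partial>lborel) = (\<integral>\<^sup>+x. f x \<partial>lborel)"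
  using nn_integral_lborel_affine[OF assms, of 1 t] by simp

lemma nn_integral_lborel_reflect:
  fixes t :: "'a::euclidean_space"
  assumes "f \<in> borel_measurable borel"
  shows "(\<integral>\<^sup>+x. f (t - x) \<partial>lborel) = (\<integral>\<^sup>+x. f x \<partial>lborel)"
  using nn_integral_lborel_affine[OF assms, of "-1" t] by simp

lemma integrable_lborel_affine:
  fixes t :: "'a::euclidean_space" and f :: "'a \<Rightarrow> 'b::{banach, second_countable_topology}"
  assumes f: "integrable lborel f" and c: "c \<noteq> 0"
  shows "integrable lborel (\<lambda>x. f (t + c *\<^sub>R x))"
  using f f[THEN borel_measurable_integrable] unfolding integrable_iff_bounded
  by (subst (asm) nn_integral_lborel_affine[OF _ c, of _ t])
     (auto simp: c ennreal_mult_less_top)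

lemma integral_lborel_affine:
  fixes t :: "'a::euclidean_space" and f :: "'a \<Rightarrow> 'b::{banach, second_countable_topology}"
  assumes [measurable]: "f \<in> borel_measurable borel" and c: "c \<noteq> 0"
  shows "(\<integral>x. f x \<partial>lborel) = (\<bar>c\<bar> ^ DIM('a)) *\<^sub>R (\<integral>x. f (t + c *\<^sub>R x) \<partial>lborel)"
  by (subst lborel_affine[OF c, of t]) (simp add: integral_density integral_distr)

lemma integral_lborel_prod:
  fixes f :: "'a::euclidean_space \<Rightarrow> real \<Rightarrow> 'b::{real_normed_field, banach, second_countable_topology}"
  assumes f: "\<And>b. b \<in> Basis \<Longrightarrow> integrable lborel (f b)"
  shows "integrable lborel (\<lambda>x::'a. \<Prod>b\<in>Basis. f b (x \<bullet> b))"
    and "(\<integral>(x::'a). (\<Prod>b\<in>Basis. f b (x \<bullet> b)) \<partial>lborel) = (\<Prod>b\<in>Basis. (\<integral>x. f b x \<partial>lborel))"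
proof -
  interpret product_sigma_finite "\<lambda>_::'a. lborel :: real measure" ..
  have [measurable]: "b \<in> Basis \<Longrightarrow> f b \<in> borel_measurable borel" for b
    using borel_measurable_integrable[OF f] by simp
  have eq: "(\<Prod>b\<in>Basis. f b ((\<Sum>c\<in>Basis. x c *\<^sub>R c) \<bullet> b)) = (\<Prod>b\<in>Basis. f b (x b))" for x :: "'a \<Rightarrow> real"
    by (rule prod.cong) auto
  show "integrable lborel (\<lambda>x::'a. \<Prod>b\<in>Basis. f b (x \<bullet> b))"
    using product_integrable_prod[of "Basis::'a set" f] f
    by (subst lborel_eq, subst integrable_distr_eq) (simp_all add: eq)
  show "(\<integral>(x::'a). (\<Prod>b\<in>Basis. f b (x \<bullet> b)) \<partial>lborel) = (\<Prod>b\<in>Basis. (\<integral>x. f b x \<partial>lborel))"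
    using product_integral_prod[of "Basis::'a set" f] f
    by (subst lborel_eq, subst integral_distr) (simp_all add: eq)
qed

text \<open>Fatou's lemma in the form used for regularisations: a bound uniform in \<open>n\<close>
  survives in the almost everywhere limit. It serves Plancherel's inequality, the weighted bounds on
  the kernel and the limit in probability.\<close>

lemma nn_integral_le_of_tendsto:
  fixes u :: "nat \<Rightarrow> 'a \<Rightarrow> ennreal"
  assumes [measurable]: "\<And>n. u n \<in> borel_measurable M"
    and lim: "AE x in M. (\<lambda>n. u n x) \<longlonglongrightarrow> v x"
    and le: "\<And>n. (\<integral>\<^sup>+x. u n x \<partial>M) \<le> C"
  shows "(\<integral>\<^sup>+x. v x \<partial>M) \<le> C"
proof -
  have "(\<integral>\<^sup>+x. v x \<partial>M) = (\<integral>\<^sup>+x. liminf (\<lambda>n. u n x) \<partial>M)"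
    using lim by (intro nn_integral_cong_AE) (auto elim!: eventually_mono dest: lim_imp_Liminf[rotated])
  also have "\<dots> \<le> liminf (\<lambda>n. \<integral>\<^sup>+x. u n x \<partial>M)"
    by (rule nn_integral_liminf) simp
  also have "\<dots> \<le> C"
    by (rule Liminf_le) (use le in \<open>auto\<close>)
  finally show ?thesis .
qed

text \<open>Since the Bochner integral of a non-integrable function is 0, the bound holds for every
  \<open>f\<close>. The jump part of \<open>levy_exponent\<close> can thus be estimated before
  anything is known about its integrability.\<close>

lemma norm_integral_le_nn_integral:
  fixes f :: "'a \<Rightarrow> 'b::{banach, second_countable_topology}"
  shows "ennreal (norm (integral\<^sup>L M f)) \<le> (\<integral>\<^sup>+x. ennreal (norm (f x)) \<partial>M)"
  by (cases "integrable M f") (auto simp: integral_norm_bound_ennreal not_integrable_integral_eq)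

section \<open>Gaussians, Plancherel's inequality and Fourier inversion\<close>

definition gauss :: "'a::euclidean_space \<Rightarrow> real" where
  "gauss x = exp (- (norm x)\<^sup>2 / 2)"

text \<open>The exponent has a plus sign and there is no normalising factor: this is
  \<open>(2 * pi) ^ d\<close> times the inverse transform, and the forward transform of \<phi> at
  \<xi> appears as \<open>ft \<phi> (- \<xi>)\<close>.\<close>

definition ft :: "('a::euclidean_space \<Rightarrow> complex) \<Rightarrow> 'a \<Rightarrow> complex" where
  "ft g t = (\<integral>x. iexp (x \<bullet> t) * g x \<partial>lborel)"

lemma gauss_pos [simp]: "gauss x > 0" "gauss x \<ge> 0"
  by (auto simp: gauss_def)

lemma gauss_le_1 [simp]: "gauss x \<le> 1"
  by (auto simp: gauss_def)

lemma gauss_minus [simp]: "gauss (- x) = gauss x"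
  by (simp add: gauss_def)

lemma gauss_0 [simp]: "gauss 0 = 1"
  by (simp add: gauss_def)

lemma continuous_gauss [continuous_intros]:
  "continuous_on S f \<Longrightarrow> continuous_on S (\<lambda>x. gauss (f x))"
  unfolding gauss_def by (intro continuous_intros) auto

lemma borel_measurable_gauss [measurable]: "gauss \<in> borel_measurable borel"
  by (intro borel_measurable_continuous_onI continuous_intros)

lemma borel_measurable_iexp [measurable]: "(\<lambda>x. iexp x) \<in> borel_measurable borel"
  by (intro borel_measurable_continuous_onI continuous_intros)

lemma borel_measurable_cnj [measurable]:
  "f \<in> borel_measurable M \<Longrightarrow> (\<lambda>x. cnj (f x)) \<in> borel_measurable M"
  by (rule measurable_compose[of f M borel]) (auto intro!: borel_measurable_continuous_onI continuous_intros)

lemma gauss_prod: "gauss x = (\<Prod>b\<in>Basis. exp (- (x \<bullet> b)\<^sup>2 / 2))"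
proof -
  have "- (norm x)\<^sup>2 / 2 = (\<Sum>b\<in>Basis. - (x \<bullet> b)\<^sup>2 / 2)"
    unfolding power2_norm_eq_inner euclidean_inner[of x x]
    by (simp add: sum_negf power2_eq_square flip: sum_divide_distrib)
  then show ?thesis by (simp add: gauss_def exp_sum)
qed

text \<open>Read off from the characteristic function of the standard normal distribution.\<close>

lemma fourier_gauss_real:
  "integrable lborel (\<lambda>x. iexp (x * t) * complex_of_real (exp (- x\<^sup>2 / 2)))"
  "(\<integral>x. iexp (x * t) * complex_of_real (exp (- x\<^sup>2 / 2)) \<partial>lborel) = sqrt (2 * pi) * exp (- t\<^sup>2 / 2)"
proof -
  have eq: "exp (- x\<^sup>2 / 2) = sqrt (2 * pi) * std_normal_density x" for x
    by (simp add: normal_density_def)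
  have "integrable lborel (\<lambda>x. std_normal_density x)" by simp
  then have "integrable lborel (\<lambda>x. sqrt (2 * pi) * std_normal_density x)" by simp
  then have i: "integrable lborel (\<lambda>x. exp (- x\<^sup>2 / 2) :: real)" unfolding eq .
  show "integrable lborel (\<lambda>x. iexp (x * t) * complex_of_real (exp (- x\<^sup>2 / 2)))"
    by (rule Bochner_Integration.integrable_bound[OF i]) (auto simp: norm_mult)
  have "complex_of_real (exp (- (t^2) / 2)) = char std_normal_distribution t"
    by (simp add: char_std_normal_distribution)
  also have "\<dots> = (\<integral>x. std_normal_density x *\<^sub>R iexp (t * x) \<partial>lborel)"
    unfolding char_def by (subst integral_density) auto
  finally have 1: "complex_of_real (exp (- (t^2) / 2)) = (\<integral>x. std_normal_density x *\<^sub>R iexp (t * x) \<partial>lborel)" .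
  have "(\<integral>x. iexp (x * t) * complex_of_real (exp (- x\<^sup>2 / 2)) \<partial>lborel)
      = (\<integral>x. sqrt (2 * pi) * (std_normal_density x *\<^sub>R iexp (t * x)) \<partial>lborel)"
    unfolding eq by (simp add: scaleR_conv_of_real mult_ac)
  also have "\<dots> = sqrt (2 * pi) * exp (- t\<^sup>2 / 2)"
    by (subst integral_mult_right_zero, subst 1[symmetric]) simp
  finally show "(\<integral>x. iexp (x * t) * complex_of_real (exp (- x\<^sup>2 / 2)) \<partial>lborel) = sqrt (2 * pi) * exp (- t\<^sup>2 / 2)" .
qed

text \<open>The total mass of \<open>gauss\<close>; its square is the constant of the inversion
  formula.\<close>

definition gconst :: "'a::euclidean_space itself \<Rightarrow> real" where
  "gconst _ = sqrt (2 * pi) ^ DIM('a)"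

lemma gconst_pos: "gconst TYPE('a::euclidean_space) > 0"
  by (simp add: gconst_def)

lemma gconst_square: "gconst TYPE('a::euclidean_space) * gconst TYPE('a) = (2 * pi) ^ DIM('a)"
  unfolding gconst_def power_mult_distrib[symmetric] by simp

lemma ft_gauss_aux:
  fixes \<xi> :: "'a::euclidean_space"
  shows "integrable lborel (\<lambda>x::'a. iexp (x \<bullet> \<xi>) * complex_of_real (gauss x))"
    and "ft (\<lambda>x. complex_of_real (gauss x)) \<xi> = gconst TYPE('a) * gauss \<xi>"
proof -
  have eq: "iexp (x \<bullet> \<xi>) * complex_of_real (gauss x)
      = (\<Prod>b\<in>Basis. iexp ((x \<bullet> b) * (\<xi> \<bullet> b)) * complex_of_real (exp (- (x \<bullet> b)\<^sup>2 / 2)))" for x :: 'a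
    unfolding prod.distrib gauss_prod euclidean_inner[of x \<xi>]
    by (simp add: exp_sum sum_distrib_left)
  show "integrable lborel (\<lambda>x::'a. iexp (x \<bullet> \<xi>) * complex_of_real (gauss x))"
    unfolding eq by (rule integral_lborel_prod(1)[OF fourier_gauss_real(1)])
  show "ft (\<lambda>x. complex_of_real (gauss x)) \<xi> = gconst TYPE('a) * gauss \<xi>"
    unfolding ft_def eq
    by (subst integral_lborel_prod(2)[OF fourier_gauss_real(1)], subst fourier_gauss_real(2))
      (simp add: prod.distrib gconst_def gauss_prod[of \<xi>])
qed

lemma integrable_gauss [simp, intro]: "integrable lborel (\<lambda>x::'a::euclidean_space. gauss x)"
  using integrable_norm[OF ft_gauss_aux(1)[of "0::'a"]] by (simp add: norm_mult)

lemma integrable_gauss_scale [intro]: 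
  "c \<noteq> 0 \<Longrightarrow> integrable lborel (\<lambda>x::'a::euclidean_space. gauss (c *\<^sub>R x))"
  using integrable_lborel_affine[OF integrable_gauss, of c "0::'a"] by simp

lemma integral_gauss: "(\<integral>x. gauss (x::'a::euclidean_space) \<partial>lborel) = gconst TYPE('a)"
proof -
  have "complex_of_real (\<integral>x. gauss (x::'a) \<partial>lborel) = gconst TYPE('a)"
    using ft_gauss_aux(2)[of "0::'a"] by (simp add: ft_def)
  then show ?thesis using of_real_eq_iff by blast
qed

lemma ft_gauss_scale:
  fixes \<xi> :: "'a::euclidean_space"
  assumes "\<sigma> > 0"
  shows "ft (\<lambda>x. complex_of_real (gauss (\<sigma> *\<^sub>R x))) \<xi> = gconst TYPE('a) / \<sigma> ^ DIM('a) * gauss (\<xi> /\<^sub>R \<sigma>)"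
proof -
  have "ft (\<lambda>x. complex_of_real (gauss x)) (\<xi> /\<^sub>R \<sigma>) = 
     \<bar>\<sigma>\<bar> ^ DIM('a) *\<^sub>R (\<integral>x. iexp ((0 + \<sigma> *\<^sub>R x) \<bullet> (\<xi> /\<^sub>R \<sigma>)) * complex_of_real (gauss (0 + \<sigma> *\<^sub>R x)) \<partial>lborel)"
    unfolding ft_def by (subst integral_lborel_affine[of _ \<sigma> 0]) (use assms in auto)
  also have "\<dots> = \<sigma> ^ DIM('a) * ft (\<lambda>x. complex_of_real (gauss (\<sigma> *\<^sub>R x))) \<xi>"
    using assms by (simp add: ft_def scaleR_conv_of_real flip: mult.assoc)
  finally show ?thesis using assms by (simp add: ft_gauss_aux field_simps)
qed

lemma ft_integrable: 
  "integrable lborel g \<Longrightarrow> integrable lborel (\<lambda>x. iexp (x \<bullet> t) * g x)"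
  by (rule Bochner_Integration.integrable_bound) (auto simp: norm_mult)

lemma ft_bound:
  assumes "integrable lborel g" shows "cmod (ft g t) \<le> (\<integral>x. cmod (g x) \<partial>lborel)"
  unfolding ft_def by (rule order_trans[OF integral_norm_bound]) (simp add: norm_mult)

lemma ft_measurable [measurable]:
  assumes [measurable]: "g \<in> borel_measurable borel"
  shows "ft g \<in> borel_measurable borel"
  unfolding ft_def by measurable

text \<open>Both sides are iterated integrals of \<open>u x * g y * iexp (y \<bullet> x)\<close>.
  Plancherel's inequality, inversion and the Parseval identity for convolutions all reduce to this
  exchange.\<close>

lemma fourier_swap:
  fixes g u :: "'a::euclidean_space \<Rightarrow> complex"
  assumes g: "integrable lborel g" and u: "integrable lborel u"
  shows "(\<integral>x. u x * ft g x \<partial>lborel) = (\<integral>y. g y * ft u y \<partial>lborel)"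
proof -
  have [measurable]: "g \<in> borel_measurable borel" "u \<in> borel_measurable borel"
    using g u by auto
  have int: "integrable (lborel \<Otimes>\<^sub>M lborel) (\<lambda>(x,y). u x * (iexp (y \<bullet> x) * g y))"
  proof (rule lborel_pair.Fubini_integrable)
    show "integrable lborel (\<lambda>x. LINT y|lborel. norm (case (x, y) of (x, y) \<Rightarrow> u x * (iexp (y \<bullet> x) * g y)))"
      using u by (simp add: norm_mult)
    show "AE x in lborel. integrable lborel (\<lambda>y. case (x, y) of (x, y) \<Rightarrow> u x * (iexp (y \<bullet> x) * g y))"
      using ft_integrable[OF g] by simp
  qed measurable
  have "(\<integral>x. u x * ft g x \<partial>lborel) = (\<integral>x. \<integral>y. u x * (iexp (y \<bullet> x) * g y) \<partial>lborel \<partial>lborel)"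
    by (simp add: ft_def)
  also have "\<dots> = (\<integral>y. \<integral>x. u x * (iexp (y \<bullet> x) * g y) \<partial>lborel \<partial>lborel)"
    using lborel_pair.Fubini_integral[OF int] by simp
  also have "\<dots> = (\<integral>y. g y * ft u y \<partial>lborel)"
    unfolding ft_def integral_mult_right_zero[symmetric]
    by (simp add: mult_ac inner_commute)
  finally show ?thesis .
qed

text \<open>The Gaussian factor turns the quadratic form in \<open>g\<close> into one with a positive kernel
  of constant row sums, to which the arithmetic-geometric mean inequality applies.\<close>
lemma plancherel_regularised:
  fixes g :: "'a::euclidean_space \<Rightarrow> complex"
  assumes g: "integrable lborel g" and "\<sigma> > 0"
  shows "(\<integral>\<^sup>+x. ennreal (gauss (\<sigma> *\<^sub>R x) * (cmod (ft g x))\<^sup>2) \<partial>lborel)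
     \<le> ennreal ((2 * pi) ^ DIM('a)) * (\<integral>\<^sup>+x. ennreal ((cmod (g x))\<^sup>2) \<partial>lborel)"
proof -
  \<comment> \<open>By \<open>ft_gauss_scale\<close>, \<open>k\<close> is the transform of the
    dilated Gaussian. Its integral is \<open>gconst\<close> squared, that is
    \<open>(2 * pi) ^ d\<close>, whatever \<sigma> is.\<close>
  define k :: "'a \<Rightarrow> real" where "k = (\<lambda>u. gconst TYPE('a) / \<sigma> ^ DIM('a) * gauss (u /\<^sub>R \<sigma>))"
  have k0: "k x \<ge> 0" for x
    using \<open>\<sigma> > 0\<close> gconst_pos[where 'a='a] by (simp add: k_def)
  have [measurable]: "k \<in> borel_measurable borel" unfolding k_def by measurable
  have [measurable]: "g \<in> borel_measurable borel" using g by auto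
  have ik: "(\<integral>\<^sup>+y. ennreal (k (y - x)) \<partial>lborel) = (2 * pi) ^ DIM('a)"
    "(\<integral>\<^sup>+y. ennreal (k (x - y)) \<partial>lborel) = (2 * pi) ^ DIM('a)" for x
  proof -
    have "(\<integral>\<^sup>+y. ennreal (k (y - x)) \<partial>lborel)
      = ennreal (\<bar>\<sigma>\<bar> ^ DIM('a)) * (\<integral>\<^sup>+y. ennreal (k (x + \<sigma> *\<^sub>R y - x)) \<partial>lborel)"
      using \<open>\<sigma> > 0\<close> by (subst nn_integral_lborel_affine[of _ \<sigma> x]) auto
    also have "\<dots> = (\<integral>\<^sup>+(y::'a). ennreal (gconst TYPE('a)) * ennreal (gauss y) \<partial>lborel)"
      using \<open>\<sigma> > 0\<close> gconst_pos[where 'a='a]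
      by (auto simp: k_def simp flip: nn_integral_cmult ennreal_mult intro!: nn_integral_cong)
    also have "\<dots> = ennreal (gconst TYPE('a)) * ennreal (gconst TYPE('a))"
      by (subst nn_integral_cmult) (auto simp: nn_integral_eq_integral integral_gauss)
    finally show *: "(\<integral>\<^sup>+y. ennreal (k (y - x)) \<partial>lborel) = (2 * pi) ^ DIM('a)"
      using gconst_pos[where 'a='a] by (simp add: ennreal_mult[symmetric] gconst_square)
    have "k (x - y) = k (y - x)" for y
      unfolding k_def by (simp add: gauss_def norm_minus_commute)
    then show "(\<integral>\<^sup>+y. ennreal (k (x - y)) \<partial>lborel) = (2 * pi) ^ DIM('a)" using * by simp
  qed
  define B where "B = (\<integral>x. cmod (g x) \<partial>lborel)"
  have B: "cmod (ft g x) \<le> B" for x unfolding B_def by (rule ft_bound[OF g])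
  then have B0: "B \<ge> 0" using norm_ge_zero order_trans by blast
  have ig: "integrable lborel (\<lambda>x::'a. gauss (\<sigma> *\<^sub>R x))" using \<open>\<sigma> > 0\<close> by auto
  have igc: "integrable lborel (\<lambda>x::'a. B * gauss (\<sigma> *\<^sub>R x))" using ig by simp
  have i1: "integrable lborel (\<lambda>x. gauss (\<sigma> *\<^sub>R x) * cnj (ft g x))"
    by (rule Bochner_Integration.integrable_bound[OF igc])
       (use B B0 in \<open>auto simp: norm_mult mult.commute intro!: mult_right_mono\<close>)
  \<comment> \<open>A factor \<open>cnj (iexp (x \<bullet> \<xi>))\<close> translates a transform by
    \<xi>, so the outer transform becomes an integral of \<open>g\<close> against a translate of
    \<open>k\<close>.\<close>
  have inner: "ft (\<lambda>x. gauss (\<sigma> *\<^sub>R x) * cnj (ft g x)) \<xi> = cnj (\<integral>y. g y * k (y - \<xi>) \<partial>lborel)" for \<xi>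
  proof -
    have i2: "integrable lborel (\<lambda>x. cnj (iexp (x \<bullet> \<xi>)) * gauss (\<sigma> *\<^sub>R x))"
      by (rule Bochner_Integration.integrable_bound[OF ig]) (auto simp: norm_mult)
    have "ft (\<lambda>x. gauss (\<sigma> *\<^sub>R x) * cnj (ft g x)) \<xi> = 
       cnj (\<integral>x. cnj (iexp (x \<bullet> \<xi>)) * gauss (\<sigma> *\<^sub>R x) * ft g x \<partial>lborel)"
      unfolding ft_def[of "\<lambda>x. gauss (\<sigma> *\<^sub>R x) * cnj (ft g x)"]
      by (rule trans[OF _ Bochner_Integration.integral_cnj]) (simp add: mult_ac)
    also have "(\<integral>x. cnj (iexp (x \<bullet> \<xi>)) * gauss (\<sigma> *\<^sub>R x) * ft g x \<partial>lborel)
      = (\<integral>y. g y * ft (\<lambda>x. cnj (iexp (x \<bullet> \<xi>)) * gauss (\<sigma> *\<^sub>R x)) y \<partial>lborel)"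
      by (rule fourier_swap[OF g i2])
    also have "\<dots> = (\<integral>y. g y * k (y - \<xi>) \<partial>lborel)"
    proof (intro Bochner_Integration.integral_cong refl arg_cong2[where f="(*)"])
      fix y
      have "ft (\<lambda>x. cnj (iexp (x \<bullet> \<xi>)) * gauss (\<sigma> *\<^sub>R x)) y = ft (\<lambda>x. complex_of_real (gauss (\<sigma> *\<^sub>R x))) (y - \<xi>)"
        unfolding ft_def by (intro Bochner_Integration.integral_cong refl)
          (simp add: exp_cnj inner_diff_right ring_distribs flip: exp_add mult.assoc)
      then show "ft (\<lambda>x. cnj (iexp (x \<bullet> \<xi>)) * gauss (\<sigma> *\<^sub>R x)) y = k (y - \<xi>)"
        using \<open>\<sigma> > 0\<close> by (simp add: ft_gauss_scale k_def)
    qed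
    finally show ?thesis .
  qed
  have i3: "integrable lborel (\<lambda>x. gauss (\<sigma> *\<^sub>R x) * (cmod (ft g x))\<^sup>2)"
  proof (rule Bochner_Integration.integrable_bound[OF integrable_mult_right[OF ig, of "B\<^sup>2"]])
    show "AE x in lborel. norm (gauss (\<sigma> *\<^sub>R x) * (cmod (ft g x))\<^sup>2) \<le> norm (B\<^sup>2 * gauss (\<sigma> *\<^sub>R x))"
      using B by (auto simp: abs_mult mult.commute[of _ "(cmod _)\<^sup>2"] intro!: mult_right_mono power_mono)
  qed auto
  have "complex_of_real (\<integral>x. gauss (\<sigma> *\<^sub>R x) * (cmod (ft g x))\<^sup>2 \<partial>lborel)
     = (\<integral>x. gauss (\<sigma> *\<^sub>R x) * cnj (ft g x) * ft g x \<partial>lborel)"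
    by (subst integral_complex_of_real[symmetric])
      (simp add: complex_norm_square mult_ac del: of_real_power)
  also have "\<dots> = (\<integral>y. g y * cnj (\<integral>z. g z * k (z - y) \<partial>lborel) \<partial>lborel)"
    by (subst fourier_swap[OF g i1]) (simp add: inner)
  finally have eq: "complex_of_real (\<integral>x. gauss (\<sigma> *\<^sub>R x) * (cmod (ft g x))\<^sup>2 \<partial>lborel)
     = (\<integral>y. g y * cnj (\<integral>z. g z * k (z - y) \<partial>lborel) \<partial>lborel)" .
  have "(\<integral>\<^sup>+x. ennreal (gauss (\<sigma> *\<^sub>R x) * (cmod (ft g x))\<^sup>2) \<partial>lborel)
    = ennreal (\<integral>x. gauss (\<sigma> *\<^sub>R x) * (cmod (ft g x))\<^sup>2 \<partial>lborel)"
    by (rule nn_integral_eq_integral[OF i3]) auto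
  also have "\<dots> \<le> ennreal (cmod (complex_of_real (\<integral>x. gauss (\<sigma> *\<^sub>R x) * (cmod (ft g x))\<^sup>2 \<partial>lborel)))"
    by (intro ennreal_leI) auto
  also have "\<dots> = ennreal (norm (\<integral>y. g y * cnj (\<integral>z. g z * k (z - y) \<partial>lborel) \<partial>lborel))" by (subst eq) simp
  also have "\<dots> \<le> (\<integral>\<^sup>+y. ennreal (norm (g y * cnj (\<integral>z. g z * k (z - y) \<partial>lborel))) \<partial>lborel)"
    by (rule norm_integral_le_nn_integral)
  also have "\<dots> \<le> (\<integral>\<^sup>+y. ennreal (cmod (g y)) * (\<integral>\<^sup>+z. ennreal (cmod (g z) * k (z - y)) \<partial>lborel) \<partial>lborel)"
    by (intro nn_integral_mono)
      (auto simp: norm_mult ennreal_mult k0 intro!: mult_left_mono order_trans[OF norm_integral_le_nn_integral])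
  also have "\<dots> = (\<integral>\<^sup>+y. (\<integral>\<^sup>+z. ennreal (cmod (g y) * cmod (g z) * k (z - y)) \<partial>lborel) \<partial>lborel)"
    by (subst nn_integral_cmult[symmetric]) (auto simp: ennreal_mult k0 mult_ac)
  also have "\<dots> \<le> (\<integral>\<^sup>+y. (\<integral>\<^sup>+z. ennreal ((cmod (g y))\<^sup>2 / 2) * ennreal (k (z - y)) + ennreal ((cmod (g z))\<^sup>2 / 2) * ennreal (k (z - y)) \<partial>lborel) \<partial>lborel)"
  proof (intro nn_integral_mono)
    fix y z
    have "cmod (g y) * cmod (g z) \<le> (cmod (g y))\<^sup>2 / 2 + (cmod (g z))\<^sup>2 / 2"
      using sum_squares_bound[of "cmod (g y)" "cmod (g z)"] by simp
    then have "cmod (g y) * cmod (g z) * k (z - y) \<le> ((cmod (g y))\<^sup>2 / 2 + (cmod (g z))\<^sup>2 / 2) * k (z - y)"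
      by (intro mult_right_mono k0)
    then have "ennreal (cmod (g y) * cmod (g z) * k (z - y)) \<le> ennreal ((cmod (g y))\<^sup>2 / 2 + (cmod (g z))\<^sup>2 / 2) * ennreal (k (z - y))"
      using k0 by (subst ennreal_mult[symmetric]) (auto intro: ennreal_leI)
    then show "ennreal (cmod (g y) * cmod (g z) * k (z - y)) \<le>
        ennreal ((cmod (g y))\<^sup>2 / 2) * ennreal (k (z - y)) + ennreal ((cmod (g z))\<^sup>2 / 2) * ennreal (k (z - y))"
      by (subst (asm) ennreal_plus) (auto simp: distrib_right)
  qed
  also have "\<dots> = (\<integral>\<^sup>+y. (\<integral>\<^sup>+z. ennreal ((cmod (g y))\<^sup>2 / 2) * ennreal (k (z - y)) \<partial>lborel) \<partial>lborel)
      + (\<integral>\<^sup>+y. (\<integral>\<^sup>+z. ennreal ((cmod (g z))\<^sup>2 / 2) * ennreal (k (z - y)) \<partial>lborel) \<partial>lborel)"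
    by (simp add: nn_integral_add)
  also have "(\<integral>\<^sup>+y. (\<integral>\<^sup>+z. ennreal ((cmod (g z))\<^sup>2 / 2) * ennreal (k (z - y)) \<partial>lborel) \<partial>lborel)
    = (\<integral>\<^sup>+z. (\<integral>\<^sup>+y. ennreal ((cmod (g z))\<^sup>2 / 2) * ennreal (k (z - y)) \<partial>lborel) \<partial>lborel)"
    by (rule lborel_pair.Fubini') simp
  finally have "(\<integral>\<^sup>+x. ennreal (gauss (\<sigma> *\<^sub>R x) * (cmod (ft g x))\<^sup>2) \<partial>lborel)
    \<le> ennreal ((2 * pi) ^ DIM('a)) * (\<integral>\<^sup>+x. ennreal ((cmod (g x))\<^sup>2 / 2) \<partial>lborel)
    + ennreal ((2 * pi) ^ DIM('a)) * (\<integral>\<^sup>+x. ennreal ((cmod (g x))\<^sup>2 / 2) \<partial>lborel)"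
    by (simp add: nn_integral_cmult ik nn_integral_multc mult.commute)
  also have "\<dots> = ennreal ((2 * pi) ^ DIM('a)) * (\<integral>\<^sup>+x. ennreal ((cmod (g x))\<^sup>2) \<partial>lborel)"
    by (subst distrib_left[symmetric], subst nn_integral_add[symmetric])
       (simp_all add: ennreal_plus[symmetric] del: ennreal_plus)
  finally show ?thesis .
qed

lemma plancherel_le:
  fixes g :: "'a::euclidean_space \<Rightarrow> complex"
  assumes g: "integrable lborel g"
  shows "(\<integral>\<^sup>+x. ennreal ((cmod (ft g x))\<^sup>2) \<partial>lborel)
     \<le> ennreal ((2 * pi) ^ DIM('a)) * (\<integral>\<^sup>+x. ennreal ((cmod (g x))\<^sup>2) \<partial>lborel)"
proof (rule nn_integral_le_of_tendsto)
  have [measurable]: "g \<in> borel_measurable borel" using g by auto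
  fix n :: nat
  show "(\<lambda>x. ennreal (gauss ((1 / real (Suc n)) *\<^sub>R x) * (cmod (ft g x))\<^sup>2)) \<in> borel_measurable lborel"
    by measurable
  show "(\<integral>\<^sup>+x. ennreal (gauss ((1 / real (Suc n)) *\<^sub>R x) * (cmod (ft g x))\<^sup>2) \<partial>lborel)
     \<le> ennreal ((2 * pi) ^ DIM('a)) * (\<integral>\<^sup>+x. ennreal ((cmod (g x))\<^sup>2) \<partial>lborel)"
    by (rule plancherel_regularised[OF g]) simp
next
  have "(\<lambda>n. gauss ((1 / real (Suc n)) *\<^sub>R x) * (cmod (ft g x))\<^sup>2) \<longlonglongrightarrow> gauss (0 *\<^sub>R x) * (cmod (ft g x))\<^sup>2" for x
    unfolding gauss_def by (intro tendsto_intros LIMSEQ_Suc[OF lim_1_over_n]) auto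
  then show "AE x in lborel. (\<lambda>n. ennreal (gauss ((1 / real (Suc n)) *\<^sub>R x) * (cmod (ft g x))\<^sup>2))
     \<longlonglongrightarrow> ennreal ((cmod (ft g x))\<^sup>2)"
    by (auto intro!: tendsto_ennrealI)
qed

text \<open>With a Gaussian factor the integral becomes, by \<open>fourier_swap\<close>, an average
  of \<phi> over \<open>x + s n *\<^sub>R u\<close> against \<open>gauss u\<close>. As
  \<open>s n\<close> tends to 0 the average tends to \<open>\<phi> x\<close> times the mass of
  \<open>gauss\<close>; the transform of the Gaussian contributes the second factor
  \<open>gconst\<close>.\<close>

lemma fourier_inversion:
  fixes \<phi> :: "'a::euclidean_space \<Rightarrow> complex"
  assumes \<phi>: "integrable lborel \<phi>" and cont: "continuous_on UNIV \<phi>" and bd: "\<And>x. cmod (\<phi> x) \<le> B"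
    and int: "integrable lborel (ft \<phi>)"
  shows "(\<integral>\<xi>. iexp (\<xi> \<bullet> x) * ft \<phi> (- \<xi>) \<partial>lborel) = (2 * pi) ^ DIM('a) * \<phi> x"
proof (rule LIMSEQ_unique)
  have [measurable]: "\<phi> \<in> borel_measurable borel" using \<phi> by auto
  define s where "s = (\<lambda>n. 1 / real (Suc n))"
  have s: "s \<longlonglongrightarrow> 0" unfolding s_def by (rule LIMSEQ_Suc[OF lim_1_over_n])
  have s0: "s n > 0" for n by (simp add: s_def)
  have intm: "integrable lborel (\<lambda>\<xi>. ft \<phi> (- \<xi>))"
    using integrable_lborel_affine[OF int, of "-1" 0] by simp
  define J where "J n = (\<integral>\<xi>. gauss (s n *\<^sub>R \<xi>) * (iexp (\<xi> \<bullet> x) * ft \<phi> (- \<xi>)) \<partial>lborel)" for n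
  show "J \<longlonglongrightarrow> (\<integral>\<xi>. iexp (\<xi> \<bullet> x) * ft \<phi> (- \<xi>) \<partial>lborel)"
    unfolding J_def
  proof (rule integral_dominated_convergence[where w="\<lambda>\<xi>. cmod (ft \<phi> (- \<xi>))"])
    have "(\<lambda>n. gauss (s n *\<^sub>R \<xi>) * (iexp (\<xi> \<bullet> x) * ft \<phi> (- \<xi>))) \<longlonglongrightarrow> gauss (0 *\<^sub>R \<xi>) * (iexp (\<xi> \<bullet> x) * ft \<phi> (- \<xi>))" for \<xi>
      unfolding gauss_def by (intro tendsto_intros s) auto
    then show "AE \<xi> in lborel. (\<lambda>n. gauss (s n *\<^sub>R \<xi>) * (iexp (\<xi> \<bullet> x) * ft \<phi> (- \<xi>))) \<longlonglongrightarrow> iexp (\<xi> \<bullet> x) * ft \<phi> (- \<xi>)"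
      by simp
  qed (use intm in \<open>auto simp: norm_mult intro!: mult_left_le_one_le\<close>)
  have J: "J n = gconst TYPE('a) * (\<integral>u. \<phi> (x + s n *\<^sub>R u) * gauss u \<partial>lborel)" for n
  proof -
    have ig: "integrable lborel (\<lambda>\<xi>. gauss (s n *\<^sub>R \<xi>) * iexp (- (\<xi> \<bullet> x)))"
      by (rule Bochner_Integration.integrable_bound[OF integrable_gauss_scale[of "s n"]])
        (use s0[of n] in \<open>auto simp: norm_mult\<close>)
    have "J n = (\<integral>\<xi>. gauss (s n *\<^sub>R \<xi>) * (iexp (- (\<xi> \<bullet> x)) * ft \<phi> \<xi>) \<partial>lborel)"
      unfolding J_def by (subst integral_lborel_affine[of _ "-1" 0]) auto
    also have "\<dots> = (\<integral>y. \<phi> y * ft (\<lambda>\<xi>. gauss (s n *\<^sub>R \<xi>) * iexp (- (\<xi> \<bullet> x))) y \<partial>lborel)"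
      using fourier_swap[OF \<phi> ig] by (simp add: mult.assoc)
    also have "\<dots> = (\<integral>y. \<phi> y * (gconst TYPE('a) / s n ^ DIM('a) * gauss ((y - x) /\<^sub>R s n)) \<partial>lborel)"
    proof (intro Bochner_Integration.integral_cong refl arg_cong2[where f="(*)"])
      fix y
      have "ft (\<lambda>\<xi>. gauss (s n *\<^sub>R \<xi>) * iexp (- (\<xi> \<bullet> x))) y = ft (\<lambda>\<xi>. complex_of_real (gauss (s n *\<^sub>R \<xi>))) (y - x)"
        unfolding ft_def by (intro Bochner_Integration.integral_cong refl)
          (simp add: inner_diff_right ring_distribs exp_diff exp_minus field_simps)
      then show "ft (\<lambda>\<xi>. gauss (s n *\<^sub>R \<xi>) * iexp (- (\<xi> \<bullet> x))) y = (gconst TYPE('a) / s n ^ DIM('a) * gauss ((y - x) /\<^sub>R s n))"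
        using s0[of n] by (simp add: ft_gauss_scale)
    qed
    also have "\<dots> = gconst TYPE('a) * (\<integral>u. \<phi> (x + s n *\<^sub>R u) * gauss u \<partial>lborel)"
      using s0[of n] 
      by (subst integral_lborel_affine[of _ "s n" x])
        (auto simp: scaleR_conv_of_real mult_ac simp flip: integral_mult_right_zero integral_divide_zero)
    finally show ?thesis .
  qed
  have "(\<lambda>n. \<integral>u. \<phi> (x + s n *\<^sub>R u) * gauss u \<partial>lborel) \<longlonglongrightarrow> (\<integral>u. \<phi> x * complex_of_real (gauss (u::'a)) \<partial>lborel)"
  proof (rule integral_dominated_convergence[where w="\<lambda>u. B * gauss u"])
    have "(\<lambda>n. \<phi> (x + s n *\<^sub>R u)) \<longlonglongrightarrow> \<phi> (x + 0 *\<^sub>R u)" for u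
      by (rule continuous_on_tendsto_compose[OF cont]) (use s in \<open>auto intro!: tendsto_eq_intros\<close>)
    then show "AE u in lborel. (\<lambda>n. \<phi> (x + s n *\<^sub>R u) * gauss u) \<longlonglongrightarrow> \<phi> x * complex_of_real (gauss u)"
      by (auto intro!: tendsto_intros)
  qed (use bd in \<open>auto simp: norm_mult intro!: mult_right_mono\<close>)
  also have "(\<integral>u. \<phi> x * complex_of_real (gauss (u::'a)) \<partial>lborel) = \<phi> x * gconst TYPE('a)"
    by (simp add: integral_gauss)
  finally have "J \<longlonglongrightarrow> gconst TYPE('a) * (\<phi> x * gconst TYPE('a))"
    unfolding J by (intro tendsto_intros)
  also have "gconst TYPE('a) * (\<phi> x * gconst TYPE('a)) = complex_of_real ((2 * pi) ^ DIM('a)) * \<phi> x"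
    unfolding gconst_square[symmetric] by simp
  finally show "J \<longlonglongrightarrow> (2 * pi) ^ DIM('a) * \<phi> x" by simp
qed

subsection \<open>Test functions\<close>

lemma partials_append: "partials (ks @ js) f = partials ks (partials js f)"
  by (induction ks) auto

lemma partial_deriv_outside_support:
  assumes "closed K" "\<And>x. x \<notin> K \<Longrightarrow> f x = 0" "x \<notin> K"
  shows "partial_deriv i f x = 0"
proof -
  have "continuous_on UNIV (\<lambda>t. x + t *\<^sub>R axis i (1::real))" by (intro continuous_intros)
  then have "open ((\<lambda>t. x + t *\<^sub>R axis i (1::real)) -` (- K))"
    using \<open>closed K\<close> by (intro open_vimage) auto
  then have "eventually (\<lambda>t. t \<in> (\<lambda>t. x + t *\<^sub>R axis i (1::real)) -` (- K)) (nhds 0)"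
    by (rule eventually_nhds_in_open) (use assms in auto)
  then have "eventually (\<lambda>t. f (x + t *\<^sub>R axis i 1) = 0) (nhds 0)"
    by eventually_elim (use assms in auto)
  then have "((\<lambda>t. f (x + t *\<^sub>R axis i 1)) has_field_derivative 0) (at 0)"
    by (subst DERIV_cong_ev[OF refl _ refl, where g = "\<lambda>_. 0"]) auto
  then show ?thesis unfolding partial_deriv_def by (rule DERIV_imp_deriv)
qed

lemma partials_outside_support:
  assumes "closed K" "\<And>x. x \<notin> K \<Longrightarrow> f x = 0" "x \<notin> K"
  shows "partials ks f x = 0"
  using assms(3) by (induction ks arbitrary: x) (auto intro: partial_deriv_outside_support assms)

lemma test_function_partials:
  assumes "test_function \<phi>" shows "test_function (partials ks \<phi>)"
proof -
  obtain K where K: "compact K" "\<And>x. x \<notin> K \<Longrightarrow> \<phi> x = 0"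
    using assms unfolding test_function_def by blast
  then have "\<And>x. x \<notin> K \<Longrightarrow> partials ks \<phi> x = 0"
    by (intro partials_outside_support[of K]) (auto intro: compact_imp_closed)
  with K(1) show ?thesis
    using assms unfolding test_function_def by (auto simp flip: partials_append)
qed

lemma test_function_partial_deriv: "test_function \<phi> \<Longrightarrow> test_function (partial_deriv i \<phi>)"
  using test_function_partials[of \<phi> "[i]"] by simp

lemma test_function_continuous: "test_function \<phi> \<Longrightarrow> continuous_on UNIV \<phi>"
  unfolding test_function_def by (metis partials.simps(1))

lemma test_function_measurable: "test_function \<phi> \<Longrightarrow> \<phi> \<in> borel_measurable borel"
  by (intro borel_measurable_continuous_onI test_function_continuous)

lemma test_function_DERIV:
  assumes "test_function \<phi>"
  shows "((\<lambda>t. \<phi> (x + t *\<^sub>R axis i 1)) has_field_derivative partial_deriv i \<phi> (x + t *\<^sub>R axis i 1)) (at t)"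
proof -
  let ?y = "x + t *\<^sub>R axis i 1"
  have "(\<lambda>s. partials [] \<phi> (?y + s *\<^sub>R axis i 1)) differentiable (at 0)"
    using assms unfolding test_function_def by blast
  then have "((\<lambda>s. \<phi> (?y + s *\<^sub>R axis i 1)) has_field_derivative partial_deriv i \<phi> ?y) (at (t + - t))"
    by (simp add: partial_deriv_def DERIV_deriv_iff_real_differentiable)
  then have "((\<lambda>s. \<phi> (?y + (s + - t) *\<^sub>R axis i 1)) has_field_derivative partial_deriv i \<phi> ?y) (at t)"
    by (subst (asm) DERIV_shift)
  then show ?thesis by (simp add: algebra_simps)
qed

lemma test_function_support:
  assumes "test_function \<phi>"
  obtains R where "R > 0" "\<And>x. norm x > R \<Longrightarrow> \<phi> x = 0"
proof -
  obtain K where K: "compact K" "\<forall>x. x \<notin> K \<longrightarrow> \<phi> x = 0"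
    using assms unfolding test_function_def by blast
  then obtain R where "R > 0" "\<forall>x\<in>K. norm x \<le> R"
    using compact_imp_bounded bounded_pos by metis
  with K that[of R] show ?thesis by (meson not_le)
qed

lemma test_function_bounded:
  assumes "test_function \<phi>"
  obtains B where "B > 0" "\<And>x. \<bar>\<phi> x\<bar> \<le> B"
proof -
  obtain R where R: "R > 0" "\<And>x. norm x > R \<Longrightarrow> \<phi> x = 0"
    using test_function_support[OF assms] by blast
  have "compact (\<phi> ` cball 0 R)"
    by (intro compact_continuous_image continuous_on_subset[OF test_function_continuous[OF assms]]) auto
  then obtain B where B: "B > 0" "\<forall>y\<in>\<phi> ` cball 0 R. norm y \<le> B"
    using compact_imp_bounded bounded_pos by metis
  have "\<bar>\<phi> x\<bar> \<le> B" for x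
    using R(2)[of x] B by (cases "norm x > R") auto
  with B(1) that show ?thesis by blast
qed

lemma test_function_integrable:
  assumes "test_function \<phi>"
  shows "integrable lborel \<phi>"
proof -
  obtain R where R: "R > 0" "\<And>x. norm x > R \<Longrightarrow> \<phi> x = 0"
    using test_function_support[OF assms] by blast
  have "integrable lborel (\<lambda>x. indicator (cball 0 R) x *\<^sub>R \<phi> x)"
    by (intro borel_integrable_compact continuous_on_subset[OF test_function_continuous[OF assms]]) auto
  also have "(\<lambda>x. indicator (cball 0 R) x *\<^sub>R \<phi> x) = \<phi>"
    using R by (auto simp: indicator_def fun_eq_iff)
  finally show ?thesis .
qed

lemma test_function_quotient_bound:
  assumes "test_function \<phi>" "\<And>x. \<bar>partial_deriv i \<phi> x\<bar> \<le> B"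
  shows "\<bar>\<phi> (x + t *\<^sub>R axis i 1) - \<phi> x\<bar> \<le> B * \<bar>t\<bar>"
  using field_differentiable_bound[of UNIV "\<lambda>t. \<phi> (x + t *\<^sub>R axis i 1)" "\<lambda>t. partial_deriv i \<phi> (x + t *\<^sub>R axis i 1)" B 0 t]
    test_function_DERIV[OF assms(1)] assms(2) by auto

lemma DERIV_seq:
  fixes f :: "'a::real_normed_field \<Rightarrow> 'a"
  assumes "(f has_field_derivative D) (at 0)" "t \<longlonglongrightarrow> 0" "\<And>n::nat. t n \<noteq> 0"
  shows "(\<lambda>n. (f (t n) - f 0) / t n) \<longlonglongrightarrow> D"
proof -
  have "((\<lambda>h. (f (0 + h) - f 0) / h) \<longlongrightarrow> D) (at 0)"
    using DERIV_D[OF assms(1)] .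
  from filterlim_compose[OF this, of t sequentially] show ?thesis
    using assms by (simp add: filterlim_at)
qed

text \<open>One limit with two uses: for \<open>H\<close> an exponential it gives the transform of a
  derivative, for \<open>H\<close> a reflected translate of the kernel it differentiates a
  convolution. The mean value inequality bounds the difference quotients of \<phi>, so integrability
  of \<open>H\<close> on balls provides the majorant.\<close>

lemma test_function_quotient_lim:
  fixes \<phi> :: "real^'n::finite \<Rightarrow> real" and H :: "real^'n \<Rightarrow> 'b::{banach, second_countable_topology, real_normed_field}"
  assumes \<phi>: "test_function \<phi>" and t: "t \<longlonglongrightarrow> 0" "\<And>n. t n \<noteq> 0"
    and H: "\<And>r. integrable lborel (\<lambda>z. indicator (cball 0 r) z *\<^sub>R H z)" and [measurable]: "H \<in> borel_measurable borel"
  shows "(\<lambda>n. \<integral>z. ((\<phi> (z + t n *\<^sub>R axis i 1) - \<phi> z) / t n) *\<^sub>R H z \<partial>lborel)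
    \<longlonglongrightarrow> (\<integral>z. partial_deriv i \<phi> z *\<^sub>R H z \<partial>lborel)"
proof -
  have [measurable]: "\<phi> \<in> borel_measurable borel" "partial_deriv i \<phi> \<in> borel_measurable borel"
    using test_function_measurable \<phi> test_function_partial_deriv by blast+
  obtain R where R: "R > 0" "\<And>x. norm x > R \<Longrightarrow> \<phi> x = 0"
    using test_function_support[OF \<phi>] by blast
  obtain B where B: "B > 0" "\<And>x. \<bar>partial_deriv i \<phi> x\<bar> \<le> B"
    using test_function_bounded[OF test_function_partial_deriv[OF \<phi>]] by blast
  obtain T where T: "\<And>n. \<bar>t n\<bar> \<le> T"
    using convergent_imp_Bseq[OF convergentI[OF t(1)]] unfolding Bseq_def by auto
  have T0: "T \<ge> 0" using T[of 0] by linarith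
  show ?thesis
  \<comment> \<open>The ball of radius \<open>R + T\<close> contains the support of \<phi> and of
    all its translates, since \<open>\<bar>t n\<bar> \<le> T\<close>.\<close>
  proof (rule integral_dominated_convergence[where w="\<lambda>z. B * norm (indicator (cball 0 (R + T)) z *\<^sub>R H z)"])
    show "integrable lborel (\<lambda>z. B * norm (indicator (cball 0 (R + T)) z *\<^sub>R H z))"
      using H by (intro integrable_mult_right integrable_norm)
    have "(\<lambda>n. (\<phi> (z + t n *\<^sub>R axis i 1) - \<phi> z) / t n) \<longlonglongrightarrow> partial_deriv i \<phi> z" for z
      using DERIV_seq[OF _ t, of "\<lambda>s. \<phi> (z + s *\<^sub>R axis i 1)"] test_function_DERIV[OF \<phi>, of z i 0] by simp
    then show "AE z in lborel. (\<lambda>n. ((\<phi> (z + t n *\<^sub>R axis i 1) - \<phi> z) / t n) *\<^sub>R H z) \<longlonglongrightarrow> partial_deriv i \<phi> z *\<^sub>R H z"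
      by (auto intro!: tendsto_intros)
    fix n
    have "norm (((\<phi> (z + t n *\<^sub>R axis i 1) - \<phi> z) / t n) *\<^sub>R H z) \<le> B * norm (indicator (cball 0 (R + T)) z *\<^sub>R H z)" for z
    proof (cases "norm z \<le> R + T")
      case True
      have "\<bar>(\<phi> (z + t n *\<^sub>R axis i 1) - \<phi> z) / t n\<bar> \<le> B"
        using test_function_quotient_bound[OF \<phi> B(2), of z "t n"] t(2)[of n] by (simp add: divide_simps)
      from mult_right_mono[OF this norm_ge_zero[of "H z"]] show ?thesis using True by simp
    next
      case False
      have "norm z \<le> norm (z + t n *\<^sub>R axis i (1::real)) + norm (t n *\<^sub>R axis i (1::real))"
        using norm_triangle_ineq4[of "z + t n *\<^sub>R axis i (1::real)" "t n *\<^sub>R axis i (1::real)"] by simp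
      then have "norm (z + t n *\<^sub>R axis i (1::real)) > R"
        using False T[of n] by (simp add: norm_axis_1)
      then have "\<phi> (z + t n *\<^sub>R axis i 1) = 0" "\<phi> z = 0" using R False T0 by auto
      then show ?thesis using B(1) by simp
    qed
    then show "AE z in lborel. norm (((\<phi> (z + t n *\<^sub>R axis i 1) - \<phi> z) / t n) *\<^sub>R H z) \<le> B * norm (indicator (cball 0 (R + T)) z *\<^sub>R H z)"
      by simp
  qed measurable
qed

section \<open>Fourier transforms of test functions\<close>

abbreviation ftr :: "(real^'n::finite \<Rightarrow> real) \<Rightarrow> real^'n \<Rightarrow> complex" where
  "ftr \<phi> \<equiv> ft (\<lambda>x. complex_of_real (\<phi> x))"

lemma test_function_cintegrable: "test_function \<phi> \<Longrightarrow> integrable lborel (\<lambda>x. complex_of_real (\<phi> x))"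
  by (simp add: test_function_integrable)

text \<open>In place of integration by parts: translating \<phi> by \<open>t\<close> along the axis
  multiplies the transform by \<open>exp (- \<i> * \<xi> $ i * t)\<close>, so difference quotients
  of \<phi> become difference quotients of this exponential at 0.\<close>

lemma ftr_partial_deriv:
  fixes \<phi> :: "real^'n::finite \<Rightarrow> real"
  assumes \<phi>: "test_function \<phi>"
  shows "ftr (partial_deriv i \<phi>) \<xi> = - \<i> * (\<xi> $ i) * ftr \<phi> \<xi>"
proof (rule LIMSEQ_unique)
  have [measurable]: "\<phi> \<in> borel_measurable borel" using test_function_measurable \<phi> by blast
  define t where "t = (\<lambda>n. 1 / real (Suc n))"
  have t: "t \<longlonglongrightarrow> 0" unfolding t_def by (rule LIMSEQ_Suc[OF lim_1_over_n])
  have t0: "t n \<noteq> 0" for n by (simp add: t_def)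
  define J where "J n = (\<integral>z. ((\<phi> (z + t n *\<^sub>R axis i 1) - \<phi> z) / t n) *\<^sub>R iexp (z \<bullet> \<xi>) \<partial>lborel)" for n
  have "J \<longlonglongrightarrow> (\<integral>z. partial_deriv i \<phi> z *\<^sub>R iexp (z \<bullet> \<xi>) \<partial>lborel)"
    unfolding J_def
  proof (rule test_function_quotient_lim[OF \<phi> t t0])
    show "integrable lborel (\<lambda>z. indicator (cball 0 r) z *\<^sub>R iexp (z \<bullet> \<xi>))" for r
      by (intro borel_integrable_compact continuous_intros) auto
  qed measurable
  then show "J \<longlonglongrightarrow> ftr (partial_deriv i \<phi>) \<xi>"
    by (simp add: ft_def scaleR_conv_of_real mult.commute)
  have J: "J n = (exp (- \<i> * \<xi> $ i * of_real (t n)) - exp (- \<i> * \<xi> $ i * 0)) / of_real (t n) * ftr \<phi> \<xi>" for n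
  proof -
    have i1: "integrable lborel (\<lambda>z. iexp (z \<bullet> \<xi>) * complex_of_real (\<phi> z))"
      by (rule ft_integrable[OF test_function_cintegrable[OF \<phi>]])
    have i2: "integrable lborel (\<lambda>z. iexp (z \<bullet> \<xi>) * complex_of_real (\<phi> (z + t n *\<^sub>R axis i 1)))"
      using integrable_lborel_affine[OF test_function_cintegrable[OF \<phi>], of 1 "t n *\<^sub>R axis i 1"]
      by (intro ft_integrable) (simp add: add.commute)
    have "J n = ((\<integral>z. iexp (z \<bullet> \<xi>) * complex_of_real (\<phi> (z + t n *\<^sub>R axis i 1)) \<partial>lborel) - ftr \<phi> \<xi>) / of_real (t n)"
      unfolding J_def ft_def Bochner_Integration.integral_diff[OF i2 i1, symmetric] integral_divide_zero[symmetric]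
      by (intro Bochner_Integration.integral_cong) (auto simp: scaleR_conv_of_real field_simps)
    also have "(\<integral>z. iexp (z \<bullet> \<xi>) * complex_of_real (\<phi> (z + t n *\<^sub>R axis i 1)) \<partial>lborel)
      = (\<integral>z. iexp ((z - t n *\<^sub>R axis i 1) \<bullet> \<xi>) * complex_of_real (\<phi> z) \<partial>lborel)"
      by (subst integral_lborel_affine[of _ 1 "- t n *\<^sub>R axis i 1"]) auto
    also have "\<dots> = (\<integral>z. exp (- \<i> * \<xi> $ i * of_real (t n)) * (iexp (z \<bullet> \<xi>) * complex_of_real (\<phi> z)) \<partial>lborel)"
      by (intro Bochner_Integration.integral_cong)
        (auto simp: inner_diff_left inner_axis' algebra_simps exp_diff exp_minus divide_inverse)
    also have "\<dots> = exp (- \<i> * \<xi> $ i * of_real (t n)) * ftr \<phi> \<xi>"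
      unfolding ft_def by (rule integral_mult_right_zero)
    finally show ?thesis by (simp add: field_simps)
  qed
  have "((\<lambda>z. exp (- \<i> * \<xi> $ i * z)) has_field_derivative (- \<i> * \<xi> $ i)) (at 0)"
    by (auto intro!: derivative_eq_intros)
  moreover have "(\<lambda>n. complex_of_real (t n)) \<longlonglongrightarrow> 0"
    using tendsto_of_real[OF t] by simp
  ultimately have "(\<lambda>n. (exp (- \<i> * \<xi> $ i * of_real (t n)) - exp (- \<i> * \<xi> $ i * 0)) / of_real (t n)) \<longlonglongrightarrow> - \<i> * \<xi> $ i"
    by (rule DERIV_seq) (simp add: t0)
  then
  show "J \<longlonglongrightarrow> - \<i> * (\<xi> $ i) * ftr \<phi> \<xi>"
    unfolding J by (intro tendsto_mult tendsto_const)
qed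

lemma ftr_partials:
  assumes "test_function \<phi>"
  shows "ftr (partials ks \<phi>) (- \<xi>) = (\<Prod>k\<leftarrow>ks. \<i> * (\<xi> $ k)) * ftr \<phi> (- \<xi>)"
  by (induction ks) (auto simp: ftr_partial_deriv test_function_partials assms)

lemma enum_list: "distinct (enum_list :: 'n::finite list)" "set (enum_list :: 'n list) = UNIV"
proof -
  have "\<exists>xs :: 'n list. distinct xs \<and> set xs = UNIV"
    using finite_distinct_list[of "UNIV::'n set"] by auto
  from someI_ex[OF this] show "distinct (enum_list :: 'n::finite list)" "set (enum_list :: 'n list) = UNIV"
    unfolding enum_list_def by auto
qed

lemma prod_list_dirs: "(\<Prod>k\<leftarrow>dirs \<alpha>. z k) = (\<Prod>i\<in>UNIV. (z i :: 'a::comm_monoid_mult) ^ \<alpha> i)"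
proof -
  have "(\<Prod>k\<leftarrow>dirs \<alpha>. z k) = (\<Prod>i\<leftarrow>enum_list. z i ^ \<alpha> i)"
  proof -
    have "(\<Prod>k\<leftarrow>concat (map (\<lambda>i. replicate (\<alpha> i) i) xs). z k) = (\<Prod>i\<leftarrow>xs. z i ^ \<alpha> i)" for xs
      by (induction xs) (auto simp: prod_list_replicate)
    then show ?thesis unfolding dirs_def .
  qed
  also have "\<dots> = (\<Prod>i\<in>UNIV. z i ^ \<alpha> i)"
    using enum_list by (metis prod.distinct_set_conv_list)
  finally show ?thesis .
qed

lemma ftr_Dmulti:
  "test_function \<phi> \<Longrightarrow> ftr (Dmulti \<alpha> \<phi>) (- \<xi>) = (\<Prod>i\<in>UNIV. (\<i> * (\<xi> $ i)) ^ \<alpha> i) * ftr \<phi> (- \<xi>)"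
  unfolding Dmulti_def by (subst ftr_partials) (auto simp: prod_list_dirs)

lemma test_function_Dmulti: "test_function \<phi> \<Longrightarrow> test_function (Dmulti \<alpha> \<phi>)"
  unfolding Dmulti_def by (rule test_function_partials)

text \<open>A second derivative in direction \<open>k\<close> multiplies the modulus of the
  transform by \<open>(\<xi> $ k)^2\<close>, so each new factor is paid for by the induction
  hypothesis for \<phi> and for that derivative. The product form is chosen because its reciprocal
  is integrable coordinate by coordinate.\<close>

lemma ftr_decay:
  assumes "finite S" "test_function \<phi>"
  shows "\<exists>C. \<forall>\<xi>. (\<Prod>i\<in>S. 1 + (\<xi> $ i)\<^sup>2) * cmod (ftr \<phi> \<xi>) \<le> C"
  using assms
proof (induction S arbitrary: \<phi>)
  case empty
  then show ?case using ft_bound[OF test_function_cintegrable] by auto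
next
  case (insert k S)
  let ?D = "partial_deriv k (partial_deriv k \<phi>)"
  obtain C1 where C1: "\<And>\<xi>. (\<Prod>i\<in>S. 1 + (\<xi> $ i)\<^sup>2) * cmod (ftr \<phi> \<xi>) \<le> C1"
    using insert by blast
  obtain C2 where C2: "\<And>\<xi>. (\<Prod>i\<in>S. 1 + (\<xi> $ i)\<^sup>2) * cmod (ftr ?D \<xi>) \<le> C2"
    using insert test_function_partial_deriv by blast
  have D: "cmod (ftr ?D \<xi>) = (\<xi> $ k)\<^sup>2 * cmod (ftr \<phi> \<xi>)" for \<xi>
    by (simp add: ftr_partial_deriv test_function_partial_deriv insert.prems norm_mult power2_eq_square)
  have "(\<Prod>i\<in>insert k S. 1 + (\<xi> $ i)\<^sup>2) * cmod (ftr \<phi> \<xi>) \<le> C1 + C2" for \<xi>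
  proof -
    have "(\<Prod>i\<in>insert k S. 1 + (\<xi> $ i)\<^sup>2) * cmod (ftr \<phi> \<xi>)
      = (\<Prod>i\<in>S. 1 + (\<xi> $ i)\<^sup>2) * cmod (ftr \<phi> \<xi>) + (\<Prod>i\<in>S. 1 + (\<xi> $ i)\<^sup>2) * cmod (ftr ?D \<xi>)"
      unfolding D using insert.hyps by (simp add: algebra_simps)
    then show ?thesis using C1[of \<xi>] C2[of \<xi>] by linarith
  qed
  then show ?case by blast
qed

lemma Basis_vec_real: "(Basis :: (real^'n::finite) set) = range (\<lambda>i. axis i 1)"
  by (auto simp: Basis_vec_def)

lemma prod_Basis_vec: "(\<Prod>b\<in>Basis. f (x \<bullet> b)) = (\<Prod>i\<in>UNIV. f (x $ i))" for x :: "real^'n::finite"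
proof -
  have "inj (\<lambda>i::'n. axis i (1::real))" by (auto simp: inj_def axis_eq_axis)
  then show ?thesis unfolding Basis_vec_real by (subst prod.reindex) (auto simp: inner_axis)
qed

lemma integrable_ftr:
  fixes \<phi> :: "real^'n::finite \<Rightarrow> real"
  assumes "test_function \<phi>"
  shows "integrable lborel (ftr \<phi>)"
proof -
  have [measurable]: "\<phi> \<in> borel_measurable borel" using test_function_measurable assms by blast
  obtain C where C: "\<And>\<xi>. (\<Prod>i\<in>UNIV. 1 + (\<xi> $ i)\<^sup>2) * cmod (ftr \<phi> \<xi>) \<le> C"
    using ftr_decay[OF finite assms] by blast
  have "integrable lborel (\<lambda>x::real. inverse (1 + x\<^sup>2))"
    using integrable_inverse_1_plus_square by (simp add: set_integrable_def)
  from integral_lborel_prod(1)[where 'a="real^'n" and f="\<lambda>_. \<lambda>x::real. inverse (1 + x\<^sup>2)", OF this]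
  have i: "integrable lborel (\<lambda>x::real^'n. C * (\<Prod>i\<in>UNIV. inverse (1 + (x $ i)\<^sup>2)))"
    by (subst (asm) prod_Basis_vec) simp
  show ?thesis
  proof (rule Bochner_Integration.integrable_bound[OF i])
    have "cmod (ftr \<phi> \<xi>) \<le> C * (\<Prod>i\<in>UNIV. inverse (1 + (\<xi> $ i)\<^sup>2))" for \<xi>
    proof -
      define P where "P = (\<Prod>i\<in>UNIV. 1 + (\<xi> $ i)\<^sup>2)"
      have "P > 0" unfolding P_def by (intro prod_pos) (auto simp: add_pos_nonneg)
      then have "cmod (ftr \<phi> \<xi>) \<le> C * inverse P"
        using C[of \<xi>] unfolding P_def[symmetric] by (simp add: field_simps)
      moreover have "(\<Prod>i\<in>UNIV. inverse (1 + (\<xi> $ i)\<^sup>2)) = inverse P"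
        unfolding P_def using prod_inversef[of "\<lambda>i. 1 + (\<xi> $ i)\<^sup>2" UNIV] by (simp only: o_def)
      ultimately show ?thesis by (simp only:)
    qed
    then show "AE x in lborel. norm (ftr \<phi> x) \<le> norm (C * (\<Prod>i\<in>UNIV. inverse (1 + (x $ i)\<^sup>2)))"
      by (auto intro: order_trans[OF _ abs_ge_self])
  qed measurable
qed

lemma test_function_inversion:
  fixes \<phi> :: "real^'n::finite \<Rightarrow> real"
  assumes "test_function \<phi>"
  shows "(\<integral>\<xi>. iexp (\<xi> \<bullet> x) * ftr \<phi> (- \<xi>) \<partial>lborel) = (2 * pi) ^ CARD('n) * \<phi> x"
proof -
  obtain B where B: "\<And>x. \<bar>\<phi> x\<bar> \<le> B"
    using test_function_bounded[OF assms] by blast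
  show ?thesis
    using fourier_inversion[OF test_function_cintegrable[OF assms] _ _ integrable_ftr[OF assms], of B x]
      test_function_continuous[OF assms] B by (simp add: continuous_on_of_real)
qed

section \<open>Convolution of a locally integrable kernel with a test function\<close>

lemma convolution_flip:
  assumes [measurable]: "G \<in> borel_measurable borel" "\<phi> \<in> borel_measurable borel"
  shows "convolution G \<phi> x = (\<integral>z. \<phi> z *\<^sub>R G (x - z) \<partial>lborel)"
  unfolding convolution_def by (simp add: mult.commute)

text \<open>\<open>G\<close> may have no derivative, so a substitution moves the translation of
  \<open>x\<close> onto \<phi>, and the limit is that of
  \<open>test_function_quotient_lim\<close>.\<close>

lemma convolution_partial_deriv:
  fixes G :: "real^'n::finite \<Rightarrow> real"
  assumes G: "locally_integrable G" and \<phi>: "test_function \<phi>"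
  shows "partial_deriv i (convolution G \<phi>) x = convolution G (partial_deriv i \<phi>) x"
proof -
  have [measurable]: "G \<in> borel_measurable borel" using G unfolding locally_integrable_def by simp
  have [measurable]: "\<phi> \<in> borel_measurable borel" "partial_deriv i \<phi> \<in> borel_measurable borel"
    using test_function_measurable \<phi> test_function_partial_deriv by blast+
  have H: "integrable lborel (\<lambda>z. indicator (cball 0 r) z *\<^sub>R G (x - z))" for r
  proof -
    have "set_integrable lborel (cball x r) G"
      using G unfolding locally_integrable_def by auto
    then have "integrable lborel (\<lambda>z. indicator (cball x r) z *\<^sub>R G z)"
      by (simp add: set_integrable_def)
    from integrable_lborel_affine[OF this, of "-1" x] show ?thesis
      by (rule Bochner_Integration.integrable_cong[THEN iffD1, rotated -1])
        (auto simp: indicator_def dist_norm)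
  qed
  have int: "integrable lborel (\<lambda>z. \<psi> (z + a) *\<^sub>R G (x - z))" if \<psi>: "test_function \<psi>" for \<psi> a
  proof -
    have [measurable]: "\<psi> \<in> borel_measurable borel"
      using test_function_measurable \<psi> by blast
    obtain R where R: "R > 0" "\<And>x. norm x > R \<Longrightarrow> \<psi> x = 0"
      using test_function_support[OF \<psi>] by blast
    obtain B where B: "B > 0" "\<And>x. \<bar>\<psi> x\<bar> \<le> B"
      using test_function_bounded[OF \<psi>] by blast
    have "norm (\<psi> (z + a) *\<^sub>R G (x - z)) \<le> norm (B *\<^sub>R (indicator (cball 0 (R + norm a)) z *\<^sub>R G (x - z)))" for z
    proof (cases "norm z \<le> R + norm a")
      case True then show ?thesis using B(1) B(2)[of "z + a"] by (auto simp: abs_mult intro!: mult_right_mono)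
    next
      case False
      then have "norm (z + a) > R" using norm_triangle_ineq4[of "z + a" a] by simp
      then show ?thesis using R by simp
    qed
    then show ?thesis
      by (intro Bochner_Integration.integrable_bound[OF integrable_scaleR_right[OF H[of "R + norm a"], of B]]) auto
  qed
  have "((\<lambda>t. convolution G \<phi> (x + t *\<^sub>R axis i 1)) has_field_derivative convolution G (partial_deriv i \<phi>) x) (at 0)"
    unfolding has_field_derivative_iff tendsto_at_iff_sequentially
  proof (intro allI impI)
    fix t :: "nat \<Rightarrow> real"
    assume t0: "\<forall>n. t n \<in> UNIV - {0}" and t: "t \<longlonglongrightarrow> 0"
    have "(\<lambda>n. \<integral>z. ((\<phi> (z + t n *\<^sub>R axis i 1) - \<phi> z) / t n) *\<^sub>R G (x - z) \<partial>lborel)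
      \<longlonglongrightarrow> (\<integral>z. partial_deriv i \<phi> z *\<^sub>R G (x - z) \<partial>lborel)"
      by (rule test_function_quotient_lim[OF \<phi> t _ H]) (use t0 in auto)
    moreover have "(\<integral>z. ((\<phi> (z + t n *\<^sub>R axis i 1) - \<phi> z) / t n) *\<^sub>R G (x - z) \<partial>lborel)
      = (convolution G \<phi> (x + t n *\<^sub>R axis i 1) - convolution G \<phi> x) / t n" for n
    proof -
      have "convolution G \<phi> (x + t n *\<^sub>R axis i 1) = (\<integral>z. \<phi> (z + t n *\<^sub>R axis i 1) *\<^sub>R G (x - z) \<partial>lborel)"
        unfolding convolution_flip[OF \<open>G \<in> _\<close> \<open>\<phi> \<in> _\<close>]
        by (subst integral_lborel_affine[of _ 1 "t n *\<^sub>R axis i 1"]) (auto simp: add.commute)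
      then have "convolution G \<phi> (x + t n *\<^sub>R axis i 1) - convolution G \<phi> x
         = (\<integral>z. \<phi> (z + t n *\<^sub>R axis i 1) *\<^sub>R G (x - z) - \<phi> z *\<^sub>R G (x - z) \<partial>lborel)"
        unfolding convolution_flip[OF \<open>G \<in> _\<close> \<open>\<phi> \<in> _\<close>]
        using int[OF \<phi>] int[OF \<phi>, of 0] by (subst Bochner_Integration.integral_diff) auto
      then show ?thesis
        by (simp flip: integral_divide_zero) (simp add: field_simps diff_divide_distrib)
    qed
    ultimately have "(\<lambda>n. (convolution G \<phi> (x + t n *\<^sub>R axis i 1) - convolution G \<phi> x) / t n)
       \<longlonglongrightarrow> (\<integral>z. partial_deriv i \<phi> z *\<^sub>R G (x - z) \<partial>lborel)"
      by (simp only:)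
    then show "((\<lambda>y. (convolution G \<phi> (x + y *\<^sub>R axis i 1) - convolution G \<phi> (x + 0 *\<^sub>R axis i 1)) / (y - 0)) \<circ> t) \<longlonglongrightarrow> convolution G (partial_deriv i \<phi>) x"
      by (simp add: o_def convolution_flip[OF \<open>G \<in> _\<close> \<open>partial_deriv i \<phi> \<in> _\<close>])
  qed
  then show ?thesis unfolding partial_deriv_def[of i "convolution G \<phi>"] by (rule DERIV_imp_deriv)
qed

lemma convolution_partials:
  assumes G: "locally_integrable G" and \<phi>: "test_function \<phi>"
  shows "partials ks (convolution G \<phi>) = convolution G (partials ks \<phi>)"
proof (induction ks)
  case (Cons k ks)
  then show ?case using convolution_partial_deriv[OF G test_function_partials[OF \<phi>]] by auto
qed auto

lemma convolution_Dmulti: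
  assumes G: "locally_integrable G" and \<phi>: "test_function \<phi>"
  shows "Dmulti \<alpha> (convolution G \<phi>) = convolution G (Dmulti \<alpha> \<phi>)"
  unfolding Dmulti_def by (rule convolution_partials[OF assms])

subsection \<open>Zero sets and coordinate slices\<close>

text \<open>Multiplying \<open>x\<close> coordinatewise by \<open>y\<close> multiplies each monomial
  by its value at \<open>y\<close>. Subtracting \<open>mon \<beta> y\<close> times the original
  relation removes \<beta> and leaves a shorter relation with coefficients
  \<open>c \<alpha> * (mon \<alpha> y - mon \<beta> y)\<close>.\<close>

lemma monomials_independent:
  fixes c :: "('n::finite \<Rightarrow> nat) \<Rightarrow> complex"
  assumes "finite A" "\<And>x :: 'n \<Rightarrow> real. (\<Sum>\<alpha>\<in>A. c \<alpha> * of_real (\<Prod>i\<in>UNIV. x i ^ \<alpha> i)) = 0" "\<alpha> \<in> A"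
  shows "c \<alpha> = 0"
  using assms
proof (induction A arbitrary: c \<alpha>)
  case (insert \<beta> A)
  define mon where "mon \<alpha> x = complex_of_real (\<Prod>i\<in>UNIV. x i ^ \<alpha> i)" for \<alpha> :: "'n \<Rightarrow> nat" and x
  have mon_mult: "mon \<alpha> (\<lambda>i. x i * y i) = mon \<alpha> x * mon \<alpha> y" for \<alpha> x y
    by (simp add: mon_def power_mult_distrib prod.distrib)
  have zero: "(\<Sum>\<alpha>\<in>A. c \<alpha> * mon \<alpha> x) + c \<beta> * mon \<beta> x = 0" for x
    using insert.prems(1)[of x] insert.hyps by (simp add: mon_def add.commute)
  have 1: "c \<alpha> * (mon \<alpha> y - mon \<beta> y) = 0" if "\<alpha> \<in> A" for \<alpha> y
  proof (rule insert.IH[OF _ that])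
    fix x
    have "(\<Sum>\<alpha>\<in>A. c \<alpha> * (mon \<alpha> y - mon \<beta> y) * mon \<alpha> x)
      = ((\<Sum>\<alpha>\<in>A. c \<alpha> * mon \<alpha> (\<lambda>i. x i * y i)) + c \<beta> * mon \<beta> (\<lambda>i. x i * y i))
      - mon \<beta> y * ((\<Sum>\<alpha>\<in>A. c \<alpha> * mon \<alpha> x) + c \<beta> * mon \<beta> x)"
      by (simp add: mon_mult algebra_simps sum_subtractf sum_distrib_left)
    then show "(\<Sum>\<alpha>\<in>A. c \<alpha> * (mon \<alpha> y - mon \<beta> y) * of_real (\<Prod>i\<in>UNIV. x i ^ \<alpha> i)) = 0"
      unfolding mon_def[of _ x, symmetric] by (simp add: zero)
  qed
  have 2: "c \<alpha> = 0" if "\<alpha> \<in> A" for \<alpha>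
  proof -
    have "\<alpha> \<noteq> \<beta>" using that insert.hyps by auto
    then obtain i where i: "\<alpha> i \<noteq> \<beta> i" by auto
    \<comment> \<open>With 2 in a coordinate where the exponents differ and 1 elsewhere, the two
      monomials take different powers of 2 as values.\<close>
    define y where "y = (\<lambda>j. if j = i then 2 else 1 :: real)"
    have "mon \<gamma> y = 2 ^ \<gamma> i" for \<gamma>
    proof -
      have "(\<Prod>j\<in>UNIV. y j ^ \<gamma> j) = (\<Prod>j\<in>UNIV. if j = i then 2 ^ \<gamma> j else 1)"
        by (intro prod.cong) (auto simp: y_def)
      then show ?thesis unfolding mon_def by simp
    qed
    moreover have "(2::complex) ^ \<alpha> i \<noteq> 2 ^ \<beta> i"
    proof
      assume "(2::complex) ^ \<alpha> i = 2 ^ \<beta> i"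
      then have "cmod (2 ^ \<alpha> i) = cmod (2 ^ \<beta> i)" by simp
      then show False using i by (simp add: norm_power)
    qed
    ultimately show ?thesis using 1[OF that, of y] by simp
  qed
  have "c \<beta> * mon \<beta> (\<lambda>_. 1) = 0" using zero[of "\<lambda>_. 1"] 2 by simp
  then have "c \<beta> = 0" by (simp add: mon_def)
  with 2 insert.prems show ?case by auto
qed auto

lemma poly_eval_imaginary_nonzero:
  fixes p :: "('n::finite \<Rightarrow> nat) \<Rightarrow> real"
  assumes p: "is_poly p" "p \<alpha> \<noteq> 0"
  obtains v :: "real^'n" where "poly_eval p (\<lambda>k. \<i> * of_real (v $ k)) \<noteq> 0"
proof (rule ccontr)
  assume "\<not> thesis"
  then have z: "poly_eval p (\<lambda>k. \<i> * of_real (v $ k)) = 0" for v :: "real^'n" using that by blast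
  have "of_real (p \<alpha>) * (\<Prod>i\<in>UNIV. \<i> ^ \<alpha> i) = 0"
  proof (rule monomials_independent)
    show "finite {\<alpha>. p \<alpha> \<noteq> 0}" using p by (simp add: is_poly_def)
    show "\<alpha> \<in> {\<alpha>. p \<alpha> \<noteq> 0}" using p by simp
    fix x :: "'n \<Rightarrow> real"
    show "(\<Sum>\<alpha>\<in>{\<alpha>. p \<alpha> \<noteq> 0}. of_real (p \<alpha>) * (\<Prod>i\<in>UNIV. \<i> ^ \<alpha> i) * of_real (\<Prod>i\<in>UNIV. x i ^ \<alpha> i)) = 0"
      using z[of "\<chi> i. x i"] by (simp add: poly_eval_def power_mult_distrib prod.distrib mult.assoc)
  qed
  with p show False by simp
qed

text \<open>The restriction of a polynomial to a complex line, kept as a \<open>poly\<close> so that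
  finiteness of roots, division by linear factors and growth at infinity apply.\<close>

definition line_poly :: "(('n::finite \<Rightarrow> nat) \<Rightarrow> real) \<Rightarrow> ('n \<Rightarrow> complex) \<Rightarrow> ('n \<Rightarrow> complex) \<Rightarrow> complex poly" where
  "line_poly c z w = (\<Sum>\<alpha>\<in>{\<alpha>. c \<alpha> \<noteq> 0}. smult (of_real (c \<alpha>)) (\<Prod>i\<in>UNIV. [:z i, w i:] ^ \<alpha> i))"

lemma poly_line_poly: "poly (line_poly c z w) s = poly_eval c (\<lambda>i. z i + s * w i)"
  by (simp add: line_poly_def poly_eval_def poly_sum poly_prod)

lemma borel_measurable_poly_eval [measurable (raw)]:
  assumes [measurable]: "\<And>k. (\<lambda>x. z x k) \<in> borel_measurable M"
  shows "(\<lambda>x. poly_eval c (z x)) \<in> borel_measurable M"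
  unfolding poly_eval_def by measurable

lemma borel_measurable_vec_nth_comp [measurable (raw)]:
  "f \<in> borel_measurable M \<Longrightarrow> (\<lambda>x. (f x :: real^'n::finite) $ k) \<in> borel_measurable M"
  by (rule measurable_compose[of f M borel]) (auto intro!: borel_measurable_continuous_onI continuous_intros)

lemma AE_lborel_exists:
  assumes "AE x::'a::euclidean_space in lborel. P x" shows "\<exists>x. P x"
proof -
  have "ae_filter (lborel :: 'a measure) \<noteq> bot" by (simp add: ae_filter_eq_bot_iff)
  then show ?thesis using eventually_happens'[OF _ assms] by blast
qed

text \<open>Every line through a point where \<open>p\<close> does not vanish meets the zero set in finitely many
  points, so averaging over dilations about that point gives measure zero.\<close>
lemma AE_poly_eval_nonzero:
  fixes p :: "('n::finite \<Rightarrow> nat) \<Rightarrow> real"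
  assumes p: "is_poly p" "p \<alpha> \<noteq> 0"
  shows "AE \<xi>::real^'n in lborel. poly_eval p (\<lambda>k. \<i> * of_real (\<xi> $ k)) \<noteq> 0"
proof -
  obtain v :: "real^'n" where v: "poly_eval p (\<lambda>k. \<i> * of_real (v $ k)) \<noteq> 0"
    using poly_eval_imaginary_nonzero[OF p] .
  define f where "f \<xi> = poly_eval p (\<lambda>k. \<i> * of_real (\<xi> $ k))" for \<xi> :: "real^'n"
  have [measurable]: "f \<in> borel_measurable borel" unfolding f_def by measurable
  \<comment> \<open>\<open>u\<close> marks the zeros after dilation about \<open>v\<close>.
    Tonelli's theorem yields one nonzero \<open>t\<close> for which the dilated zero set is null,
    and undoing that single dilation finishes.\<close>
  define u where "u t x = (if f (v + t *\<^sub>R x) = 0 then 1 else 0 :: ennreal)" for t x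
  have [measurable]: "case_prod u \<in> borel_measurable (borel \<Otimes>\<^sub>M borel)" 
    "case_prod u \<in> borel_measurable (lborel \<Otimes>\<^sub>M lborel)"
    unfolding u_def by measurable
  have fin: "finite {t. f (v + t *\<^sub>R x) = 0}" for x
  proof -
    define L where "L = line_poly p (\<lambda>k. \<i> * of_real (v $ k)) (\<lambda>k. \<i> * of_real (x $ k))"
    have L: "poly L (of_real t) = f (v + t *\<^sub>R x)" for t
      by (simp add: L_def poly_line_poly f_def algebra_simps)
    have "poly L 0 \<noteq> 0" using L[of 0] v by (simp add: f_def)
    then have "finite {s. poly L s = 0}" by (intro poly_roots_finite) auto
    then have "finite (complex_of_real -` {s. poly L s = 0})"
      by (rule finite_vimageI) (auto simp: inj_def)
    then show ?thesis by (simp add: vimage_def L)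
  qed
  have "(\<integral>\<^sup>+t. \<integral>\<^sup>+x. u t x \<partial>lborel \<partial>lborel) = (\<integral>\<^sup>+x. \<integral>\<^sup>+t. u t x \<partial>lborel \<partial>lborel)"
    by (rule lborel_pair.Fubini'[symmetric]) measurable
  also have "\<dots> = (\<integral>\<^sup>+(x::real^'n). 0 \<partial>lborel)"
  proof (rule nn_integral_cong)
    fix x
    have "(\<integral>\<^sup>+t. u t x \<partial>lborel) = (\<integral>\<^sup>+t. indicator {t. f (v + t *\<^sub>R x) = 0} t \<partial>lborel)"
      by (intro nn_integral_cong) (simp add: u_def)
    also have "\<dots> = 0"
      using finite_imp_null_set_lborel[OF fin[of x]] by (subst nn_integral_indicator) (auto simp: null_sets_def)
    finally show "(\<integral>\<^sup>+t. u t x \<partial>lborel) = 0" .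
  qed
  finally have "(\<integral>\<^sup>+t. \<integral>\<^sup>+x. u t x \<partial>lborel \<partial>lborel) = 0" by simp
  then have "AE t in lborel. (\<integral>\<^sup>+x. u t x \<partial>lborel) = 0"
    by (subst (asm) nn_integral_0_iff_AE) auto
  moreover have "AE t in lborel. t \<noteq> (0::real)" by (rule AE_lborel_singleton)
  ultimately have "AE t in lborel. (\<integral>\<^sup>+x. u t x \<partial>lborel) = 0 \<and> t \<noteq> 0" by eventually_elim auto
  from AE_lborel_exists[OF this] obtain t where t: "(\<integral>\<^sup>+x. u t x \<partial>lborel) = 0" "t \<noteq> 0" by blast
  have "(\<integral>\<^sup>+x. (if f x = 0 then 1 else 0) \<partial>lborel) = (0::ennreal)"
    using t by (subst nn_integral_lborel_affine[OF _ t(2), of _ v]) (auto simp: u_def)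
  then have "AE x in lborel. (if f x = 0 then 1 else 0) = (0::ennreal)"
    by (subst (asm) nn_integral_0_iff_AE) auto
  then show ?thesis by eventually_elim (auto simp: f_def split: if_splits)
qed

lemma borel_measurable_symbol_ratio [measurable (raw)]:
  assumes [measurable]: "\<eta> \<in> borel_measurable M" "\<xi> \<in> borel_measurable M"
  shows "(\<lambda>x. symbol_ratio q p (\<eta> x) (\<xi> x)) \<in> borel_measurable M"
  unfolding symbol_ratio_def by measurable

lemma poly_eval_cnj: "cnj (poly_eval c z) = poly_eval c (\<lambda>k. cnj (z k))"
  by (simp add: poly_eval_def)

text \<open>Rests on the coefficients being real, and is what makes the kernel real valued.\<close>

lemma symbol_ratio_minus: "symbol_ratio q p \<eta> (- \<xi>) = cnj (symbol_ratio q p \<eta> \<xi>)"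
  by (simp add: symbol_ratio_def poly_eval_cnj)

text \<open>Averaging over translates replaces Fubini's theorem in a decomposition of the space
  into the \<open>k\<close>-th axis and its complement.\<close>

lemma nn_integral_std_normal: "(\<integral>\<^sup>+\<tau>. ennreal (std_normal_density (c - \<tau>)) \<partial>lborel) = 1"
proof -
  have "(\<integral>\<^sup>+\<tau>. ennreal (std_normal_density (c - \<tau>)) \<partial>lborel) = (\<integral>\<^sup>+\<tau>. ennreal (std_normal_density \<tau>) \<partial>lborel)"
    by (rule nn_integral_lborel_reflect[where f="\<lambda>x. ennreal (std_normal_density x)"]) measurable
  also have "\<dots> = 1"
    by (subst nn_integral_eq_integral) auto
  finally show ?thesis .
qed

text \<open>The density has mass one along the axis, so after translating \<open>y\<close> and
  exchanging the integrals the weight disappears. It is also strictly positive, so that vanishing or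
  finiteness of the left side passes to almost every slice.\<close>

lemma nn_integral_slice:
  fixes F :: "real^'n::finite \<Rightarrow> ennreal"
  assumes [measurable]: "F \<in> borel_measurable borel"
  shows "(\<integral>\<^sup>+y. ennreal (std_normal_density (y $ k)) * (\<integral>\<^sup>+\<tau>. F (y + \<tau> *\<^sub>R axis k 1) \<partial>lborel) \<partial>lborel)
    = (\<integral>\<^sup>+y. F y \<partial>lborel)"
proof -
  have "(\<integral>\<^sup>+y. ennreal (std_normal_density (y $ k)) * (\<integral>\<^sup>+\<tau>. F (y + \<tau> *\<^sub>R axis k 1) \<partial>lborel) \<partial>lborel)
     = (\<integral>\<^sup>+y. (\<integral>\<^sup>+\<tau>. ennreal (std_normal_density (y $ k)) * F (y + \<tau> *\<^sub>R axis k 1) \<partial>lborel) \<partial>lborel)"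
    by (intro nn_integral_cong nn_integral_cmult[symmetric]) measurable
  also have "\<dots> = (\<integral>\<^sup>+\<tau>. (\<integral>\<^sup>+y. ennreal (std_normal_density (y $ k)) * F (y + \<tau> *\<^sub>R axis k 1) \<partial>lborel) \<partial>lborel)"
    by (rule lborel_pair.Fubini') measurable
  also have "\<dots> = (\<integral>\<^sup>+\<tau>. (\<integral>\<^sup>+y. ennreal (std_normal_density (y $ k - \<tau>)) * F y \<partial>lborel) \<partial>lborel)"
  proof (rule nn_integral_cong)
    fix \<tau> :: real
    show "(\<integral>\<^sup>+y. ennreal (std_normal_density (y $ k)) * F (y + \<tau> *\<^sub>R axis k 1) \<partial>lborel)
      = (\<integral>\<^sup>+y. ennreal (std_normal_density (y $ k - \<tau>)) * F y \<partial>lborel)"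
      by (subst nn_integral_lborel_affine[of _ 1 "\<tau> *\<^sub>R axis k 1"]) (auto simp: add.commute axis_def)
  qed
  also have "\<dots> = (\<integral>\<^sup>+y. (\<integral>\<^sup>+\<tau>. ennreal (std_normal_density (y $ k - \<tau>)) * F y \<partial>lborel) \<partial>lborel)"
    by (rule lborel_pair.Fubini') measurable
  also have "\<dots> = (\<integral>\<^sup>+y. F y \<partial>lborel)"
    by (simp add: nn_integral_multc nn_integral_std_normal)
  finally show ?thesis .
qed

lemma AE_slice_finite:
  fixes F :: "real^'n::finite \<Rightarrow> ennreal"
  assumes [measurable]: "F \<in> borel_measurable borel" and fin: "(\<integral>\<^sup>+y. F y \<partial>lborel) < \<infinity>"
  shows "AE y in lborel. (\<integral>\<^sup>+\<tau>. F (y + \<tau> *\<^sub>R axis k 1) \<partial>lborel) < \<infinity>"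
proof -
  have "AE y in lborel. ennreal (std_normal_density (y $ k)) * (\<integral>\<^sup>+\<tau>. F (y + \<tau> *\<^sub>R axis k 1) \<partial>lborel) \<noteq> \<infinity>"
    using fin by (intro nn_integral_noteq_infinite) (auto simp: nn_integral_slice)
  then show ?thesis
    by eventually_elim
      (auto simp: ennreal_mult_eq_top_iff less_top normal_density_def)
qed

lemma AE_slice:
  fixes P :: "real^'n::finite \<Rightarrow> bool"
  assumes "AE y in lborel. P y"
  shows "AE y in lborel. AE \<tau> in lborel. P (y + \<tau> *\<^sub>R axis k 1)"
proof -
  obtain N where N: "{x. \<not> P x} \<subseteq> N" "N \<in> sets borel" "emeasure lborel N = 0"
    using AE_E[OF assms(1)] by (auto simp: space_borel)
  have [measurable]: "N \<in> sets borel" by fact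
  have "(\<integral>\<^sup>+y. ennreal (std_normal_density (y $ k)) * (\<integral>\<^sup>+\<tau>. indicator N (y + \<tau> *\<^sub>R axis k 1) \<partial>lborel) \<partial>lborel) = 0"
    by (subst nn_integral_slice) (use N in auto)
  then have "AE y in lborel. ennreal (std_normal_density (y $ k)) * (\<integral>\<^sup>+\<tau>. indicator N (y + \<tau> *\<^sub>R axis k 1) \<partial>lborel) = 0"
    by (subst (asm) nn_integral_0_iff_AE) auto
  then show ?thesis
  proof eventually_elim
    case (elim y)
    then have "(\<integral>\<^sup>+\<tau>. indicator N (y + \<tau> *\<^sub>R axis k 1) \<partial>lborel) = (0::ennreal)"
      by (auto simp: normal_density_def)
    then have "AE \<tau> in lborel. indicator N (y + \<tau> *\<^sub>R axis k 1) = (0::ennreal)"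
      by (subst (asm) nn_integral_0_iff_AE) auto
    then show ?case by eventually_elim (use N in \<open>auto simp: indicator_def split: if_splits\<close>)
  qed
qed

text \<open>Fubini's theorem is applied once before and once after the translation by \<tau>, hence
  the two integrability facts for the two forms of the integrand.\<close>

lemma integral_slice:
  fixes F :: "real^'n::finite \<Rightarrow> complex"
  assumes F: "integrable lborel F"
  shows "(\<integral>y. std_normal_density (y $ k) *\<^sub>R (\<integral>\<tau>. F (y + \<tau> *\<^sub>R axis k 1) \<partial>lborel) \<partial>lborel)
    = (\<integral>y. F y \<partial>lborel)"
proof -
  have [measurable]: "F \<in> borel_measurable borel" using F by auto
  have fin: "(\<integral>\<^sup>+y. ennreal (norm (F y)) \<partial>lborel) < \<infinity>" using F by (simp add: integrable_iff_bounded)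
  have i1: "integrable (lborel \<Otimes>\<^sub>M lborel) (\<lambda>(y, \<tau>). std_normal_density (y $ k) *\<^sub>R F (y + \<tau> *\<^sub>R axis k 1))"
  proof (rule integrableI_bounded)
    have "(\<integral>\<^sup>+z. ennreal (norm (case z of (y, \<tau>) \<Rightarrow> std_normal_density (y $ k) *\<^sub>R F (y + \<tau> *\<^sub>R axis k 1))) \<partial>(lborel \<Otimes>\<^sub>M lborel))
      = (\<integral>\<^sup>+y. (\<integral>\<^sup>+\<tau>. ennreal (std_normal_density (y $ k)) * ennreal (norm (F (y + \<tau> *\<^sub>R axis k 1))) \<partial>lborel) \<partial>lborel)"
      by (subst lborel.nn_integral_fst[symmetric]) (auto simp: ennreal_mult)
    also have "\<dots> = (\<integral>\<^sup>+y. ennreal (std_normal_density (y $ k)) * (\<integral>\<^sup>+\<tau>. ennreal (norm (F (y + \<tau> *\<^sub>R axis k 1))) \<partial>lborel) \<partial>lborel)"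
      by (intro nn_integral_cong nn_integral_cmult) measurable
    also have "\<dots> = (\<integral>\<^sup>+y. ennreal (norm (F y)) \<partial>lborel)" by (rule nn_integral_slice) measurable
    finally show "(\<integral>\<^sup>+z. ennreal (norm (case z of (y, \<tau>) \<Rightarrow> std_normal_density (y $ k) *\<^sub>R F (y + \<tau> *\<^sub>R axis k 1))) \<partial>(lborel \<Otimes>\<^sub>M lborel)) < \<infinity>"
      using fin by simp
  qed measurable
  have i2: "integrable (lborel \<Otimes>\<^sub>M lborel) (\<lambda>(\<tau>, y). std_normal_density (y $ k - \<tau>) *\<^sub>R F y)"
  proof (rule integrableI_bounded)
    have "(\<integral>\<^sup>+z. ennreal (norm (case z of (\<tau>, y) \<Rightarrow> std_normal_density (y $ k - \<tau>) *\<^sub>R F y)) \<partial>(lborel \<Otimes>\<^sub>M lborel))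
      = (\<integral>\<^sup>+y. (\<integral>\<^sup>+\<tau>. ennreal (std_normal_density (y $ k - \<tau>)) * ennreal (norm (F y)) \<partial>lborel) \<partial>lborel)"
      by (subst lborel_pair.nn_integral_snd[symmetric]) (auto simp: ennreal_mult)
    also have "\<dots> = (\<integral>\<^sup>+y. ennreal (norm (F y)) \<partial>lborel)"
      by (simp add: nn_integral_multc nn_integral_std_normal)
    finally show "(\<integral>\<^sup>+z. ennreal (norm (case z of (\<tau>, y) \<Rightarrow> std_normal_density (y $ k - \<tau>) *\<^sub>R F y)) \<partial>(lborel \<Otimes>\<^sub>M lborel)) < \<infinity>"
      using fin by simp
  qed measurable
  have one: "(\<integral>\<tau>. std_normal_density (c - \<tau>) \<partial>lborel) = 1" for c
    by (rule integral_eq_nn_integral[THEN trans]) (auto simp: nn_integral_std_normal)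
  have "(\<integral>y. std_normal_density (y $ k) *\<^sub>R (\<integral>\<tau>. F (y + \<tau> *\<^sub>R axis k 1) \<partial>lborel) \<partial>lborel)
    = (\<integral>y. (\<integral>\<tau>. std_normal_density (y $ k) *\<^sub>R F (y + \<tau> *\<^sub>R axis k 1) \<partial>lborel) \<partial>lborel)"
    by simp
  also have "\<dots> = (\<integral>\<tau>. (\<integral>y. std_normal_density (y $ k) *\<^sub>R F (y + \<tau> *\<^sub>R axis k 1) \<partial>lborel) \<partial>lborel)"
    by (rule lborel_pair.Fubini_integral[symmetric, OF i1])
  also have "\<dots> = (\<integral>\<tau>. (\<integral>y. std_normal_density (y $ k - \<tau>) *\<^sub>R F y \<partial>lborel) \<partial>lborel)"
  proof (rule Bochner_Integration.integral_cong[OF refl])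
    fix \<tau> :: real
    show "(\<integral>y. std_normal_density (y $ k) *\<^sub>R F (y + \<tau> *\<^sub>R axis k 1) \<partial>lborel)
      = (\<integral>y. std_normal_density (y $ k - \<tau>) *\<^sub>R F y \<partial>lborel)"
      by (subst integral_lborel_affine[of _ 1 "\<tau> *\<^sub>R axis k 1"]) (auto simp: add.commute axis_def)
  qed
  also have "\<dots> = (\<integral>y. (\<integral>\<tau>. std_normal_density (y $ k - \<tau>) *\<^sub>R F y \<partial>lborel) \<partial>lborel)"
    by (rule lborel_pair.Fubini_integral[symmetric, OF i2])
  also have "\<dots> = (\<integral>y. F y \<partial>lborel)"
  proof (rule Bochner_Integration.integral_cong[OF refl])
    fix y
    have "integrable lborel (\<lambda>\<tau>. std_normal_density (y $ k - \<tau>))"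
      using integrable_lborel_affine[of std_normal_density "-1" "y $ k"] by simp
    then show "(\<integral>\<tau>. std_normal_density (y $ k - \<tau>) *\<^sub>R F y \<partial>lborel) = F y"
      by (subst integral_scaleR_left) (auto simp: one)
  qed
  finally show ?thesis .
qed

subsection \<open>Contour shifts of square integrable rational functions\<close>

text \<open>Splitting off one linear factor at a common root lowers the degree of \<open>P\<close>,
  which drives the induction.\<close>

lemma cancel_common_roots:
  fixes P Q :: "complex poly"
  assumes "P \<noteq> 0"
  obtains P' Q' D where "P = D * P'" "Q = D * Q'" "\<And>s. poly P' s = 0 \<Longrightarrow> poly Q' s \<noteq> 0"
proof -
  have "\<exists>P' Q' D. P = D * P' \<and> Q = D * Q' \<and> (\<forall>s. poly P' s = 0 \<longrightarrow> poly Q' s \<noteq> 0)"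
    using assms
  proof (induction "degree P" arbitrary: P Q rule: less_induct)
    case less
    show ?case
    proof (cases "\<exists>a. poly P a = 0 \<and> poly Q a = 0")
      case False
      then show ?thesis by (intro exI[of _ P] exI[of _ Q] exI[of _ 1]) auto
    next
      case True
      then obtain a P1 Q1 where *: "P = [:-a, 1:] * P1" "Q = [:-a, 1:] * Q1"
        by (metis dvdE poly_eq_0_iff_dvd)
      with less.prems have "P1 \<noteq> 0" by auto
      moreover from this have "degree P1 < degree P"
        unfolding * by (subst degree_mult_eq) auto
      ultimately obtain P' Q' D where "P1 = D * P'" "Q1 = D * Q'" "\<forall>s. poly P' s = 0 \<longrightarrow> poly Q' s \<noteq> 0"
        using less.hyps by blast
      moreover from this have "P = ([:-a, 1:] * D) * P'" "Q = ([:-a, 1:] * D) * Q'"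
        using * by (simp_all only: mult.assoc)
      ultimately show ?thesis by blast
    qed
  qed
  with that show ?thesis by blast
qed

lemma nn_integral_inverse_at_0:
  assumes "r > 0"
  shows "(\<integral>\<^sup>+u. ennreal (1 / u) * indicator {0<..<r} u \<partial>lborel) = \<infinity>"
proof (rule ccontr)
  let ?I = "\<integral>\<^sup>+u. ennreal (1 / u) * indicator {0<..<r} u \<partial>lborel"
  assume "?I \<noteq> \<infinity>"
  then obtain n :: nat where n: "?I < of_nat n" using ennreal_Ex_less_of_nat by (metis infinity_ennreal_def top.not_eq_extremum)
  define b where "b = r / 2"
  \<comment> \<open>The integral of \<open>1 / u\<close> from \<open>a\<close> to \<open>b\<close>
    is \<open>ln b - ln a\<close>; this \<open>a\<close> makes it exactly \<open>n\<close>.\<close>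
  define a where "a = b * exp (- real n)"
  have ab: "0 < a" "a \<le> b" "b < r" using assms by (auto simp: a_def b_def)
  have "ln a = ln b - real n"
    using ab unfolding a_def by (subst ln_mult) (auto simp: zero_less_mult_iff)
  then have "ennreal (real n) = ennreal (ln b - ln a)" by simp
  also have "\<dots> = (\<integral>\<^sup>+u. ennreal (1 / u) * indicator {a..b} u \<partial>lborel)"
    using ab by (intro nn_integral_FTC_Icc[symmetric]) (auto intro!: derivative_eq_intros)
  also have "\<dots> \<le> ?I"
    using ab by (intro nn_integral_mono) (auto simp: indicator_def)
  finally show False using n by (simp add: ennreal_of_nat_eq_real_of_nat)
qed

text \<open>A zero of the reduced denominator with real part \<open>\<sigma>\<^sub>0\<close> makes the integral over the line \<open>Re s = \<sigma>\<close>
  at least of order \<open>1 / \<bar>\<sigma> - \<sigma>\<^sub>0\<bar>\<close>. At common zeros of \<open>P\<close> and \<open>Q\<close> the quotient has the junk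
  value \<open>0\<close>, hence the detour through the reduced fraction.\<close>
lemma no_pole_of_square_integrable:
  fixes P Q P' Q' D :: "complex poly"
  assumes PD: "P = D * P'" "Q = D * Q'" and "P \<noteq> 0" and root: "poly P' s0 = 0" and nz: "poly Q' s0 \<noteq> 0"
    and s0: "\<bar>Re s0\<bar> < \<epsilon>"
    and fin: "(\<integral>\<^sup>+\<sigma>. indicator {-\<epsilon><..<\<epsilon>} \<sigma> *
       (\<integral>\<^sup>+\<tau>. ennreal ((cmod (poly Q (Complex \<sigma> \<tau>) / poly P (Complex \<sigma> \<tau>)))\<^sup>2) \<partial>lborel) \<partial>lborel) < \<infinity>"
  shows False
proof -
  obtain P2 where P2: "P' = [:-s0, 1:] * P2" using root by (metis dvdE poly_eq_0_iff_dvd)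
  define c where "c = cmod (poly Q' s0) / 2"
  have c: "c > 0" using nz by (simp add: c_def)
  have "eventually (\<lambda>s. poly Q' s \<in> - cball 0 c) (nhds s0)"
  proof (rule topological_tendstoD)
    show "(poly Q' \<longlongrightarrow> poly Q' s0) (nhds s0)"
      using poly_isCont by (simp add: isCont_def tendsto_at_iff_tendsto_nhds)
    show "poly Q' s0 \<in> - cball 0 c" using nz by (simp add: c_def)
  qed auto
  then obtain r1 where r1': "r1 > 0" "\<forall>s. dist s s0 < r1 \<longrightarrow> poly Q' s \<in> - cball 0 c"
    unfolding eventually_nhds_metric by blast
  have r1: "r1 > 0" "\<And>s. dist s s0 < r1 \<Longrightarrow> cmod (poly Q' s) > c"
    using r1' by (auto simp: not_le)
  have "compact (poly P2 ` cball s0 1)"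
    by (intro compact_continuous_image continuous_intros) auto
  then obtain B where B: "B > 0" "\<And>s. s \<in> cball s0 1 \<Longrightarrow> cmod (poly P2 s) \<le> B"
    using compact_imp_bounded bounded_pos by (metis image_eqI)
  have "finite {s. poly P s = 0}" using \<open>P \<noteq> 0\<close> by (rule poly_roots_finite)
  from finite_set_avoid[OF this, of s0] obtain r2 where r2: "r2 > 0" "\<And>s. poly P s = 0 \<Longrightarrow> s \<noteq> s0 \<Longrightarrow> r2 \<le> dist s0 s"
    by auto
  \<comment> \<open>Halved, because points of the triangle used below may be almost
    \<open>2 * r\<close> away from \<open>s0\<close>. Within that distance \<open>Q'\<close> stays
    above \<open>c\<close>, \<open>P2\<close> is bounded by \<open>B\<close>, and \<open>P\<close>
    has no zero other than possibly \<open>s0\<close>; the last entry keeps the triangle in the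
    strip.\<close>
  define r where "r = min (min r1 r2) (min 1 (\<epsilon> - Re s0)) / 2"
  have r: "r > 0" "r < r1 / 1" "2 * r \<le> r1" "2 * r \<le> r2" "2 * r \<le> 1" "2 * r \<le> \<epsilon> - Re s0"
    using r1 r2 s0 by (auto simp: r_def)
  define \<kappa> where "\<kappa> = (c / B)\<^sup>2 / 2"
  have \<kappa>: "\<kappa> > 0" using c B by (simp add: \<kappa>_def)
  \<comment> \<open>On the triangle \<open>0 \<le> v \<le> u\<close> the squared distance from
    \<open>s0\<close> is at most \<open>2 * u^2\<close>, which accounts for the 2 in
    \<kappa>.\<close>
  have lower: "\<kappa> / u\<^sup>2 \<le> (cmod (poly Q s / poly P s))\<^sup>2" if s: "s = Complex (Re s0 + u) (Im s0 + v)" "0 < u" "u < r" "0 \<le> v" "v \<le> u" for s u v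
  proof -
    have d: "(cmod (s - s0))\<^sup>2 \<le> 2 * u\<^sup>2"
      using s by (simp add: cmod_power2)
    also have "\<dots> < (2 * r)\<^sup>2"
    proof -
      have "u\<^sup>2 < r\<^sup>2" "0 < r\<^sup>2" using s r by (auto intro: power_strict_mono)
      moreover have "(2 * r)\<^sup>2 = 4 * r\<^sup>2" by (simp add: power_mult_distrib)
      ultimately show ?thesis by linarith
    qed
    finally have "cmod (s - s0) < 2 * r" using r by (meson power2_less_imp_less less_imp_le mult_nonneg_nonneg zero_le_numeral)
    then have dist: "dist s s0 < 2 * r" by (simp add: dist_norm)
    have ne: "s \<noteq> s0" using s by (auto simp: complex_eq_iff)
    have Pnz: "poly P s \<noteq> 0" using r2(2)[of s] ne dist r by (auto simp: dist_commute)
    \<comment> \<open>Off the zeros of \<open>P\<close> the common factor \<open>D\<close> does not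
      vanish, so the cancellation is genuine.\<close>
    have eq: "poly Q s / poly P s = poly Q' s / ((s - s0) * poly P2 s)"
    proof -
      have "poly P s = poly D s * ((s - s0) * poly P2 s)" "poly Q s = poly D s * poly Q' s"
        by (simp_all add: PD P2 algebra_simps)
      with Pnz show ?thesis by simp
    qed
    have den: "cmod ((s - s0) * poly P2 s) > 0" using Pnz unfolding PD P2 by auto
    have "cmod ((s - s0) * poly P2 s) \<le> cmod (s - s0) * B"
      using B(2)[of s] dist r by (auto simp: norm_mult dist_commute intro!: mult_left_mono)
    moreover have "cmod (poly Q' s) \<ge> c" using r1(2)[of s] dist r by simp
    ultimately have "c / (cmod (s - s0) * B) \<le> cmod (poly Q s / poly P s)"
      unfolding eq norm_divide using den c by (intro frac_le) auto
    then have "(c / (cmod (s - s0) * B))\<^sup>2 \<le> (cmod (poly Q s / poly P s))\<^sup>2"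
      using c B by (intro power_mono) auto
    moreover have "\<kappa> / u\<^sup>2 \<le> (c / (cmod (s - s0) * B))\<^sup>2"
    proof -
      have "(c / (cmod (s - s0) * B))\<^sup>2 = (c / B)\<^sup>2 / (cmod (s - s0))\<^sup>2" by (simp add: power_divide power_mult_distrib)
      moreover have "(c / B)\<^sup>2 / (2 * u\<^sup>2) \<le> (c / B)\<^sup>2 / (cmod (s - s0))\<^sup>2"
        using d ne s(2) by (intro divide_left_mono) auto
      ultimately show ?thesis by (simp add: \<kappa>_def)
    qed
    ultimately show ?thesis by linarith
  qed
  let ?R = "\<lambda>\<sigma> \<tau>. ennreal ((cmod (poly Q (Complex \<sigma> \<tau>) / poly P (Complex \<sigma> \<tau>)))\<^sup>2)"
  have "continuous_on UNIV (\<lambda>z. Complex (fst z) (snd z))" by (simp add: Complex_eq) (intro continuous_intros)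
  then have mC: "(\<lambda>z. Complex (fst z) (snd z)) \<in> borel_measurable (borel \<Otimes>\<^sub>M borel)"
    by (simp add: borel_prod borel_measurable_continuous_onI)
  have mp: "(\<lambda>z. poly A (Complex (fst z) (snd z))) \<in> borel_measurable (borel \<Otimes>\<^sub>M borel)" for A :: "complex poly"
    by (rule measurable_compose[OF mC]) (intro borel_measurable_continuous_onI continuous_intros)
  have mR: "(\<lambda>z. ?R (fst z) (snd z)) \<in> borel_measurable (borel \<Otimes>\<^sub>M borel)"
    using mp[of P] mp[of Q] by measurable
  \<comment> \<open>At abscissa \<open>Re s0 + u\<close> the triangle has height \<open>u\<close>,
    which turns \<open>\<kappa> / u^2\<close> into \<open>\<kappa> / u\<close>; this is not
    integrable at 0.\<close>
  have inner: "ennreal (\<kappa> / u) \<le> (\<integral>\<^sup>+\<tau>. ?R (Re s0 + u) \<tau> \<partial>lborel)" if u: "0 < u" "u < r" for u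
  proof -
    have "ennreal (\<kappa> / u) = ennreal (\<kappa> / u\<^sup>2) * ennreal u"
      using u \<kappa> by (simp add: power2_eq_square flip: ennreal_mult)
    also have "\<dots> = (\<integral>\<^sup>+\<tau>. ennreal (\<kappa> / u\<^sup>2) * indicator {Im s0..Im s0 + u} \<tau> \<partial>lborel)"
      using u by (subst nn_integral_cmult_indicator) auto
    also have "\<dots> \<le> (\<integral>\<^sup>+\<tau>. ?R (Re s0 + u) \<tau> \<partial>lborel)"
    proof (rule nn_integral_mono)
      fix \<tau>
      show "ennreal (\<kappa> / u\<^sup>2) * indicator {Im s0..Im s0 + u} \<tau> \<le> ?R (Re s0 + u) \<tau>"
        using lower[of "Complex (Re s0 + u) \<tau>" u "\<tau> - Im s0"] u
        by (auto simp: indicator_def intro!: ennreal_leI)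
    qed
    finally show ?thesis .
  qed
  have "\<infinity> = ennreal \<kappa> * (\<integral>\<^sup>+u. ennreal (1 / u) * indicator {0<..<r} u \<partial>lborel)"
    using \<kappa> r by (subst nn_integral_inverse_at_0) (auto simp: ennreal_mult_top)
  also have "\<dots> = (\<integral>\<^sup>+u. ennreal (\<kappa> / u) * indicator {0<..<r} u \<partial>lborel)"
    using \<kappa> by (subst nn_integral_cmult[symmetric])
      (auto simp: indicator_def simp flip: ennreal_mult intro!: nn_integral_cong)
  also have "\<dots> \<le> (\<integral>\<^sup>+u. indicator {-\<epsilon><..<\<epsilon>} (Re s0 + u) * (\<integral>\<^sup>+\<tau>. ?R (Re s0 + u) \<tau> \<partial>lborel) \<partial>lborel)"
  proof (rule nn_integral_mono)
    fix u
    show "ennreal (\<kappa> / u) * indicator {0<..<r} u \<le> indicator {-\<epsilon><..<\<epsilon>} (Re s0 + u) * (\<integral>\<^sup>+\<tau>. ?R (Re s0 + u) \<tau> \<partial>lborel)"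
      using inner[of u] r s0 by (auto simp: indicator_def)
  qed
  also have "\<dots> = (\<integral>\<^sup>+\<sigma>. indicator {-\<epsilon><..<\<epsilon>} \<sigma> * (\<integral>\<^sup>+\<tau>. ?R \<sigma> \<tau> \<partial>lborel) \<partial>lborel)"
    using mR by (intro nn_integral_lborel_translate[where f="\<lambda>\<sigma>. indicator {-\<epsilon><..<\<epsilon>} \<sigma> * (\<integral>\<^sup>+\<tau>. ?R \<sigma> \<tau> \<partial>lborel)"]
      borel_measurable_times_ennreal lborel.borel_measurable_nn_integral) (auto simp: split_beta')
  finally show False using fin by simp
qed

text \<open>A primitive on the convex strip replaces the rectangular contour. The truncated
  integrals over the two lines are differences of its values, so they differ by its increments along
  the horizontal segments at heights \<open>n\<close> and \<open>- n\<close>, each at most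
  \<open>b n * \<bar>\<eta>\<bar>\<close>.\<close>

lemma vertical_shift:
  fixes f :: "complex \<Rightarrow> complex"
  assumes hol: "f holomorphic_on {s. \<bar>Re s\<bar> < \<epsilon>}" and \<eta>: "\<bar>\<eta>\<bar> < \<epsilon>"
    and i0: "integrable lborel (\<lambda>\<tau>. f (Complex 0 \<tau>))" and i1: "integrable lborel (\<lambda>\<tau>. f (Complex \<eta> \<tau>))"
    and b: "b \<longlonglongrightarrow> 0" and bound: "\<And>\<sigma> n. n \<ge> N \<Longrightarrow> \<bar>\<sigma>\<bar> \<le> \<bar>\<eta>\<bar> \<Longrightarrow> cmod (f (Complex \<sigma> (real n))) \<le> b n"
      "\<And>\<sigma> n. n \<ge> N \<Longrightarrow> \<bar>\<sigma>\<bar> \<le> \<bar>\<eta>\<bar> \<Longrightarrow> cmod (f (Complex \<sigma> (- real n))) \<le> b n"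
  shows "(\<integral>\<tau>. f (Complex 0 \<tau>) \<partial>lborel) = (\<integral>\<tau>. f (Complex \<eta> \<tau>) \<partial>lborel)"
proof -
  let ?S = "{s. \<bar>Re s\<bar> < \<epsilon>}"
  have S: "?S = {s. Re s < \<epsilon>} \<inter> {s. Re s > - \<epsilon>}" by auto
  have conv: "convex ?S" unfolding S by (intro convex_Int convex_halfspace_Re_lt convex_halfspace_Re_gt)
  have op: "open ?S" unfolding S by (intro open_Int open_halfspace_Re_lt open_halfspace_Re_gt)
  obtain g where g: "\<And>x. x \<in> ?S \<Longrightarrow> (g has_field_derivative f x) (at x within ?S)"
    using holomorphic_convex_primitive'[OF conv op hol] by blast
  have gd: "(g has_field_derivative f x) (at x)" if "x \<in> ?S" for x
    using g[OF that] at_within_open[OF that op] by simp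
  \<comment> \<open>The factor \<open>- \<i>\<close> comes from parametrising the vertical line by
    \<tau>, with tangent \<i>.\<close>
  have FTC: "(\<integral>\<tau>. indicator {-real n..real n} \<tau> *\<^sub>R f (Complex \<sigma> \<tau>) \<partial>lborel)
      = - \<i> * (g (Complex \<sigma> (real n)) - g (Complex \<sigma> (- real n)))" if \<sigma>: "\<bar>\<sigma>\<bar> < \<epsilon>" for \<sigma> n
  proof -
    have "(\<integral>\<tau>. indicator {-real n..real n} \<tau> *\<^sub>R f (Complex \<sigma> \<tau>) \<partial>lborel)
      = - \<i> * g (Complex \<sigma> (real n)) - (- \<i> * g (Complex \<sigma> (- real n)))"
    proof (rule integral_FTC_atLeastAtMost)
      fix \<tau>
      have "((\<lambda>\<tau>. Complex \<sigma> \<tau>) has_vector_derivative \<i>) (at \<tau> within {-real n..real n})"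
        unfolding Complex_eq by (auto intro!: derivative_eq_intros)
      moreover have "(g has_field_derivative f (Complex \<sigma> \<tau>)) (at (Complex \<sigma> \<tau>) within (\<lambda>\<tau>. Complex \<sigma> \<tau>) ` {-real n..real n})"
        by (rule DERIV_subset[OF gd]) (use \<sigma> in auto)
      ultimately have "((g \<circ> (\<lambda>\<tau>. Complex \<sigma> \<tau>)) has_vector_derivative \<i> * f (Complex \<sigma> \<tau>)) (at \<tau> within {-real n..real n})"
        by (rule field_vector_diff_chain_within)
      then have "((\<lambda>\<tau>. - \<i> * (g \<circ> (\<lambda>\<tau>. Complex \<sigma> \<tau>)) \<tau>) has_vector_derivative - \<i> * (\<i> * f (Complex \<sigma> \<tau>))) (at \<tau> within {-real n..real n})"
        by (rule has_vector_derivative_mult_right)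
      then show "((\<lambda>\<tau>. - \<i> * g (Complex \<sigma> \<tau>)) has_vector_derivative f (Complex \<sigma> \<tau>)) (at \<tau> within {-real n..real n})"
        by simp
    next
      have "continuous_on {-real n..real n} (\<lambda>\<tau>. Complex \<sigma> \<tau>)"
        unfolding Complex_eq by (intro continuous_intros)
      then show "continuous_on {-real n..real n} (\<lambda>\<tau>. f (Complex \<sigma> \<tau>))"
        by (rule continuous_on_compose2[OF holomorphic_on_imp_continuous_on[OF hol]]) (use \<sigma> in auto)
    qed simp
    then show ?thesis by (simp add: algebra_simps)
  qed
  have lim: "(\<lambda>n. \<integral>\<tau>. indicator {-real n..real n} \<tau> *\<^sub>R h \<tau> \<partial>lborel) \<longlonglongrightarrow> (\<integral>\<tau>. h \<tau> \<partial>lborel)"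
    if h: "integrable lborel h" for h :: "real \<Rightarrow> complex"
  proof (rule integral_dominated_convergence[where w="\<lambda>\<tau>. norm (h \<tau>)"])
    show "AE \<tau> in lborel. (\<lambda>n. indicator {-real n..real n} \<tau> *\<^sub>R h \<tau>) \<longlonglongrightarrow> h \<tau>"
    proof (intro AE_I2 tendsto_eventually)
      fix \<tau> :: real
      obtain N :: nat where "\<bar>\<tau>\<bar> \<le> real N" using real_arch_simple by blast
      then show "eventually (\<lambda>n. indicator {-real n..real n} \<tau> *\<^sub>R h \<tau> = h \<tau>) sequentially"
        by (auto simp: eventually_sequentially indicator_def intro!: exI[of _ N])
    qed
  qed (use h in \<open>auto simp: indicator_def\<close>)
  have seg: "cmod (g (Complex \<eta> t) - g (Complex 0 t)) \<le> B * \<bar>\<eta>\<bar>" if B: "\<And>\<sigma>. \<bar>\<sigma>\<bar> \<le> \<bar>\<eta>\<bar> \<Longrightarrow> cmod (f (Complex \<sigma> t)) \<le> B" for t B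
  proof -
    let ?T = "{s. Im s = t} \<inter> {s. \<bar>Re s\<bar> \<le> \<bar>\<eta>\<bar>}"
    have T: "?T = {s. Im s = t} \<inter> {s. Re s \<le> \<bar>\<eta>\<bar>} \<inter> {s. Re s \<ge> - \<bar>\<eta>\<bar>}" by auto
    have "{s. Im s = t} = {s. Im s \<le> t} \<inter> {s. Im s \<ge> t}" by auto
    then have "convex ?T" unfolding T by (simp only:) (intro convex_Int convex_halfspace_Im_le convex_halfspace_Im_ge convex_halfspace_Re_le convex_halfspace_Re_ge)
    moreover have "(g has_field_derivative f s) (at s within ?T)" if "s \<in> ?T" for s
      by (rule DERIV_subset[OF gd]) (use that \<eta> in auto)
    moreover have "cmod (f s) \<le> B" if "s \<in> ?T" for s
    proof -
      have "Complex (Re s) t = s" using that by (simp add: complex_eq_iff)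
      then show ?thesis using B[of "Re s"] that by simp
    qed
    ultimately have "cmod (g (Complex \<eta> t) - g (Complex 0 t)) \<le> B * cmod (Complex \<eta> t - Complex 0 t)"
      by (rule field_differentiable_bound) auto
    also have "cmod (Complex \<eta> t - Complex 0 t) = \<bar>\<eta>\<bar>" by (simp add: cmod_def)
    finally show ?thesis .
  qed
  define d where "d n = (\<integral>\<tau>. indicator {-real n..real n} \<tau> *\<^sub>R f (Complex \<eta> \<tau>) \<partial>lborel)
    - (\<integral>\<tau>. indicator {-real n..real n} \<tau> *\<^sub>R f (Complex 0 \<tau>) \<partial>lborel)" for n
  have "cmod (d n) \<le> 2 * \<bar>\<eta>\<bar> * b n" if "n \<ge> N" for n
  proof -
    have 0: "\<bar>0\<bar> < \<epsilon>" using \<eta> by simp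
    have "d n = - \<i> * ((g (Complex \<eta> (real n)) - g (Complex 0 (real n))) - (g (Complex \<eta> (- real n)) - g (Complex 0 (- real n))))"
      unfolding d_def FTC[OF \<eta>] FTC[OF 0] by (simp add: algebra_simps)
    then have "cmod (d n) \<le> cmod (g (Complex \<eta> (real n)) - g (Complex 0 (real n))) + cmod (g (Complex \<eta> (- real n)) - g (Complex 0 (- real n)))"
      by (simp add: norm_mult norm_triangle_ineq4)
    also have "\<dots> \<le> b n * \<bar>\<eta>\<bar> + b n * \<bar>\<eta>\<bar>"
      using bound that by (intro add_mono seg) auto
    finally show ?thesis by simp
  qed
  then have "eventually (\<lambda>n. cmod (d n) \<le> 2 * \<bar>\<eta>\<bar> * b n) sequentially"
    unfolding eventually_sequentially by blast
  moreover have "(\<lambda>n. 2 * \<bar>\<eta>\<bar> * b n) \<longlonglongrightarrow> 0" using tendsto_mult_right_zero[OF b] by simp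
  ultimately have "d \<longlonglongrightarrow> 0" by (rule Lim_null_comparison)
  moreover have "d \<longlonglongrightarrow> (\<integral>\<tau>. f (Complex \<eta> \<tau>) \<partial>lborel) - (\<integral>\<tau>. f (Complex 0 \<tau>) \<partial>lborel)"
    unfolding d_def by (intro tendsto_diff lim i0 i1)
  ultimately show ?thesis using LIMSEQ_unique by fastforce
qed

lemma poly_growth: "\<exists>A m. A \<ge> 0 \<and> (\<forall>s. cmod (poly Q s) \<le> A * (1 + cmod s) ^ m)" for Q :: "complex poly"
proof (induction Q)
  case 0 then show ?case by (auto intro!: exI[of _ 0])
next
  case (pCons a Q)
  then obtain A m where A: "A \<ge> 0" "\<And>s. cmod (poly Q s) \<le> A * (1 + cmod s) ^ m" by blast
  have "cmod (poly (pCons a Q) s) \<le> (cmod a + A) * (1 + cmod s) ^ Suc m" for s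
  proof -
    have one: "1 \<le> (1 + cmod s) ^ Suc m" by (intro one_le_power) simp
    have "cmod (poly (pCons a Q) s) \<le> cmod a + cmod s * cmod (poly Q s)"
      by (simp add: norm_triangle_le norm_mult)
    also have "\<dots> \<le> cmod a * (1 + cmod s) ^ Suc m + (1 + cmod s) * (A * (1 + cmod s) ^ m)"
      using A mult_left_mono[OF one, of "cmod a"] by (intro add_mono mult_mono) auto
    finally show ?thesis by (simp add: algebra_simps)
  qed
  then show ?case using A(1) by (intro exI[of _ "cmod a + A"] exI[of _ "Suc m"]) auto
qed

lemma poly_lower: "P \<noteq> 0 \<Longrightarrow> \<exists>r c. c > 0 \<and> (\<forall>s. r \<le> cmod s \<longrightarrow> c \<le> cmod (poly P s))" for P :: "complex poly"
proof (cases P)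
  case (pCons a R)
  assume "P \<noteq> 0"
  show ?thesis
  proof (cases "R = 0")
    case True
    with pCons \<open>P \<noteq> 0\<close> show ?thesis by (intro exI[of _ 0] exI[of _ "cmod a"]) auto
  next
    case False
    from poly_infinity[OF this, of 1 a] show ?thesis
      unfolding pCons by (metis zero_less_one)
  qed
qed

lemma gaussian_poly_decay:
  fixes \<rho> :: real assumes "\<rho> > 0"
  shows "(\<lambda>n. A * (C + real n) ^ m * exp (K + L * real n - \<rho> * (real n)\<^sup>2)) \<longlonglongrightarrow> 0"
  using assms by real_asymp

text \<open>At zeros of \<open>P\<close> the quotient has the value 0, so it need not be holomorphic
  as it stands. The reduced fraction replaces it: square integrability keeps it free of poles in the
  strip, and it agrees with the quotient off finitely many points of each vertical line.\<close>

lemma contour_shift_rational: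
  fixes P Q :: "complex poly" and b u :: real
  assumes "P \<noteq> 0" and \<eta>: "\<bar>\<eta>\<bar> < \<epsilon>" and \<rho>: "\<rho> > 0"
    and fin: "(\<integral>\<^sup>+\<sigma>. indicator {-\<epsilon><..<\<epsilon>} \<sigma> *
       (\<integral>\<^sup>+\<tau>. ennreal ((cmod (poly Q (Complex \<sigma> \<tau>) / poly P (Complex \<sigma> \<tau>)))\<^sup>2) \<partial>lborel) \<partial>lborel) < \<infinity>"
  defines "f \<equiv> \<lambda>s. poly Q s / poly P s * exp (of_real b * s + of_real \<rho> * (s + \<i> * of_real u)\<^sup>2)"
  assumes i0: "integrable lborel (\<lambda>\<tau>. f (Complex 0 \<tau>))" and i1: "integrable lborel (\<lambda>\<tau>. f (Complex \<eta> \<tau>))"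
  shows "(\<integral>\<tau>. f (Complex 0 \<tau>) \<partial>lborel) = (\<integral>\<tau>. f (Complex \<eta> \<tau>) \<partial>lborel)"
proof -
  obtain P' Q' D where PD: "P = D * P'" "Q = D * Q'" and cop: "\<And>s. poly P' s = 0 \<Longrightarrow> poly Q' s \<noteq> 0"
    using cancel_common_roots[OF \<open>P \<noteq> 0\<close>, of Q] by blast
  have P': "poly P' s \<noteq> 0" if "\<bar>Re s\<bar> < \<epsilon>" for s
    using no_pole_of_square_integrable[OF PD \<open>P \<noteq> 0\<close> _ cop that fin] by blast
  have "P' \<noteq> 0" using PD \<open>P \<noteq> 0\<close> by auto
  define E where "E s = exp (of_real b * s + of_real \<rho> * (s + \<i> * of_real u)\<^sup>2)" for s
  define h where "h s = poly Q' s / poly P' s * E s" for s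
  have fh: "AE \<tau> in lborel. f (Complex \<sigma> \<tau>) = h (Complex \<sigma> \<tau>)" for \<sigma>
  proof -
    have "finite {s. poly P s = 0}" using \<open>P \<noteq> 0\<close> by (rule poly_roots_finite)
    then have "finite (Complex \<sigma> -` {s. poly P s = 0})" by (rule finite_vimageI) (auto simp: inj_def)
    then have "AE \<tau> in lborel. \<tau> \<notin> Complex \<sigma> -` {s. poly P s = 0}"
      by (intro AE_not_in finite_imp_null_set_lborel)
    then show ?thesis
      by eventually_elim (auto simp: f_def h_def E_def PD)
  qed
  have hol: "h holomorphic_on {s. \<bar>Re s\<bar> < \<epsilon>}"
    unfolding h_def E_def using P' by (intro holomorphic_intros) auto
  have mh: "(\<lambda>\<tau>. h (Complex \<sigma> \<tau>)) \<in> borel_measurable borel" if "\<bar>\<sigma>\<bar> < \<epsilon>" for \<sigma>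
  proof (rule borel_measurable_continuous_onI)
    have "continuous_on UNIV (\<lambda>\<tau>. Complex \<sigma> \<tau>)"
      unfolding Complex_eq by (intro continuous_intros)
    then show "continuous_on UNIV (\<lambda>\<tau>. h (Complex \<sigma> \<tau>))"
      by (rule continuous_on_compose2[OF holomorphic_on_imp_continuous_on[OF hol]]) (use that in auto)
  qed
  have "\<epsilon> > 0" using \<eta> by linarith
  have mf: "(\<lambda>\<tau>. f (Complex \<sigma> \<tau>)) \<in> borel_measurable borel" for \<sigma>
  proof -
    have [measurable]: "(\<lambda>\<tau>. Complex \<sigma> \<tau>) \<in> borel_measurable borel"
      unfolding Complex_eq by measurable
    have [measurable]: "poly A \<in> borel_measurable borel" for A :: "complex poly"
      by (intro borel_measurable_continuous_onI continuous_intros)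
    show ?thesis unfolding f_def by measurable
  qed
  have ih: "integrable lborel (\<lambda>\<tau>. h (Complex \<sigma> \<tau>))" "(\<integral>\<tau>. f (Complex \<sigma> \<tau>) \<partial>lborel) = (\<integral>\<tau>. h (Complex \<sigma> \<tau>) \<partial>lborel)"
    if "integrable lborel (\<lambda>\<tau>. f (Complex \<sigma> \<tau>))" "\<bar>\<sigma>\<bar> < \<epsilon>" for \<sigma>
    using that mh[OF that(2)] mf[of \<sigma>] fh[of \<sigma>]
    by (auto intro: integrable_cong_AE_imp integral_cong_AE)
  obtain A m where A: "A \<ge> 0" "\<And>s. cmod (poly Q' s) \<le> A * (1 + cmod s) ^ m" using poly_growth by metis
  obtain r c where rc: "c > 0" "\<And>s. r \<le> cmod s \<Longrightarrow> c \<le> cmod (poly P' s)"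
    using poly_lower[OF \<open>P' \<noteq> 0\<close>] by blast
  obtain N :: nat where N: "r \<le> real N" using real_arch_simple by blast
  \<comment> \<open>A bound for \<open>h\<close> at heights \<open>n\<close> and \<open>- n\<close>:
    growth of \<open>Q'\<close> over the lower bound for \<open>P'\<close> far out, times the
    exponential of a bound for the real part
    \<open>b * \<sigma> + \<rho> * (\<sigma>^2 - (t + u)^2)\<close>.\<close>
  define bb where "bb n = A / c * (1 + \<epsilon> + real n) ^ m * exp ((\<bar>b\<bar> * \<epsilon> + \<rho> * \<epsilon>\<^sup>2) + (2 * \<rho> * \<bar>u\<bar>) * real n - \<rho> * (real n)\<^sup>2)" for n
  have bb: "bb \<longlonglongrightarrow> 0" unfolding bb_def by (rule gaussian_poly_decay[OF \<rho>])
  have hb: "cmod (h (Complex \<sigma> t)) \<le> bb n" if "\<bar>\<sigma>\<bar> \<le> \<bar>\<eta>\<bar>" "\<bar>t\<bar> = real n" "n \<ge> N" for \<sigma> t n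
  proof -
    let ?s = "Complex \<sigma> t"
    have "\<bar>t\<bar> \<le> cmod ?s" using abs_Im_le_cmod[of ?s] by simp
    then have "c \<le> cmod (poly P' ?s)" using that N by (intro rc(2)) auto
    moreover have "cmod ?s \<le> \<epsilon> + real n" using cmod_le[of ?s] that \<eta> by simp
    then have "cmod (poly Q' ?s) \<le> A * (1 + \<epsilon> + real n) ^ m"
      using A(1) by (intro order_trans[OF A(2)] mult_left_mono power_mono) auto
    ultimately have 1: "cmod (poly Q' ?s / poly P' ?s) \<le> A * (1 + \<epsilon> + real n) ^ m / c"
      using rc(1) \<open>\<epsilon> > 0\<close> A(1) unfolding norm_divide by (intro frac_le) auto
    have "Re (of_real b * ?s + of_real \<rho> * (?s + \<i> * of_real u)\<^sup>2) = b * \<sigma> + \<rho> * (\<sigma>\<^sup>2 - (t + u)\<^sup>2)"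
      by (simp add: power2_eq_square)
    also have "\<dots> \<le> (\<bar>b\<bar> * \<epsilon> + \<rho> * \<epsilon>\<^sup>2) + (2 * \<rho> * \<bar>u\<bar>) * real n - \<rho> * (real n)\<^sup>2"
    proof -
      have "b * \<sigma> \<le> \<bar>b * \<sigma>\<bar>" by simp
      also have "\<dots> \<le> \<bar>b\<bar> * \<epsilon>" unfolding abs_mult using that \<eta> by (intro mult_left_mono) auto
      finally have "b * \<sigma> \<le> \<bar>b\<bar> * \<epsilon>" .
      moreover have "\<sigma>\<^sup>2 \<le> \<epsilon>\<^sup>2" using that \<eta> by (intro abs_le_square_iff[THEN iffD1]) auto
      moreover have "- ((t + u)\<^sup>2) \<le> 2 * \<bar>u\<bar> * real n - (real n)\<^sup>2"
      proof -
        have "- (t * u) \<le> \<bar>t * u\<bar>" by simp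
        also have "\<dots> = \<bar>u\<bar> * real n" using that by (simp add: abs_mult mult.commute)
        finally have "- (t * u) \<le> \<bar>u\<bar> * real n" .
        moreover have "t\<^sup>2 = (real n)\<^sup>2" using that by (metis power2_abs)
        moreover have "0 \<le> u\<^sup>2" by simp
        moreover have "(t + u)\<^sup>2 = t\<^sup>2 + u\<^sup>2 + 2 * (t * u)" by (simp add: power2_sum)
        ultimately show ?thesis by linarith
      qed
      ultimately have "b * \<sigma> + \<rho> * (\<sigma>\<^sup>2 + - ((t + u)\<^sup>2)) \<le> \<bar>b\<bar> * \<epsilon> + \<rho> * (\<epsilon>\<^sup>2 + (2 * \<bar>u\<bar> * real n - (real n)\<^sup>2))"
        using \<rho> by (intro add_mono mult_left_mono) auto
      then show ?thesis by (simp add: algebra_simps)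
    qed
    finally have 2: "cmod (E ?s) \<le> exp ((\<bar>b\<bar> * \<epsilon> + \<rho> * \<epsilon>\<^sup>2) + (2 * \<rho> * \<bar>u\<bar>) * real n - \<rho> * (real n)\<^sup>2)"
      unfolding E_def norm_exp_eq_Re by simp
    have "cmod (h ?s) \<le> (A * (1 + \<epsilon> + real n) ^ m / c) * exp ((\<bar>b\<bar> * \<epsilon> + \<rho> * \<epsilon>\<^sup>2) + (2 * \<rho> * \<bar>u\<bar>) * real n - \<rho> * (real n)\<^sup>2)"
      unfolding h_def norm_mult using A(1) \<open>\<epsilon> > 0\<close> rc(1) by (intro mult_mono 1 2) auto
    then show ?thesis by (simp add: bb_def)
  qed
  have "(\<integral>\<tau>. h (Complex 0 \<tau>) \<partial>lborel) = (\<integral>\<tau>. h (Complex \<eta> \<tau>) \<partial>lborel)"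
    by (rule vertical_shift[where N=N, OF hol \<eta> ih(1)[OF i0] ih(1)[OF i1] bb]) (use hb \<open>\<epsilon> > 0\<close> \<eta> in auto)
  then show ?thesis using ih(2)[OF i0] ih(2)[OF i1 \<eta>] \<open>\<epsilon> > 0\<close> by simp
qed

subsection \<open>The kernel and its exponential decay\<close>

lemma nn_integral_square_sum_le:
  fixes f g :: "'a \<Rightarrow> complex"
  assumes [measurable]: "f \<in> borel_measurable M" "g \<in> borel_measurable M"
  shows "(\<integral>\<^sup>+x. ennreal ((cmod (f x + g x))\<^sup>2) \<partial>M)
    \<le> 2 * (\<integral>\<^sup>+x. ennreal ((cmod (f x))\<^sup>2) \<partial>M) + 2 * (\<integral>\<^sup>+x. ennreal ((cmod (g x))\<^sup>2) \<partial>M)"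
proof -
  have "(\<integral>\<^sup>+x. ennreal ((cmod (f x + g x))\<^sup>2) \<partial>M)
    \<le> (\<integral>\<^sup>+x. ennreal (2 * (cmod (f x))\<^sup>2) + ennreal (2 * (cmod (g x))\<^sup>2) \<partial>M)"
  proof (rule nn_integral_mono)
    fix x
    have "(cmod (f x + g x))\<^sup>2 \<le> (cmod (f x) + cmod (g x))\<^sup>2"
      by (intro power_mono norm_triangle_ineq) auto
    also have "\<dots> \<le> 2 * (cmod (f x))\<^sup>2 + 2 * (cmod (g x))\<^sup>2"
      using sum_squares_bound[of "cmod (f x)" "cmod (g x)"] by (simp add: power2_sum)
    finally show "ennreal ((cmod (f x + g x))\<^sup>2) \<le> ennreal (2 * (cmod (f x))\<^sup>2) + ennreal (2 * (cmod (g x))\<^sup>2)"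
      by (subst ennreal_plus[symmetric]) (auto intro: ennreal_leI simp del: ennreal_plus)
  qed
  also have "\<dots> = 2 * (\<integral>\<^sup>+x. ennreal ((cmod (f x))\<^sup>2) \<partial>M) + 2 * (\<integral>\<^sup>+x. ennreal ((cmod (g x))\<^sup>2) \<partial>M)"
    by (subst nn_integral_add) (simp_all add: ennreal_mult nn_integral_cmult)
  finally show ?thesis .
qed

text \<open>Weights \<open>4 ^ k\<close> on the squared increments leave a series with finite
  integral, as \<open>4 ^ k * (1/8) ^ k = (1/2) ^ k\<close>. Its sum \<open>S\<close> is finite
  almost everywhere and bounds each increment by \<open>sqrt S\<close> times
  \<open>(1/2) ^ k\<close>; the geometric tail gives the factor 2 in \<open>w\<close>. This single
  \<open>w\<close> later dominates all approximations at once.\<close>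

lemma L2_fast_Cauchy_limit:
  fixes f :: "nat \<Rightarrow> 'a \<Rightarrow> complex"
  assumes [measurable]: "\<And>k. f k \<in> borel_measurable M"
    and fast: "\<And>k. (\<integral>\<^sup>+x. ennreal ((cmod (f (Suc k) x - f k x))\<^sup>2) \<partial>M) \<le> ennreal (B * (1/8) ^ k)" and B: "B \<ge> 0"
  obtains g w where "g \<in> borel_measurable M" "w \<in> borel_measurable M" "\<And>x. w x \<ge> (0::real)"
    "(\<integral>\<^sup>+x. ennreal ((w x)\<^sup>2) \<partial>M) < \<infinity>"
    "AE x in M. (\<lambda>k. f k x) \<longlonglongrightarrow> g x" "AE x in M. \<forall>k. cmod (f k x - g x) \<le> (1/2) ^ k * w x"
proof -
  define S where "S x = (\<Sum>k. ennreal (4 ^ k * (cmod (f (Suc k) x - f k x))\<^sup>2))" for x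
  have [measurable]: "S \<in> borel_measurable M" unfolding S_def by measurable
  have "(\<integral>\<^sup>+x. S x \<partial>M) = (\<Sum>k. \<integral>\<^sup>+x. ennreal (4 ^ k) * ennreal ((cmod (f (Suc k) x - f k x))\<^sup>2) \<partial>M)"
    unfolding S_def by (subst nn_integral_suminf) (auto simp: ennreal_mult)
  also have "\<dots> \<le> (\<Sum>k. ennreal (B * (1/2) ^ k))"
  proof (intro suminf_le allI)
    fix k
    have "(\<integral>\<^sup>+x. ennreal (4 ^ k) * ennreal ((cmod (f (Suc k) x - f k x))\<^sup>2) \<partial>M) \<le> ennreal (4 ^ k) * ennreal (B * (1/8) ^ k)"
      by (subst nn_integral_cmult) (auto intro!: mult_left_mono fast)
    also have "\<dots> = ennreal (4 ^ k * (B * (1/8) ^ k))" by (rule ennreal_mult'[symmetric]) simp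
    also have "4 ^ k * (B * (1/8) ^ k) = B * (1/2::real) ^ k"
      by (simp add: mult.left_commute flip: power_mult_distrib)
    finally show "(\<integral>\<^sup>+x. ennreal (4 ^ k) * ennreal ((cmod (f (Suc k) x - f k x))\<^sup>2) \<partial>M) \<le> ennreal (B * (1/2) ^ k)" .
  qed auto
  also have "\<dots> = ennreal (\<Sum>k. B * (1/2) ^ k)"
    using B by (intro suminf_ennreal2 summable_mult summable_geometric) auto
  finally have S_fin: "(\<integral>\<^sup>+x. S x \<partial>M) < \<infinity>" by (rule order_le_less_trans) simp
  then have AES: "AE x in M. S x \<noteq> \<infinity>" by (intro nn_integral_noteq_infinite) auto
  define w where "w x = 2 * sqrt (enn2real (S x))" for x
  define g where "g x = lim (\<lambda>k. f k x)" for x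
  have [measurable]: "w \<in> borel_measurable M" "g \<in> borel_measurable M"
    unfolding w_def g_def by measurable
  have key: "(\<lambda>k. f k x) \<longlonglongrightarrow> g x \<and> (\<forall>k. cmod (f k x - g x) \<le> (1/2) ^ k * w x)" if "S x \<noteq> \<infinity>" for x
  proof -
    define s where "s = enn2real (S x)"
    have s0: "s \<ge> 0" by (simp add: s_def)
    have Ss: "S x = ennreal s" using that by (simp add: s_def less_top)
    have d: "cmod (f (Suc k) x - f k x) \<le> sqrt s * (1/2) ^ k" for k
    proof -
      have "ennreal (4 ^ k * (cmod (f (Suc k) x - f k x))\<^sup>2) \<le> S x"
      proof -
        define e where "e i = ennreal (4 ^ i * (cmod (f (Suc i) x - f i x))\<^sup>2)" for i
        have "sum e {k} \<le> suminf e" by (rule sum_le_suminf) auto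
        moreover have "S x = suminf e" by (simp only: S_def e_def[abs_def])
        ultimately show ?thesis by (simp add: e_def)
      qed
      then have "4 ^ k * (cmod (f (Suc k) x - f k x))\<^sup>2 \<le> s"
        unfolding Ss using s0 by (simp add: ennreal_le_iff)
      then have "(2 ^ k * cmod (f (Suc k) x - f k x))\<^sup>2 \<le> s"
      proof -
        have "(2 ^ k)\<^sup>2 = ((2::real)\<^sup>2) ^ k" by (metis power_mult mult.commute)
        then show ?thesis using \<open>4 ^ k * _ \<le> s\<close> by (simp add: power_mult_distrib)
      qed
      then have "2 ^ k * cmod (f (Suc k) x - f k x) \<le> sqrt s"
        by (rule real_le_rsqrt)
      then show ?thesis by (simp add: power_one_over field_simps)
    qed
    have sd: "summable (\<lambda>k. sqrt s * (1/2::real) ^ k)" by (intro summable_mult summable_geometric) auto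
    have sm: "summable (\<lambda>k. f (Suc k) x - f k x)"
      by (rule summable_comparison_test'[OF sd]) (use d in auto)
    then have "convergent (\<lambda>k. f k x)"
      unfolding convergent_def
    proof -
      have "(\<lambda>n. (\<Sum>k<n. f (Suc k) x - f k x) + f 0 x) \<longlonglongrightarrow> (\<Sum>k. f (Suc k) x - f k x) + f 0 x"
        by (intro tendsto_add summable_LIMSEQ sm tendsto_const)
      then show "\<exists>L. (\<lambda>k. f k x) \<longlonglongrightarrow> L"
        using sum_lessThan_telescope[of "\<lambda>k. f k x"] by auto
    qed
    then have lim: "(\<lambda>k. f k x) \<longlonglongrightarrow> g x" unfolding g_def by (simp add: convergent_LIMSEQ_iff)
    moreover have "cmod (f k x - g x) \<le> (1/2) ^ k * w x" for k
    proof -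
      have "cmod (f k x - f (k + n) x) \<le> (1/2) ^ k * w x" for n
      proof -
        have "f (k + n) x - f k x = (\<Sum>i<n. f (k + Suc i) x - f (k + i) x)"
          using sum_lessThan_telescope[of "\<lambda>i. f (k + i) x" n] by simp
        then have "cmod (f k x - f (k + n) x) \<le> (\<Sum>i<n. cmod (f (k + Suc i) x - f (k + i) x))"
          by (simp add: norm_minus_commute[of "f k x"] norm_sum)
        also have "\<dots> \<le> (\<Sum>i<n. sqrt s * (1/2) ^ (k + i))"
          by (intro sum_mono) (use d in auto)
        also have "\<dots> = sqrt s * (1/2) ^ k * (\<Sum>i<n. (1/2) ^ i)"
          by (simp add: sum_distrib_left power_add mult.assoc)
        also have "\<dots> \<le> sqrt s * (1/2) ^ k * 2"
        proof (intro mult_left_mono)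
          have "(\<Sum>i<n. (1/2::real) ^ i) \<le> (\<Sum>i. (1/2) ^ i)" by (intro sum_le_suminf summable_geometric) auto
          then show "(\<Sum>i<n. (1/2::real) ^ i) \<le> 2" by (simp add: suminf_geometric)
        qed (use s0 in auto)
        finally show ?thesis by (simp add: w_def s_def mult_ac)
      qed
      moreover have "(\<lambda>n. cmod (f k x - f (k + n) x)) \<longlonglongrightarrow> cmod (f k x - g x)"
        using LIMSEQ_ignore_initial_segment[OF lim, of k] by (intro tendsto_intros) (simp add: add.commute)
      ultimately show ?thesis by (intro Lim_bounded) auto
    qed
    ultimately show ?thesis by blast
  qed
  have "(\<integral>\<^sup>+x. ennreal ((w x)\<^sup>2) \<partial>M) \<le> (\<integral>\<^sup>+x. 4 * S x \<partial>M)"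
    using AES by (intro nn_integral_mono_AE) (auto elim!: eventually_mono simp: w_def power_mult_distrib ennreal_mult less_top)
  also have "\<dots> < \<infinity>" using S_fin by (simp add: nn_integral_cmult ennreal_mult_less_top)
  finally have w_fin: "(\<integral>\<^sup>+x. ennreal ((w x)\<^sup>2) \<partial>M) < \<infinity>" .
  show ?thesis
  proof (rule that[of g w])
    show "AE x in M. (\<lambda>k. f k x) \<longlonglongrightarrow> g x" "AE x in M. \<forall>k. cmod (f k x - g x) \<le> (1/2) ^ k * w x"
      using AES key by (auto elim!: eventually_mono)
  qed (use w_fin in \<open>auto simp: w_def\<close>)
qed

lemma integrable_product_AM_GM:
  fixes f g :: "'a \<Rightarrow> complex"
  assumes [measurable]: "f \<in> borel_measurable M" "g \<in> borel_measurable M"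
    and f: "(\<integral>\<^sup>+x. ennreal ((cmod (f x))\<^sup>2) \<partial>M) < \<infinity>" and g: "(\<integral>\<^sup>+x. ennreal ((cmod (g x))\<^sup>2) \<partial>M) < \<infinity>"
  shows "integrable M (\<lambda>x. f x * g x)"
proof (rule integrableI_bounded)
  have "(\<integral>\<^sup>+x. ennreal (norm (f x * g x)) \<partial>M) \<le> (\<integral>\<^sup>+x. ennreal ((cmod (f x))\<^sup>2) + ennreal ((cmod (g x))\<^sup>2) \<partial>M)"
  proof (rule nn_integral_mono)
    fix x
    have "2 * (cmod (f x) * cmod (g x)) \<le> (cmod (f x))\<^sup>2 + (cmod (g x))\<^sup>2"
      using sum_squares_bound[of "cmod (f x)" "cmod (g x)"] by (simp add: mult.assoc)
    moreover have "0 \<le> cmod (f x) * cmod (g x)" by simp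
    ultimately have "cmod (f x) * cmod (g x) \<le> (cmod (f x))\<^sup>2 + (cmod (g x))\<^sup>2" by linarith
    then show "ennreal (norm (f x * g x)) \<le> ennreal ((cmod (f x))\<^sup>2) + ennreal ((cmod (g x))\<^sup>2)"
      by (subst ennreal_plus[symmetric]) (auto simp: norm_mult intro: ennreal_leI simp del: ennreal_plus)
  qed
  also have "\<dots> < \<infinity>" using f g by (subst nn_integral_add) auto
  finally show "(\<integral>\<^sup>+x. ennreal (norm (f x * g x)) \<partial>M) < \<infinity>" .
qed measurable

text \<open>With \<open>s = i \<xi> + \<eta>\<close> this is \<open>exp (\<rho> * (s \<bullet> s))\<close>, entire in \<open>s\<close> and of Gaussian decay along the
  tube, so that contours can be shifted with absolutely convergent integrals.\<close>
definition damp :: "real \<Rightarrow> real^'n::finite \<Rightarrow> real^'n \<Rightarrow> complex" where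
  "damp \<rho> \<eta> \<xi> = exp (of_real \<rho> * (\<Sum>j\<in>UNIV. (\<i> * of_real (\<xi> $ j) + of_real (\<eta> $ j))\<^sup>2))"

lemma borel_measurable_damp [measurable]: "damp \<rho> \<eta> \<in> borel_measurable borel"
  unfolding damp_def by measurable

lemma norm_square_vec: "(norm x)\<^sup>2 = (\<Sum>j\<in>UNIV. (x $ j)\<^sup>2)" for x :: "real^'n::finite"
  unfolding power2_norm_eq_inner by (simp add: inner_vec_def power2_eq_square)

lemma cmod_damp: "cmod (damp \<rho> \<eta> \<xi>) = exp (\<rho> * ((norm \<eta>)\<^sup>2 - (norm \<xi>)\<^sup>2))"
proof -
  have "Re (of_real \<rho> * (\<Sum>j\<in>UNIV. (\<i> * of_real (\<xi> $ j) + of_real (\<eta> $ j))\<^sup>2))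
    = \<rho> * (\<Sum>j\<in>UNIV. (\<eta> $ j)\<^sup>2 - (\<xi> $ j)\<^sup>2)"
    by (simp add: power2_eq_square)
  then show ?thesis
    unfolding damp_def norm_exp_eq_Re norm_square_vec sum_subtractf by simp
qed

lemma damp_0: "damp \<rho> 0 \<xi> = of_real (exp (- \<rho> * (norm \<xi>)\<^sup>2))"
  unfolding damp_def norm_square_vec by (simp add: power_mult_distrib sum_negf exp_of_real[symmetric])

lemma damp_fin:
  fixes \<eta> :: "real^'n::finite"
  assumes "\<rho> > 0" shows "(\<integral>\<^sup>+\<xi>. ennreal ((cmod (damp \<rho> \<eta> \<xi>))\<^sup>2) \<partial>lborel) < \<infinity>"
proof -
  have "(cmod (damp \<rho> \<eta> \<xi>))\<^sup>2 = exp (2 * \<rho> * (norm \<eta>)\<^sup>2) * gauss ((2 * sqrt \<rho>) *\<^sub>R \<xi>)" for \<xi>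
    using assms unfolding cmod_damp gauss_def
    by (simp add: power_mult_distrib exp_add[symmetric] exp_double[symmetric] right_diff_distrib)
  moreover have i: "integrable lborel (\<lambda>\<xi>::real^'n. exp (2 * \<rho> * (norm \<eta>)\<^sup>2) * gauss ((2 * sqrt \<rho>) *\<^sub>R \<xi>))"
    using assms by (intro integrable_mult_right integrable_gauss_scale) auto
  ultimately show ?thesis
    using nn_integral_eq_integral[OF i] by simp
qed

lemma damp_tendsto:
  assumes "\<rho> \<longlonglongrightarrow> 0" shows "(\<lambda>k. damp (\<rho> k) 0 \<xi>) \<longlonglongrightarrow> 1"
proof -
  have "(\<lambda>k. exp (- \<rho> k * (norm \<xi>)\<^sup>2)) \<longlonglongrightarrow> exp (- 0 * (norm \<xi>)\<^sup>2)"
    by (intro tendsto_intros assms)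
  then have "(\<lambda>k. complex_of_real (exp (- \<rho> k * (norm \<xi>)\<^sup>2))) \<longlonglongrightarrow> complex_of_real (exp (- 0 * (norm \<xi>)\<^sup>2))"
    by (rule tendsto_of_real)
  then show ?thesis unfolding damp_0 by simp
qed

lemma cmod_damp_le_1: "\<rho> \<ge> 0 \<Longrightarrow> cmod (damp \<rho> 0 \<xi>) \<le> 1"
  unfolding cmod_damp by simp

section \<open>The symbol on the tube and its contour shift\<close>

locale tube_symbol =
  fixes p q :: "('n::finite \<Rightarrow> nat) \<Rightarrow> real" and \<epsilon> C :: real
  assumes is_poly_p: "is_poly p" and p_nz: "\<exists>\<alpha>. p \<alpha> \<noteq> 0" and eps: "\<epsilon> > 0"
    and bound: "\<And>\<eta>::real^'n. norm \<eta> < \<epsilon> \<Longrightarrow>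
       (\<integral>\<^sup>+\<xi>. ennreal ((cmod (symbol_ratio q p \<eta> \<xi>))\<^sup>2) \<partial>lborel) \<le> ennreal C"
begin

abbreviation h :: "real^'n \<Rightarrow> real^'n \<Rightarrow> complex" where
  "h \<equiv> symbol_ratio q p"

lemma h_fin: "norm \<eta> < \<epsilon> \<Longrightarrow> (\<integral>\<^sup>+\<xi>. ennreal ((cmod (h \<eta> \<xi>))\<^sup>2) \<partial>lborel) < \<infinity>"
  using bound order_le_less_trans by fastforce

lemma integrable_h_damp:
  "norm \<eta> < \<epsilon> \<Longrightarrow> \<rho> > 0 \<Longrightarrow> integrable lborel (\<lambda>\<xi>. h \<eta> \<xi> * damp \<rho> \<eta> \<xi>)"
  by (intro integrable_product_AM_GM h_fin damp_fin) measurable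

lemma AE_line_poly_nonzero:
  "AE y in lborel. line_poly p (\<lambda>j. \<i> * of_real (y $ j)) (\<lambda>j. if j = k then 1 else 0) \<noteq> 0"
proof -
  obtain \<alpha> where "p \<alpha> \<noteq> 0" using p_nz by blast
  from AE_slice[OF AE_poly_eval_nonzero[OF is_poly_p this], of k] show ?thesis
  proof eventually_elim
    case (elim y)
    from AE_lborel_exists[OF this] obtain \<tau> :: real
      where \<tau>: "poly_eval p (\<lambda>j. \<i> * of_real ((y + \<tau> *\<^sub>R axis k 1) $ j)) \<noteq> 0" by blast
    have "poly (line_poly p (\<lambda>j. \<i> * of_real (y $ j)) (\<lambda>j. if j = k then 1 else 0)) (\<i> * of_real \<tau>)
      = poly_eval p (\<lambda>j. \<i> * of_real ((y + \<tau> *\<^sub>R axis k 1) $ j))"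
      unfolding poly_line_poly by (intro arg_cong[where f="poly_eval p"]) (auto simp: axis_def algebra_simps)
    with \<tau> show ?case by auto
  qed
qed

text \<open>Since \<open>\<i> * (y + \<tau>) + \<sigma> = \<i> * y + (\<sigma> + \<i> *
  \<tau>)\<close>, a real shift by \<sigma> and a translation by \<tau> along the same axis combine
  into one complex variable.\<close>

lemma h_line:
  "h (\<sigma> *\<^sub>R axis k 1) (y + \<tau> *\<^sub>R axis k 1)
    = poly (line_poly q (\<lambda>j. \<i> * of_real (y $ j)) (\<lambda>j. if j = k then 1 else 0)) (Complex \<sigma> \<tau>)
    / poly (line_poly p (\<lambda>j. \<i> * of_real (y $ j)) (\<lambda>j. if j = k then 1 else 0)) (Complex \<sigma> \<tau>)"
proof -
  have "(\<lambda>j. \<i> * of_real ((y + \<tau> *\<^sub>R axis k 1) $ j) + of_real ((\<sigma> *\<^sub>R axis k 1) $ j))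
    = (\<lambda>j. \<i> * of_real (y $ j) + Complex \<sigma> \<tau> * (if j = k then 1 else 0))"
    by (auto simp: axis_def Complex_eq algebra_simps)
  then show ?thesis unfolding symbol_ratio_def poly_line_poly by simp
qed

text \<open>The bound is uniform in the shift, so it can be integrated over
  \<open>\<bar>\<sigma>\<bar> < \<epsilon>\<close>; exchanging this with the slice average leaves a
  finite integral over almost every strip. It provides the absence of poles in
  \<open>contour_shift_rational\<close>.\<close>

lemma AE_strip_finite:
  "AE y in lborel. (\<integral>\<^sup>+\<sigma>. indicator {-\<epsilon><..<\<epsilon>} \<sigma> *
     (\<integral>\<^sup>+\<tau>. ennreal ((cmod (h (\<sigma> *\<^sub>R axis k 1) (y + \<tau> *\<^sub>R axis k 1)))\<^sup>2) \<partial>lborel) \<partial>lborel) < \<infinity>"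
proof -
  define H where "H \<sigma> \<xi> = ennreal ((cmod (h (\<sigma> *\<^sub>R axis k 1) \<xi>))\<^sup>2)" for \<sigma> :: real and \<xi>
  have [measurable]: "(\<lambda>x. H (f x) (g x)) \<in> borel_measurable M"
    if [measurable]: "f \<in> borel_measurable M" "g \<in> borel_measurable M" for f g and M :: "'x measure"
    unfolding H_def by measurable
  let ?a = "axis k (1::real)"
  let ?w = "\<lambda>y::real^'n. ennreal (std_normal_density (y $ k))"
  have "(\<integral>\<^sup>+y. ?w y * (\<integral>\<^sup>+\<sigma>. indicator {-\<epsilon><..<\<epsilon>} \<sigma> * (\<integral>\<^sup>+\<tau>. H \<sigma> (y + \<tau> *\<^sub>R ?a) \<partial>lborel) \<partial>lborel) \<partial>lborel)
    = (\<integral>\<^sup>+y. (\<integral>\<^sup>+\<sigma>. indicator {-\<epsilon><..<\<epsilon>} \<sigma> * (?w y * (\<integral>\<^sup>+\<tau>. H \<sigma> (y + \<tau> *\<^sub>R ?a) \<partial>lborel)) \<partial>lborel) \<partial>lborel)"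
    by (subst nn_integral_cmult[symmetric]) (auto simp: mult_ac)
  also have "\<dots> = (\<integral>\<^sup>+\<sigma>. (\<integral>\<^sup>+y. indicator {-\<epsilon><..<\<epsilon>} \<sigma> * (?w y * (\<integral>\<^sup>+\<tau>. H \<sigma> (y + \<tau> *\<^sub>R ?a) \<partial>lborel)) \<partial>lborel) \<partial>lborel)"
    by (rule lborel_pair.Fubini') measurable
  also have "\<dots> = (\<integral>\<^sup>+\<sigma>. indicator {-\<epsilon><..<\<epsilon>} \<sigma> * (\<integral>\<^sup>+y. H \<sigma> y \<partial>lborel) \<partial>lborel)"
    by (subst nn_integral_cmult) (auto simp: nn_integral_slice)
  also have "\<dots> \<le> (\<integral>\<^sup>+\<sigma>. ennreal C * indicator {-\<epsilon><..<\<epsilon>} \<sigma> \<partial>lborel)"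
  proof (rule nn_integral_mono)
    fix \<sigma>
    show "indicator {-\<epsilon><..<\<epsilon>} \<sigma> * (\<integral>\<^sup>+y. H \<sigma> y \<partial>lborel) \<le> ennreal C * indicator {-\<epsilon><..<\<epsilon>} \<sigma>"
      unfolding H_def using bound[of "\<sigma> *\<^sub>R ?a"] by (auto simp: indicator_def norm_axis_1)
  qed
  also have "\<dots> < \<infinity>"
    using eps by (subst nn_integral_cmult_indicator) (auto simp: ennreal_mult_less_top)
  finally have "(\<integral>\<^sup>+y. ?w y * (\<integral>\<^sup>+\<sigma>. indicator {-\<epsilon><..<\<epsilon>} \<sigma> * (\<integral>\<^sup>+\<tau>. H \<sigma> (y + \<tau> *\<^sub>R ?a) \<partial>lborel) \<partial>lborel) \<partial>lborel) \<noteq> \<infinity>"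
    by simp
  then have "AE y in lborel. ?w y * (\<integral>\<^sup>+\<sigma>. indicator {-\<epsilon><..<\<epsilon>} \<sigma> * (\<integral>\<^sup>+\<tau>. H \<sigma> (y + \<tau> *\<^sub>R ?a) \<partial>lborel) \<partial>lborel) \<noteq> \<infinity>"
    by (intro nn_integral_noteq_infinite) measurable
  then show ?thesis
    unfolding H_def[symmetric]
    by eventually_elim (auto simp: ennreal_mult_eq_top_iff less_top normal_density_def)
qed

text \<open>On almost every line parallel to the axis the two integrands are, up to a common
  constant, one function of a complex variable on two vertical lines. The prefactor
  \<open>exp (s * x $ k)\<close> completes \<open>iexp (\<xi> \<bullet> x)\<close> to an exponential
  of that variable.\<close>

lemma ft_shift:
  assumes s: "\<bar>s\<bar> < \<epsilon>" and \<rho>: "\<rho> > 0"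
  shows "ft (\<lambda>\<xi>. h 0 \<xi> * damp \<rho> 0 \<xi>) x
    = exp (s * x $ k) * ft (\<lambda>\<xi>. h (s *\<^sub>R axis k 1) \<xi> * damp \<rho> (s *\<^sub>R axis k 1) \<xi>) x"
proof -
  let ?a = "axis k (1::real) :: real^'n"
  define F where "F \<sigma> \<xi> = exp (\<sigma> * x $ k) * (iexp (\<xi> \<bullet> x) * (h (\<sigma> *\<^sub>R ?a) \<xi> * damp \<rho> (\<sigma> *\<^sub>R ?a) \<xi>))" for \<sigma> \<xi>
  have [measurable]: "F \<sigma> \<in> borel_measurable borel" for \<sigma> unfolding F_def by measurable
  have int: "integrable lborel (F \<sigma>)" if "\<bar>\<sigma>\<bar> < \<epsilon>" for \<sigma>
    unfolding F_def using that by (intro integrable_mult_right ft_integrable integrable_h_damp \<rho>) (simp add: norm_axis_1)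
  have AEint: "AE y in lborel. integrable lborel (\<lambda>\<tau>. F \<sigma> (y + \<tau> *\<^sub>R ?a))" if "\<bar>\<sigma>\<bar> < \<epsilon>" for \<sigma>
  proof -
    have "AE y in lborel. (\<integral>\<^sup>+\<tau>. ennreal (norm (F \<sigma> (y + \<tau> *\<^sub>R ?a))) \<partial>lborel) < \<infinity>"
      by (rule AE_slice_finite) (use int[OF that] in \<open>auto simp: integrable_iff_bounded\<close>)
    then show ?thesis by eventually_elim (auto simp: integrable_iff_bounded)
  qed
  have s0: "\<bar>0\<bar> < \<epsilon>" using eps by simp
  have "AE y in lborel. (\<integral>\<tau>. F 0 (y + \<tau> *\<^sub>R ?a) \<partial>lborel) = (\<integral>\<tau>. F s (y + \<tau> *\<^sub>R ?a) \<partial>lborel)"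
    using AE_line_poly_nonzero[of k] AE_strip_finite[of k] AEint[OF s] AEint[OF s0]
  proof eventually_elim
    case (elim y)
    let ?P = "line_poly p (\<lambda>j. \<i> * of_real (y $ j)) (\<lambda>j. if j = k then 1 else 0)"
    let ?Q = "line_poly q (\<lambda>j. \<i> * of_real (y $ j)) (\<lambda>j. if j = k then 1 else 0)"
    define f where "f z = poly ?Q z / poly ?P z * exp (of_real (x $ k) * z + of_real \<rho> * (z + \<i> * of_real (y $ k))\<^sup>2)" for z
    \<comment> \<open>\<open>c\<close> collects what does not depend on \<sigma> and \<tau>: the
      phase at \<open>y\<close> and the damping in the remaining coordinates.\<close>
    define c where "c = iexp (y \<bullet> x) * exp (of_real \<rho> * (\<Sum>j\<in>UNIV - {k}. (\<i> * of_real (y $ j))\<^sup>2))"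
    have c: "c \<noteq> 0" by (simp add: c_def)
    have Ff: "F \<sigma> (y + \<tau> *\<^sub>R ?a) = c * f (Complex \<sigma> \<tau>)" for \<sigma> \<tau>
    proof -
      have "(\<Sum>j\<in>UNIV. (\<i> * of_real ((y + \<tau> *\<^sub>R ?a) $ j) + of_real ((\<sigma> *\<^sub>R ?a) $ j))\<^sup>2)
        = (Complex \<sigma> \<tau> + \<i> * of_real (y $ k))\<^sup>2 + (\<Sum>j\<in>UNIV - {k}. (\<i> * of_real (y $ j))\<^sup>2)"
        by (subst sum.remove[of _ k]) (auto simp: axis_def Complex_eq algebra_simps intro!: sum.cong)
      then have d: "damp \<rho> (\<sigma> *\<^sub>R ?a) (y + \<tau> *\<^sub>R ?a) = exp (of_real \<rho> * (Complex \<sigma> \<tau> + \<i> * of_real (y $ k))\<^sup>2)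
         * exp (of_real \<rho> * (\<Sum>j\<in>UNIV - {k}. (\<i> * of_real (y $ j))\<^sup>2))"
        unfolding damp_def by (simp add: distrib_left exp_add)
      have e: "exp (\<sigma> * x $ k) * iexp ((y + \<tau> *\<^sub>R ?a) \<bullet> x) = iexp (y \<bullet> x) * exp (of_real (x $ k) * Complex \<sigma> \<tau>)"
        by (simp add: inner_add_left inner_axis' Complex_eq algebra_simps exp_add exp_of_real[symmetric])
      have "F \<sigma> (y + \<tau> *\<^sub>R ?a) = (exp (\<sigma> * x $ k) * iexp ((y + \<tau> *\<^sub>R ?a) \<bullet> x)) * h (\<sigma> *\<^sub>R ?a) (y + \<tau> *\<^sub>R ?a) * damp \<rho> (\<sigma> *\<^sub>R ?a) (y + \<tau> *\<^sub>R ?a)"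
        by (simp add: F_def mult_ac)
      also have "\<dots> = c * f (Complex \<sigma> \<tau>)"
        unfolding d e h_line f_def c_def by (simp add: exp_add mult_ac)
      finally show ?thesis .
    qed
    have intf: "integrable lborel (\<lambda>\<tau>. f (Complex \<sigma> \<tau>))" if "integrable lborel (\<lambda>\<tau>. F \<sigma> (y + \<tau> *\<^sub>R ?a))" for \<sigma>
      using integrable_mult_right[OF that, of "inverse c"] c by (simp add: Ff flip: mult.assoc)
    have "(\<integral>\<tau>. f (Complex 0 \<tau>) \<partial>lborel) = (\<integral>\<tau>. f (Complex s \<tau>) \<partial>lborel)"
      unfolding f_def
    proof (rule contour_shift_rational[OF elim(1) s \<rho>])
      show "(\<integral>\<^sup>+\<sigma>. indicator {-\<epsilon><..<\<epsilon>} \<sigma> * (\<integral>\<^sup>+\<tau>. ennreal ((cmod (poly ?Q (Complex \<sigma> \<tau>) / poly ?P (Complex \<sigma> \<tau>)))\<^sup>2) \<partial>lborel) \<partial>lborel) < \<infinity>"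
        using elim(2) unfolding h_line .
      show "integrable lborel (\<lambda>\<tau>. poly ?Q (Complex 0 \<tau>) / poly ?P (Complex 0 \<tau>) * exp (of_real (x $ k) * Complex 0 \<tau> + of_real \<rho> * (Complex 0 \<tau> + \<i> * of_real (y $ k))\<^sup>2))"
        using intf[OF elim(4)] unfolding f_def .
      show "integrable lborel (\<lambda>\<tau>. poly ?Q (Complex s \<tau>) / poly ?P (Complex s \<tau>) * exp (of_real (x $ k) * Complex s \<tau> + of_real \<rho> * (Complex s \<tau> + \<i> * of_real (y $ k))\<^sup>2))"
        using intf[OF elim(3)] unfolding f_def .
    qed
    then show ?case unfolding Ff by simp
  qed
  then have "(\<integral>y. std_normal_density (y $ k) *\<^sub>R (\<integral>\<tau>. F 0 (y + \<tau> *\<^sub>R ?a) \<partial>lborel) \<partial>lborel)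
     = (\<integral>y. std_normal_density (y $ k) *\<^sub>R (\<integral>\<tau>. F s (y + \<tau> *\<^sub>R ?a) \<partial>lborel) \<partial>lborel)"
    by (intro integral_cong_AE) (auto elim: eventually_mono)
  then have "(\<integral>y. F 0 y \<partial>lborel) = (\<integral>y. F s y \<partial>lborel)"
    unfolding integral_slice[OF int[OF s]] integral_slice[OF int[OF s0]] .
  then show ?thesis unfolding F_def ft_def by simp
qed

end

section \<open>The normalised inverse transform and auxiliary integrability facts\<close>

lemma inv_fourier_ft: "inv_fourier g t = of_real (1 / (2 * pi) ^ CARD('n)) * ft g t"
  for g :: "real^'n::finite \<Rightarrow> complex"
  by (simp add: inv_fourier_def ft_def)

lemma inv_fourier_measurable [measurable]:
  assumes [measurable]: "g \<in> borel_measurable borel"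
  shows "inv_fourier g \<in> borel_measurable borel"
  unfolding inv_fourier_ft[abs_def] by measurable

text \<open>The squared normalisation times the constant of \<open>plancherel_le\<close> is
  \<open>1 / (2 * pi) ^ d\<close>, which is then bounded by 1.\<close>

lemma plancherel_inv_fourier:
  fixes g :: "real^'n::finite \<Rightarrow> complex"
  assumes g: "integrable lborel g"
  shows "(\<integral>\<^sup>+x. ennreal ((cmod (inv_fourier g x))\<^sup>2) \<partial>lborel) \<le> (\<integral>\<^sup>+x. ennreal ((cmod (g x))\<^sup>2) \<partial>lborel)"
proof -
  have [measurable]: "g \<in> borel_measurable borel" using g by auto
  define K where "K = (2 * pi) ^ CARD('n)"
  have K: "K \<ge> 1" unfolding K_def using pi_gt3 by (intro one_le_power) simp
  have "(\<integral>\<^sup>+x. ennreal ((cmod (inv_fourier g x))\<^sup>2) \<partial>lborel) = (\<integral>\<^sup>+x. ennreal ((1 / K)\<^sup>2) * ennreal ((cmod (ft g x))\<^sup>2) \<partial>lborel)"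
    unfolding inv_fourier_ft K_def[symmetric]
    by (intro nn_integral_cong) (simp add: norm_mult power_mult_distrib norm_divide power_divide flip: ennreal_mult)
  also have "\<dots> = ennreal ((1 / K)\<^sup>2) * (\<integral>\<^sup>+x. ennreal ((cmod (ft g x))\<^sup>2) \<partial>lborel)"
    by (rule nn_integral_cmult) measurable
  also have "\<dots> \<le> ennreal ((1 / K)\<^sup>2) * (ennreal K * (\<integral>\<^sup>+x. ennreal ((cmod (g x))\<^sup>2) \<partial>lborel))"
    unfolding K_def using plancherel_le[OF g] by (intro mult_left_mono) auto
  also have "\<dots> = ennreal (1 / K) * (\<integral>\<^sup>+x. ennreal ((cmod (g x))\<^sup>2) \<partial>lborel)"
    unfolding mult.assoc[symmetric] using K by (subst ennreal_mult[symmetric]) (auto simp: power2_eq_square)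
  also have "\<dots> \<le> 1 * (\<integral>\<^sup>+x. ennreal ((cmod (g x))\<^sup>2) \<partial>lborel)"
    using K by (intro mult_right_mono) (auto simp: ennreal_le_1)
  finally show ?thesis by simp
qed

lemma inv_fourier_diff:
  "integrable lborel f \<Longrightarrow> integrable lborel g \<Longrightarrow> inv_fourier (\<lambda>x. f x - g x) t = inv_fourier f t - inv_fourier g t"
  unfolding inv_fourier_ft ft_def right_diff_distrib
  by (subst Bochner_Integration.integral_diff) (auto intro: ft_integrable simp: right_diff_distrib)

lemma inv_fourier_real:
  fixes g :: "real^'n::finite \<Rightarrow> complex"
  assumes [measurable]: "g \<in> borel_measurable borel" and sym: "\<And>x. g (- x) = cnj (g x)"
  shows "inv_fourier g t = of_real (Re (inv_fourier g t))"
proof -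
  have "cnj (ft g t) = (\<integral>x. cnj (iexp (x \<bullet> t) * g x) \<partial>lborel)"
    unfolding ft_def by (rule Bochner_Integration.integral_cnj[symmetric])
  also have "\<dots> = (\<integral>x. cnj (iexp ((- x) \<bullet> t) * g (- x)) \<partial>lborel)"
    by (subst integral_lborel_affine[of _ "-1" 0]) auto
  also have "\<dots> = ft g t" unfolding ft_def sym by (simp add: exp_cnj)
  finally have "cnj (inv_fourier g t) = inv_fourier g t" unfolding inv_fourier_ft by simp
  then show ?thesis by (metis Reals_cnj_iff of_real_Re)
qed

text \<open>From \<open>exp y \<ge> 1 + y + y^2 / 2\<close> with
  \<open>y = b * \<bar>t\<bar>\<close>; it reduces integrability of the exponential to that of
  \<open>inverse (1 + t^2)\<close>.\<close>

lemma exp_abs_le: 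
  fixes t b :: real assumes "b > 0"
  shows "exp (- b * \<bar>t\<bar>) \<le> (1 + 2 / b\<^sup>2) * inverse (1 + t\<^sup>2)"
proof -
  have "1 + K * Y \<le> (1 + K) * (1 + y + Y)" if "K \<ge> 0" "Y \<ge> 0" "y \<ge> 0" for K Y y :: real
    using that by (simp add: algebra_simps add_nonneg_nonneg)
  from this[of "2 / b\<^sup>2" "(b * \<bar>t\<bar>)\<^sup>2 / 2" "b * \<bar>t\<bar>"]
  have "(1 + t\<^sup>2) \<le> (1 + 2 / b\<^sup>2) * (1 + b * \<bar>t\<bar> + (b * \<bar>t\<bar>)\<^sup>2 / 2)"
    using assms by (simp add: power_mult_distrib)
  also have "\<dots> \<le> (1 + 2 / b\<^sup>2) * exp (b * \<bar>t\<bar>)"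
    using assms exp_lower_Taylor_quadratic[of "b * \<bar>t\<bar>"] by (intro mult_left_mono) auto
  finally have "exp (- b * \<bar>t\<bar>) * (1 + t\<^sup>2) \<le> 1 + 2 / b\<^sup>2" 
    by (simp add: exp_minus field_simps)
  moreover have "1 + t\<^sup>2 > 0" by (simp add: add_pos_nonneg)
  ultimately show ?thesis by (simp add: divide_inverse[symmetric] pos_le_divide_eq)
qed

lemma integrable_exp_norm:
  assumes c: "c > 0" shows "integrable lborel (\<lambda>x::real^'n::finite. exp (- c * norm x))"
proof -
  \<comment> \<open>Each \<open>\<bar>x $ i\<bar>\<close> is at most \<open>norm x\<close>, so with
    this \<open>b\<close> the product of the one-dimensional exponentials dominates
    \<open>exp (- c * norm x)\<close>.\<close>
  define b where "b = c / CARD('n)"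
  have b: "b > 0" using c by (simp add: b_def)
  have "integrable lborel (\<lambda>x::real. (1 + 2 / b\<^sup>2) * inverse (1 + x\<^sup>2))"
    using integrable_inverse_1_plus_square by (intro integrable_mult_right) (simp add: set_integrable_def)
  from integral_lborel_prod(1)[where 'a="real^'n" and f="\<lambda>_. \<lambda>x::real. (1 + 2 / b\<^sup>2) * inverse (1 + x\<^sup>2)", OF this]
  have i: "integrable lborel (\<lambda>x::real^'n. \<Prod>i\<in>UNIV. (1 + 2 / b\<^sup>2) * inverse (1 + (x $ i)\<^sup>2))"
    by (subst (asm) prod_Basis_vec) simp
  show ?thesis
  proof (rule Bochner_Integration.integrable_bound[OF i])
    have le: "exp (- c * norm x) \<le> (\<Prod>i\<in>UNIV. (1 + 2 / b\<^sup>2) * inverse (1 + (x $ i)\<^sup>2))" for x :: "real^'n"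
    proof -
      have "(\<Sum>i\<in>UNIV. \<bar>x $ i\<bar>) \<le> of_nat (card (UNIV::'n set)) * norm x"
        by (rule sum_bounded_above) (rule component_le_norm_cart)
      then have "b * (\<Sum>i\<in>UNIV. \<bar>x $ i\<bar>) \<le> c * norm x"
        using mult_left_mono[of "\<Sum>i\<in>UNIV. \<bar>x $ i\<bar>" "CARD('n) * norm x" b] b by (simp add: b_def)
      then have "exp (- c * norm x) \<le> exp (\<Sum>i\<in>UNIV. - b * \<bar>x $ i\<bar>)" by (simp add: sum_negf sum_distrib_left)
      also have "\<dots> = (\<Prod>i\<in>UNIV. exp (- b * \<bar>x $ i\<bar>))" by (rule exp_sum) simp
      also have "\<dots> \<le> (\<Prod>i\<in>UNIV. (1 + 2 / b\<^sup>2) * inverse (1 + (x $ i)\<^sup>2))"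
        by (intro prod_mono conjI exp_abs_le b) auto
      finally show ?thesis .
    qed
    show "AE x::real^'n in lborel. norm (exp (- c * norm x)) \<le> norm (\<Prod>i\<in>UNIV. (1 + 2 / b\<^sup>2) * inverse (1 + (x $ i)\<^sup>2))"
      unfolding real_norm_def abs_exp_cancel by (intro AE_I2 order_trans[OF le abs_ge_self])
  qed measurable
qed

lemma ftr_L2:
  assumes \<psi>: "test_function \<psi>"
  shows "(\<integral>\<^sup>+\<xi>. ennreal ((cmod (ftr \<psi> (- \<xi> :: real^'n::finite)))\<^sup>2) \<partial>lborel) < \<infinity>"
proof -
  have [measurable]: "\<psi> \<in> borel_measurable borel" using test_function_measurable[OF \<psi>] .
  define B where "B = (\<integral>x. cmod (complex_of_real (\<psi> x)) \<partial>lborel)"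
  have B: "cmod (ftr \<psi> \<xi>) \<le> B" for \<xi> unfolding B_def by (rule ft_bound[OF test_function_cintegrable[OF \<psi>]])
  have "integrable lborel (\<lambda>\<xi>. ftr \<psi> (- \<xi>))"
    using integrable_lborel_affine[OF integrable_ftr[OF \<psi>], of "-1" 0] by simp
  then have i: "integrable lborel (\<lambda>\<xi>. B * cmod (ftr \<psi> (- \<xi>)))" by (intro integrable_mult_right integrable_norm)
  have "(\<integral>\<^sup>+\<xi>. ennreal ((cmod (ftr \<psi> (- \<xi>)))\<^sup>2) \<partial>lborel) \<le> (\<integral>\<^sup>+\<xi>. ennreal (norm (B * cmod (ftr \<psi> (- \<xi>)))) \<partial>lborel)"
  proof (intro nn_integral_mono ennreal_leI)
    fix \<xi>
    show "(cmod (ftr \<psi> (- \<xi>)))\<^sup>2 \<le> norm (B * cmod (ftr \<psi> (- \<xi>)))"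
      using mult_right_mono[OF B[of "- \<xi>"] norm_ge_zero[of "ftr \<psi> (- \<xi>)"]]
      by (simp add: power2_eq_square abs_mult) (meson abs_ge_self mult_right_mono norm_ge_zero order_trans)
  qed
  also have "\<dots> < \<infinity>" using i by (simp only: integrable_iff_bounded)
  finally show ?thesis .
qed

section \<open>Damped symbols and the construction of the kernel\<close>

context tube_symbol
begin

abbreviation reg :: "real \<Rightarrow> real^'n \<Rightarrow> complex" where
  "reg \<rho> \<equiv> \<lambda>\<xi>. h 0 \<xi> * damp \<rho> 0 \<xi>"

lemma integrable_reg: "\<rho> > 0 \<Longrightarrow> integrable lborel (reg \<rho>)"
  using integrable_h_damp[of 0 \<rho>] eps by simp

lemma cmod_reg_le: "\<rho> \<ge> 0 \<Longrightarrow> cmod (reg \<rho> \<xi>) \<le> cmod (h 0 \<xi>)"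
  using mult_left_mono[OF cmod_damp_le_1, of \<rho> "cmod (h 0 \<xi>)" \<xi>] by (simp add: norm_mult)

lemma reg_tendsto: "\<rho> \<longlonglongrightarrow> 0 \<Longrightarrow> (\<lambda>k. reg (\<rho> k) \<xi>) \<longlonglongrightarrow> h 0 \<xi>"
  using tendsto_mult[OF tendsto_const damp_tendsto, of \<rho> "h 0 \<xi>" \<xi>] by simp

lemma L2_dist_reg:
  assumes \<rho>: "\<rho> \<longlonglongrightarrow> 0" "\<And>k. \<rho> k > 0"
  shows "(\<lambda>k. L2_dist (reg (\<rho> k)) (h 0)) \<longlonglongrightarrow> 0"
proof -
  have "(\<lambda>k. \<integral>\<^sup>+x. ennreal ((cmod (reg (\<rho> k) x - h 0 x))\<^sup>2) \<partial>lborel) \<longlonglongrightarrow> (\<integral>\<^sup>+(x::real^'n). 0 \<partial>lborel)"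
  proof (rule nn_integral_dominated_convergence[where w="\<lambda>x. 4 * ennreal ((cmod (h 0 x))\<^sup>2)"])
    show "(\<integral>\<^sup>+x. 4 * ennreal ((cmod (h 0 x))\<^sup>2) \<partial>lborel) < \<infinity>"
      using h_fin[of 0] eps by (subst nn_integral_cmult) (auto simp: ennreal_mult_less_top)
    fix k
    have "ennreal ((cmod (reg (\<rho> k) x - h 0 x))\<^sup>2) \<le> 4 * ennreal ((cmod (h 0 x))\<^sup>2)" for x
    proof -
      have "cmod (reg (\<rho> k) x - h 0 x) \<le> cmod (reg (\<rho> k) x) + cmod (h 0 x)" by (rule norm_triangle_ineq4)
      also have "\<dots> \<le> 2 * cmod (h 0 x)" using cmod_reg_le[of "\<rho> k" x] \<rho>(2)[of k] by simp
      finally have "(cmod (reg (\<rho> k) x - h 0 x))\<^sup>2 \<le> (2 * cmod (h 0 x))\<^sup>2" by (intro power_mono) auto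
      then have "ennreal ((cmod (reg (\<rho> k) x - h 0 x))\<^sup>2) \<le> ennreal (4 * (cmod (h 0 x))\<^sup>2)"
        by (intro ennreal_leI) (simp add: power_mult_distrib)
      then show ?thesis by (simp add: ennreal_mult)
    qed
    then show "AE x in lborel. ennreal ((cmod (reg (\<rho> k) x - h 0 x))\<^sup>2) \<le> 4 * ennreal ((cmod (h 0 x))\<^sup>2)" by simp
  next
    have "(\<lambda>k. (cmod (reg (\<rho> k) x - h 0 x))\<^sup>2) \<longlonglongrightarrow> (cmod (h 0 x - h 0 x))\<^sup>2" for x
      by (intro tendsto_intros reg_tendsto \<rho>)
    then have "(\<lambda>k. ennreal ((cmod (reg (\<rho> k) x - h 0 x))\<^sup>2)) \<longlonglongrightarrow> 0" for x
      using tendsto_ennrealI[of "\<lambda>k. (cmod (reg (\<rho> k) x - h 0 x))\<^sup>2" 0] by simp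
    then show "AE x in lborel. (\<lambda>k. ennreal ((cmod (reg (\<rho> k) x - h 0 x))\<^sup>2)) \<longlonglongrightarrow> 0" by simp
  qed measurable
  then show ?thesis unfolding L2_dist_def by simp
qed

lemma inv_fourier_reg_real: "inv_fourier (reg \<rho>) t = of_real (Re (inv_fourier (reg \<rho>) t))"
proof (rule inv_fourier_real)
  show "reg \<rho> (- x) = cnj (reg \<rho> x)" for x by (simp add: symbol_ratio_minus damp_0)
qed measurable

text \<open>Plancherel's inequality makes the transforms of the damped symbols Cauchy in L2, and
  along a fast subsequence \<open>L2_fast_Cauchy_limit\<close> gives a pointwise limit. The majorant
  \<open>w\<close> is exported together with the kernel, because the Parseval identity takes it as
  dominating function.\<close>

lemma fundamental_kernel_exists:
  obtains G :: "real^'n \<Rightarrow> real" and w :: "real^'n \<Rightarrow> real" and \<rho> :: "nat \<Rightarrow> real"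
  where "\<And>k. 0 < \<rho> k" "\<And>k. \<rho> k \<le> 1" "\<rho> \<longlonglongrightarrow> 0"
    "G \<in> borel_measurable borel" "w \<in> borel_measurable borel" "\<And>x. w x \<ge> 0"
    "(\<integral>\<^sup>+x. ennreal ((w x)\<^sup>2) \<partial>lborel) < \<infinity>"
    "AE x in lborel. (\<lambda>k. inv_fourier (reg (\<rho> k)) x) \<longlonglongrightarrow> of_real (G x)"
    "AE x in lborel. \<forall>k. cmod (inv_fourier (reg (\<rho> k)) x - of_real (G x)) \<le> (1/2) ^ k * w x"
proof -
  define r where "r m = 1 / real (Suc m)" for m
  have r: "r \<longlonglongrightarrow> 0" unfolding r_def by (rule LIMSEQ_Suc[OF lim_1_over_n])
  have r0: "r m > 0" "r m \<le> 1" for m by (auto simp: r_def)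
  \<comment> \<open>\<open>m \<ge> k\<close> is demanded so that the chosen parameters still tend to
    0.\<close>
  have "\<exists>m\<ge>k. L2_dist (reg (r m)) (h 0) < ennreal ((1/8) ^ k)" for k
  proof -
    have "eventually (\<lambda>m. L2_dist (reg (r m)) (h 0) < ennreal ((1/8) ^ k)) sequentially"
      by (rule order_tendstoD(2)[OF L2_dist_reg[OF r r0(1)]]) simp
    with eventually_ge_at_top[of k] have "eventually (\<lambda>m. m \<ge> k \<and> L2_dist (reg (r m)) (h 0) < ennreal ((1/8) ^ k)) sequentially"
      by eventually_elim simp
    then show ?thesis by (auto simp: eventually_sequentially)
  qed
  then obtain m where m: "\<And>k. m k \<ge> k" "\<And>k. L2_dist (reg (r (m k))) (h 0) < ennreal ((1/8) ^ k)" by metis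
  define \<rho> where "\<rho> k = r (m k)" for k
  have \<rho>: "\<rho> k > 0" "\<rho> k \<le> 1" for k by (auto simp: \<rho>_def r0)
  have \<rho>lim: "\<rho> \<longlonglongrightarrow> 0"
  proof (rule tendsto_sandwich[OF _ _ tendsto_const r])
    show "eventually (\<lambda>k. \<rho> k \<le> r k) sequentially"
      using m(1) by (auto simp: \<rho>_def r_def intro!: always_eventually divide_left_mono)
    show "eventually (\<lambda>k. 0 \<le> \<rho> k) sequentially" by (intro always_eventually allI less_imp_le \<rho>(1))
  qed
  define f where "f k = inv_fourier (reg (\<rho> k))" for k
  have [measurable]: "f k \<in> borel_measurable borel" for k unfolding f_def by measurable
  \<comment> \<open>\<open>h 0\<close> is inserted between the two symbols; the bound
    \<open>2 * a^2 + 2 * b^2\<close>, with both square integrals at most \<open>(1/8) ^ k\<close>,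
    gives the 4.\<close>
  have "(\<integral>\<^sup>+x. ennreal ((cmod (f (Suc k) x - f k x))\<^sup>2) \<partial>lborel) \<le> ennreal (4 * (1/8) ^ k)" for k
  proof -
    have "(\<integral>\<^sup>+x. ennreal ((cmod (f (Suc k) x - f k x))\<^sup>2) \<partial>lborel)
      = (\<integral>\<^sup>+x. ennreal ((cmod (inv_fourier (\<lambda>\<xi>. reg (\<rho> (Suc k)) \<xi> - reg (\<rho> k) \<xi>) x))\<^sup>2) \<partial>lborel)"
      unfolding f_def by (subst inv_fourier_diff[OF integrable_reg[OF \<rho>(1)] integrable_reg[OF \<rho>(1)]]) simp
    also have "\<dots> \<le> (\<integral>\<^sup>+\<xi>. ennreal ((cmod (reg (\<rho> (Suc k)) \<xi> - reg (\<rho> k) \<xi>))\<^sup>2) \<partial>lborel)"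
      by (intro plancherel_inv_fourier Bochner_Integration.integrable_diff integrable_reg \<rho>)
    also have "\<dots> = (\<integral>\<^sup>+\<xi>. ennreal ((cmod ((reg (\<rho> (Suc k)) \<xi> - h 0 \<xi>) + (h 0 \<xi> - reg (\<rho> k) \<xi>)))\<^sup>2) \<partial>lborel)"
      by simp
    also have "\<dots> \<le> 2 * L2_dist (reg (\<rho> (Suc k))) (h 0) + 2 * (\<integral>\<^sup>+\<xi>. ennreal ((cmod (h 0 \<xi> - reg (\<rho> k) \<xi>))\<^sup>2) \<partial>lborel)"
      unfolding L2_dist_def by (rule nn_integral_square_sum_le) measurable
    also have "(\<integral>\<^sup>+\<xi>. ennreal ((cmod (h 0 \<xi> - reg (\<rho> k) \<xi>))\<^sup>2) \<partial>lborel) = L2_dist (reg (\<rho> k)) (h 0)"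
      unfolding L2_dist_def by (simp add: norm_minus_commute)
    also have "2 * L2_dist (reg (\<rho> (Suc k))) (h 0) + 2 * L2_dist (reg (\<rho> k)) (h 0) \<le> 2 * ennreal ((1/8) ^ k) + 2 * ennreal ((1/8) ^ k)"
    proof (intro add_mono mult_left_mono)
      have "ennreal ((1/8) ^ Suc k) \<le> ennreal ((1/8) ^ k)" by (intro ennreal_leI power_decreasing) auto
      then show "L2_dist (reg (\<rho> (Suc k))) (h 0) \<le> ennreal ((1/8) ^ k)"
        using m(2)[of "Suc k"] unfolding \<rho>_def by (meson less_imp_le order_trans)
      show "L2_dist (reg (\<rho> k)) (h 0) \<le> ennreal ((1/8) ^ k)"
        using m(2)[of k] unfolding \<rho>_def by (rule less_imp_le)
    qed auto
    also have "\<dots> = ennreal (4 * (1/8) ^ k)"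
      by (simp add: ennreal_mult flip: distrib_right)
    finally show ?thesis .
  qed
  then obtain g w where g: "g \<in> borel_measurable lborel" "w \<in> borel_measurable lborel" "\<And>x. w x \<ge> (0::real)"
    "(\<integral>\<^sup>+x. ennreal ((w x)\<^sup>2) \<partial>lborel) < \<infinity>"
    "AE x in lborel. (\<lambda>k. f k x) \<longlonglongrightarrow> g x" "AE x in lborel. \<forall>k. cmod (f k x - g x) \<le> (1/2) ^ k * w x"
    by (rule L2_fast_Cauchy_limit[of f lborel 4, rotated]) auto
  have [measurable]: "g \<in> borel_measurable borel" "w \<in> borel_measurable borel" using g by auto
  have fr: "f k x = of_real (Re (f k x))" for k x unfolding f_def by (rule inv_fourier_reg_real)
  \<comment> \<open>The approximations are real, so passing to the real part of the limit can only
    shrink the error.\<close>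
  have le: "cmod (f k x - of_real (Re (g x))) \<le> cmod (f k x - g x)" for k x
  proof -
    have eq: "f k x - of_real (Re (g x)) = of_real (Re (f k x - g x))" by (subst fr) simp
    show ?thesis unfolding eq norm_of_real by (rule abs_Re_le_cmod)
  qed
  show ?thesis
  proof (rule that[of \<rho> "\<lambda>x. Re (g x)" w])
    show "AE x in lborel. (\<lambda>k. inv_fourier (reg (\<rho> k)) x) \<longlonglongrightarrow> of_real (Re (g x))"
      using g(5)
    proof eventually_elim
      case (elim x)
      then have "(\<lambda>k. complex_of_real (Re (f k x))) \<longlonglongrightarrow> complex_of_real (Re (g x))" by (intro tendsto_of_real tendsto_Re)
      then show ?case unfolding fr[symmetric] unfolding f_def .
    qed
    show "AE x in lborel. \<forall>k. cmod (inv_fourier (reg (\<rho> k)) x - of_real (Re (g x))) \<le> (1/2) ^ k * w x"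
      using g(6) by eventually_elim (use le in \<open>auto simp: f_def intro: order_trans\<close>)
  qed (use \<rho> \<rho>lim g in auto)
qed

end

section \<open>Weighted bounds on the kernel and the equation it solves\<close>

locale tube_kernel = tube_symbol p q \<epsilon> C for p q :: "('n::finite \<Rightarrow> nat) \<Rightarrow> real" and \<epsilon> C +
  fixes G w :: "real^'n \<Rightarrow> real" and \<rho> :: "nat \<Rightarrow> real"
  assumes \<rho>: "\<And>k. 0 < \<rho> k" "\<And>k. \<rho> k \<le> 1" "\<rho> \<longlonglongrightarrow> 0"
    and G_measurable [measurable]: "G \<in> borel_measurable borel"
    and w_measurable [measurable]: "w \<in> borel_measurable borel" and w_nonneg: "\<And>x. w x \<ge> 0"
    and w_fin: "(\<integral>\<^sup>+x. ennreal ((w x)\<^sup>2) \<partial>lborel) < \<infinity>"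
    and G_lim: "AE x in lborel. (\<lambda>k. inv_fourier (reg (\<rho> k)) x) \<longlonglongrightarrow> of_real (G x)"
    and G_dom: "AE x in lborel. \<forall>k. cmod (inv_fourier (reg (\<rho> k)) x - of_real (G x)) \<le> (1/2) ^ k * w x"
begin

text \<open>The damped symbols serve as the approximating sequence; squaring \<open>G_dom\<close>
  gives the rate \<open>(1/4) ^ k\<close>.\<close>

lemma inv_fourier_L2_G: "inv_fourier_L2 (h 0) (\<lambda>x. complex_of_real (G x))"
  unfolding inv_fourier_L2_def
proof (intro conjI exI[of _ "\<lambda>k. reg (\<rho> k)"] allI)
  fix k
  show "integrable lborel (reg (\<rho> k))" by (rule integrable_reg[OF \<rho>(1)])
  have "(\<integral>\<^sup>+x. ennreal ((cmod (reg (\<rho> k) x))\<^sup>2) \<partial>lborel) \<le> (\<integral>\<^sup>+x. ennreal ((cmod (h 0 x))\<^sup>2) \<partial>lborel)"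
    using cmod_reg_le[of "\<rho> k"] \<rho>(1)[of k] by (intro nn_integral_mono ennreal_leI power_mono) auto
  also have "\<dots> < \<infinity>" using h_fin[of 0] eps by simp
  finally show "(\<integral>\<^sup>+x. ennreal ((cmod (reg (\<rho> k) x))\<^sup>2) \<partial>lborel) < \<infinity>" .
next
  show "(\<lambda>k. L2_dist (reg (\<rho> k)) (h 0)) \<longlonglongrightarrow> 0" by (rule L2_dist_reg[OF \<rho>(3,1)])
  have le: "L2_dist (inv_fourier (reg (\<rho> k))) (\<lambda>x. complex_of_real (G x)) \<le> ennreal ((1/4) ^ k) * (\<integral>\<^sup>+x. ennreal ((w x)\<^sup>2) \<partial>lborel)" for k
  proof -
    have "L2_dist (inv_fourier (reg (\<rho> k))) (\<lambda>x. complex_of_real (G x)) \<le> (\<integral>\<^sup>+x. ennreal ((1/4) ^ k) * ennreal ((w x)\<^sup>2) \<partial>lborel)"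
      unfolding L2_dist_def
    proof (rule nn_integral_mono_AE)
      show "AE x in lborel. ennreal ((cmod (inv_fourier (reg (\<rho> k)) x - of_real (G x)))\<^sup>2) \<le> ennreal ((1/4) ^ k) * ennreal ((w x)\<^sup>2)"
        using G_dom
      proof eventually_elim
        case (elim x)
        then have "(cmod (inv_fourier (reg (\<rho> k)) x - of_real (G x)))\<^sup>2 \<le> ((1/2) ^ k * w x)\<^sup>2"
          by (intro power_mono) auto
        also have "\<dots> = (1/4) ^ k * (w x)\<^sup>2"
        proof -
          have "((1/2) ^ k)\<^sup>2 = ((1/2::real)\<^sup>2) ^ k" by (metis power_mult mult.commute)
          then show ?thesis by (simp add: power_mult_distrib power_divide)
        qed
        finally show ?case by (subst ennreal_mult[symmetric]) (auto intro: ennreal_leI)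
      qed
    qed
    then show ?thesis by (simp add: nn_integral_cmult)
  qed
  have "(\<lambda>k. ennreal ((1/4) ^ k)) \<longlonglongrightarrow> ennreal 0"
    by (intro tendsto_ennrealI LIMSEQ_realpow_zero) auto
  then have "(\<lambda>k. (\<integral>\<^sup>+x. ennreal ((w x)\<^sup>2) \<partial>lborel) * ennreal ((1/4) ^ k)) \<longlonglongrightarrow> (\<integral>\<^sup>+x. ennreal ((w x)\<^sup>2) \<partial>lborel) * ennreal 0"
    using w_fin by (intro ennreal_tendsto_cmult) auto
  then have "(\<lambda>k. ennreal ((1/4) ^ k) * (\<integral>\<^sup>+x. ennreal ((w x)\<^sup>2) \<partial>lborel)) \<longlonglongrightarrow> 0"
    by (simp add: mult.commute)
  then show "(\<lambda>k. L2_dist (inv_fourier (reg (\<rho> k))) (\<lambda>x. complex_of_real (G x))) \<longlonglongrightarrow> 0"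
    by (rule tendsto_sandwich[OF always_eventually always_eventually tendsto_const, rotated 2]) (use le in auto)
qed measurable

text \<open>By \<open>ft_shift\<close> the weight turns the transform of the damped symbol into that
  of the shifted one, to which Plancherel's inequality and \<open>bound\<close> apply. The damping
  costs at most \<open>exp (2 * \<epsilon>^2)\<close> because \<open>\<rho> m \<le> 1\<close>, and
  Fatou's lemma removes the regularisation.\<close>

lemma G_weighted:
  assumes s: "\<bar>s\<bar> < \<epsilon>"
  shows "(\<integral>\<^sup>+x. ennreal ((exp (- s * x $ k) * G x)\<^sup>2) \<partial>lborel) \<le> ennreal (exp (2 * \<epsilon>\<^sup>2)) * ennreal C"
proof (rule nn_integral_le_of_tendsto)
  let ?\<eta> = "s *\<^sub>R axis k (1::real) :: real^'n"
  have \<eta>: "norm ?\<eta> = \<bar>s\<bar>" by (simp add: norm_axis_1)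
  show "(\<lambda>x. ennreal ((cmod (of_real (exp (- s * x $ k)) * inv_fourier (reg (\<rho> m)) x))\<^sup>2)) \<in> borel_measurable lborel" for m
    by measurable
  show "AE x in lborel. (\<lambda>m. ennreal ((cmod (of_real (exp (- s * x $ k)) * inv_fourier (reg (\<rho> m)) x))\<^sup>2)) \<longlonglongrightarrow> ennreal ((exp (- s * x $ k) * G x)\<^sup>2)"
    using G_lim
  proof eventually_elim
    case (elim x)
    then have "(\<lambda>m. (cmod (of_real (exp (- s * x $ k)) * inv_fourier (reg (\<rho> m)) x))\<^sup>2) \<longlonglongrightarrow> (cmod (of_real (exp (- s * x $ k)) * of_real (G x)))\<^sup>2"
      by (intro tendsto_intros)
    then show ?case by (intro tendsto_ennrealI) (simp add: norm_mult power_mult_distrib)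
  qed
  fix m
  define H where "H \<xi> = h ?\<eta> \<xi> * damp (\<rho> m) ?\<eta> \<xi>" for \<xi>
  have H: "integrable lborel H" unfolding H_def using s by (intro integrable_h_damp \<rho>) (simp add: norm_axis_1)
  have eq: "of_real (exp (- s * x $ k)) * inv_fourier (reg (\<rho> m)) x = inv_fourier H x" for x
    unfolding inv_fourier_ft ft_shift[OF s \<rho>(1), of m x k] H_def
    by (simp add: exp_minus exp_of_real[symmetric])
  have "(\<integral>\<^sup>+x. ennreal ((cmod (inv_fourier H x))\<^sup>2) \<partial>lborel) \<le> (\<integral>\<^sup>+x. ennreal ((cmod (H x))\<^sup>2) \<partial>lborel)"
    by (rule plancherel_inv_fourier[OF H])
  also have "\<dots> \<le> (\<integral>\<^sup>+x. ennreal (exp (2 * \<epsilon>\<^sup>2)) * ennreal ((cmod (h ?\<eta> x))\<^sup>2) \<partial>lborel)"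
  proof (rule nn_integral_mono)
    fix x :: "real^'n"
    have "\<rho> m * ((norm ?\<eta>)\<^sup>2 - (norm x)\<^sup>2) \<le> \<epsilon>\<^sup>2"
    proof -
      have "\<rho> m * ((norm ?\<eta>)\<^sup>2 - (norm x)\<^sup>2) \<le> \<rho> m * s\<^sup>2"
        using \<rho>(1)[of m] unfolding \<eta> by (intro mult_left_mono) auto
      also have "\<dots> \<le> 1 * s\<^sup>2" by (intro mult_right_mono \<rho>) auto
      also have "s\<^sup>2 \<le> \<epsilon>\<^sup>2" using s eps by (simp flip: abs_le_square_iff)
      finally show ?thesis by simp
    qed
    then have "(cmod (damp (\<rho> m) ?\<eta> x))\<^sup>2 \<le> exp (2 * \<epsilon>\<^sup>2)"
      unfolding cmod_damp exp_double[symmetric] by simp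
    then have "(cmod (H x))\<^sup>2 \<le> exp (2 * \<epsilon>\<^sup>2) * (cmod (h ?\<eta> x))\<^sup>2"
      unfolding H_def norm_mult power_mult_distrib by (subst mult.commute) (intro mult_right_mono, auto)
    then show "ennreal ((cmod (H x))\<^sup>2) \<le> ennreal (exp (2 * \<epsilon>\<^sup>2)) * ennreal ((cmod (h ?\<eta> x))\<^sup>2)"
      by (subst ennreal_mult[symmetric]) (auto intro: ennreal_leI)
  qed
  also have "\<dots> = ennreal (exp (2 * \<epsilon>\<^sup>2)) * (\<integral>\<^sup>+x. ennreal ((cmod (h ?\<eta> x))\<^sup>2) \<partial>lborel)"
    by (rule nn_integral_cmult) measurable
  also have "\<dots> \<le> ennreal (exp (2 * \<epsilon>\<^sup>2)) * ennreal C"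
    using s \<eta> by (intro mult_left_mono bound) auto
  finally show "(\<integral>\<^sup>+x. ennreal ((cmod (of_real (exp (- s * x $ k)) * inv_fourier (reg (\<rho> m)) x))\<^sup>2) \<partial>lborel) \<le> ennreal (exp (2 * \<epsilon>\<^sup>2)) * ennreal C"
    unfolding eq .
qed

text \<open>Half of \<epsilon> is the shift taken along each axis. The division by the dimension
  pays for passing from \<open>norm x\<close> to its largest coordinate in modulus, which is at
  least \<open>norm x / CARD('n)\<close>.\<close>

definition rate :: real where "rate = \<epsilon> / 2 / CARD('n)"

lemma rate_pos: "rate > 0" using eps by (simp add: rate_def)

text \<open>The square of the exponential of the norm lies below the sum over \<open>k\<close> of
  the squares of \<open>exp (s * x $ k)\<close> and \<open>exp (- s * x $ k)\<close>, and
  \<open>G_weighted\<close> covers each of these weights.\<close>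

lemma G_exp_L2: "(\<integral>\<^sup>+x. ennreal ((exp (rate * norm x) * G x)\<^sup>2) \<partial>lborel) < \<infinity>"
proof -
  define s where "s = \<epsilon> / 2"
  have s: "s > 0" "\<bar>s\<bar> < \<epsilon>" "\<bar>- s\<bar> < \<epsilon>" using eps by (auto simp: s_def)
  have le: "(exp (rate * norm x) * G x)\<^sup>2 \<le> (\<Sum>k\<in>UNIV. (exp (- s * x $ k) * G x)\<^sup>2 + (exp (- (- s) * x $ k) * G x)\<^sup>2)" for x :: "real^'n"
  proof -
    have "\<exists>k. norm x \<le> CARD('n) * \<bar>x $ k\<bar>"
    proof (rule ccontr)
      assume "\<not> ?thesis"
      then have "\<bar>x $ k\<bar> < norm x / CARD('n)" for k by (auto simp: not_le field_simps)
      then have "(\<Sum>k\<in>UNIV. \<bar>x $ k\<bar>) < of_nat (card (UNIV :: 'n set)) * (norm x / CARD('n))"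
        by (intro sum_bounded_above_strict) auto
      then show False using norm_le_l1_cart[of x] by simp
    qed
    then obtain k where k: "norm x \<le> CARD('n) * \<bar>x $ k\<bar>" by blast
    have "rate * norm x \<le> s * \<bar>x $ k\<bar>"
      using mult_left_mono[OF k, of rate] rate_pos by (simp add: rate_def s_def)
    then have "exp (rate * norm x) \<le> exp (s * \<bar>x $ k\<bar>)" by simp
    then have "(exp (rate * norm x))\<^sup>2 \<le> (exp (s * \<bar>x $ k\<bar>))\<^sup>2" by (intro power_mono) auto
    also have "\<dots> \<le> (exp (- s * x $ k))\<^sup>2 + (exp (- (- s) * x $ k))\<^sup>2"
      by (cases "x $ k \<ge> 0") auto
    finally have "(exp (rate * norm x) * G x)\<^sup>2 \<le> (exp (- s * x $ k) * G x)\<^sup>2 + (exp (- (- s) * x $ k) * G x)\<^sup>2"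
      unfolding power_mult_distrib distrib_right[symmetric] by (intro mult_right_mono) auto
    also have "\<dots> \<le> (\<Sum>k\<in>UNIV. (exp (- s * x $ k) * G x)\<^sup>2 + (exp (- (- s) * x $ k) * G x)\<^sup>2)"
      by (rule member_le_sum[of k UNIV "\<lambda>k. (exp (- s * x $ k) * G x)\<^sup>2 + (exp (- (- s) * x $ k) * G x)\<^sup>2"]) auto
    finally show ?thesis .
  qed
  have "(\<integral>\<^sup>+x. ennreal ((exp (rate * norm x) * G x)\<^sup>2) \<partial>lborel)
     \<le> (\<integral>\<^sup>+x. (\<Sum>k\<in>UNIV. ennreal ((exp (- s * x $ k) * G x)\<^sup>2) + ennreal ((exp (- (- s) * x $ k) * G x)\<^sup>2)) \<partial>lborel)"
  proof (rule nn_integral_mono)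
    fix x :: "real^'n"
    have "(\<Sum>k\<in>UNIV. ennreal ((exp (- s * x $ k) * G x)\<^sup>2) + ennreal ((exp (- (- s) * x $ k) * G x)\<^sup>2))
      = ennreal (\<Sum>k\<in>UNIV. (exp (- s * x $ k) * G x)\<^sup>2 + (exp (- (- s) * x $ k) * G x)\<^sup>2)"
      by (subst sum_ennreal[symmetric]) (auto intro!: sum.cong)
    then show "ennreal ((exp (rate * norm x) * G x)\<^sup>2) \<le> (\<Sum>k\<in>UNIV. ennreal ((exp (- s * x $ k) * G x)\<^sup>2) + ennreal ((exp (- (- s) * x $ k) * G x)\<^sup>2))"
      using le[of x] by (simp only: ennreal_leI)
  qed
  also have "\<dots> = (\<Sum>k\<in>UNIV. (\<integral>\<^sup>+x. ennreal ((exp (- s * x $ k) * G x)\<^sup>2) \<partial>lborel) + (\<integral>\<^sup>+x. ennreal ((exp (- (- s) * x $ k) * G x)\<^sup>2) \<partial>lborel))"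
    by (subst nn_integral_sum) (auto intro!: sum.cong nn_integral_add)
  also have "\<dots> \<le> (\<Sum>(k::'n)\<in>UNIV. ennreal (exp (2 * \<epsilon>\<^sup>2)) * ennreal C + ennreal (exp (2 * \<epsilon>\<^sup>2)) * ennreal C)"
    by (intro sum_mono add_mono G_weighted s)
  also have "\<dots> < \<infinity>"
    by (auto simp: ennreal_mult_less_top sum_constant of_nat_less_top)
  finally show ?thesis .
qed

lemma G_L2: "(\<integral>\<^sup>+x. ennreal ((G x)\<^sup>2) \<partial>lborel) < \<infinity>"
proof -
  have "(\<integral>\<^sup>+x. ennreal ((G x)\<^sup>2) \<partial>lborel) \<le> (\<integral>\<^sup>+x. ennreal ((exp (rate * norm x) * G x)\<^sup>2) \<partial>lborel)"
  proof (intro nn_integral_mono ennreal_leI)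
    fix x :: "real^'n"
    have "1 * (G x)\<^sup>2 \<le> (exp (rate * norm x))\<^sup>2 * (G x)\<^sup>2"
      using rate_pos by (intro mult_right_mono one_le_power) auto
    then show "(G x)\<^sup>2 \<le> (exp (rate * norm x) * G x)\<^sup>2" by (simp add: power_mult_distrib)
  qed
  then show ?thesis using G_exp_L2 order_le_less_trans by blast
qed

lemma G_exp_L1: "(\<integral>\<^sup>+x. ennreal (exp (rate / 2 * norm x) * \<bar>G x\<bar>) \<partial>lborel) < \<infinity>"
proof -
  have "(\<integral>\<^sup>+x. ennreal (exp (rate / 2 * norm x) * \<bar>G x\<bar>) \<partial>lborel)
    \<le> (\<integral>\<^sup>+x. ennreal (exp (- rate * norm x)) + ennreal ((exp (rate * norm x) * G x)\<^sup>2) \<partial>lborel)"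
  proof (rule nn_integral_mono)
    fix x :: "real^'n"
    \<comment> \<open>The product \<open>?u * ?v\<close> is the wanted integrand: half of the rate
      is given up so that \<open>?u\<close> becomes square integrable.\<close>
    let ?u = "exp (- (rate / 2) * norm x)" and ?v = "exp (rate * norm x) * \<bar>G x\<bar>"
    have "2 * (?u * ?v) \<le> ?u\<^sup>2 + ?v\<^sup>2" using sum_squares_bound[of ?u ?v] by (simp add: mult.assoc)
    moreover have "0 \<le> ?u * ?v" by simp
    ultimately have "?u * ?v \<le> ?u\<^sup>2 + ?v\<^sup>2" by linarith
    also have "?u\<^sup>2 = exp (- rate * norm x)" by (simp flip: exp_double)
    also have "?v\<^sup>2 = (exp (rate * norm x) * G x)\<^sup>2" by (simp add: power_mult_distrib)
    also have "?u * ?v = exp (rate / 2 * norm x) * \<bar>G x\<bar>"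
      unfolding mult.assoc[symmetric] exp_add[symmetric] by simp
    finally have "exp (rate / 2 * norm x) * \<bar>G x\<bar> \<le> exp (- rate * norm x) + (exp (rate * norm x) * G x)\<^sup>2" .
    then show "ennreal (exp (rate / 2 * norm x) * \<bar>G x\<bar>) \<le> ennreal (exp (- rate * norm x)) + ennreal ((exp (rate * norm x) * G x)\<^sup>2)"
      by (subst ennreal_plus[symmetric]) (auto intro: ennreal_leI simp del: ennreal_plus)
  qed
  also have "\<dots> = (\<integral>\<^sup>+(x::real^'n). ennreal (exp (- rate * norm x)) \<partial>lborel) + (\<integral>\<^sup>+x. ennreal ((exp (rate * norm x) * G x)\<^sup>2) \<partial>lborel)"
    by (rule nn_integral_add) measurable
  also have "\<dots> < \<infinity>"
    using G_exp_L2 nn_integral_eq_integral[OF integrable_exp_norm[where 'n='n, OF rate_pos]] by simp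
  finally show ?thesis .
qed

lemma integrable_G: "integrable lborel G"
proof (rule integrableI_bounded)
  have "(\<integral>\<^sup>+x. ennreal (norm (G x)) \<partial>lborel) \<le> (\<integral>\<^sup>+x. ennreal (exp (rate / 2 * norm x) * \<bar>G x\<bar>) \<partial>lborel)"
  proof (intro nn_integral_mono ennreal_leI)
    fix x :: "real^'n"
    show "norm (G x) \<le> exp (rate / 2 * norm x) * \<bar>G x\<bar>"
      using mult_right_mono[of 1 "exp (rate / 2 * norm x)" "\<bar>G x\<bar>"] rate_pos by simp
  qed
  then show "(\<integral>\<^sup>+x. ennreal (norm (G x)) \<partial>lborel) < \<infinity>" using G_exp_L1 order_le_less_trans by blast
qed simp

lemma locally_integrable_G: "locally_integrable G"
  unfolding locally_integrable_def
proof (intro conjI allI impI)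
  fix K :: "(real^'n) set" assume "compact K"
  then have "K \<in> sets lborel" by (simp add: borel_compact)
  then show "set_integrable lborel K G"
    unfolding set_integrable_def by (intro integrable_mult_indicator integrable_G)
qed simp

lemma integrable_h_ftr:
  assumes \<psi>: "test_function \<psi>"
  shows "integrable lborel (\<lambda>\<xi>. h 0 \<xi> * ftr \<psi> (- \<xi>))"
proof -
  have [measurable]: "\<psi> \<in> borel_measurable borel" using test_function_measurable[OF \<psi>] .
  show ?thesis using h_fin[of 0] eps ftr_L2[OF \<psi>] by (intro integrable_product_AM_GM) auto
qed

text \<open>\<open>fourier_swap\<close> with the reflected translate \<open>u\<close> of \<psi>
  gives the identity for damped symbols. In the limit \<open>\<bar>G\<bar> + w\<close> dominates the
  kernels on one side, and the modulus of \<open>h 0\<close> dominates the symbols on the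
  other.\<close>

lemma convolution_parseval:
  assumes \<psi>: "test_function \<psi>"
  shows "complex_of_real ((2 * pi) ^ CARD('n) * convolution G \<psi> x)
    = (\<integral>\<xi>. iexp (\<xi> \<bullet> x) * (h 0 \<xi> * ftr \<psi> (- \<xi>)) \<partial>lborel)"
proof -
  have [measurable]: "\<psi> \<in> borel_measurable borel" using test_function_measurable[OF \<psi>] .
  define K where "K = (2 * pi) ^ CARD('n)"
  have K: "K \<noteq> 0" unfolding K_def by simp
  define u where "u z = complex_of_real (\<psi> (x - z))" for z
  have [measurable]: "u \<in> borel_measurable borel" unfolding u_def by measurable
  have u: "integrable lborel u"
    unfolding u_def using integrable_lborel_affine[OF test_function_cintegrable[OF \<psi>], of "-1" x] by simp
  have ftu: "ft u \<xi> = iexp (\<xi> \<bullet> x) * ftr \<psi> (- \<xi>)" for \<xi>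
  proof -
    have "ft u \<xi> = (\<integral>z. iexp ((x - z) \<bullet> \<xi>) * complex_of_real (\<psi> z) \<partial>lborel)"
      unfolding ft_def u_def by (subst integral_lborel_affine[of _ "-1" x]) auto
    also have "\<dots> = (\<integral>z. iexp (\<xi> \<bullet> x) * (iexp (z \<bullet> - \<xi>) * complex_of_real (\<psi> z)) \<partial>lborel)"
      by (intro Bochner_Integration.integral_cong refl)
        (simp add: inner_diff_left inner_commute[of x] right_diff_distrib exp_diff exp_minus divide_inverse)
    finally show ?thesis unfolding ft_def by simp
  qed
  have parseval: "of_real K * (\<integral>z. u z * inv_fourier (reg (\<rho> k)) z \<partial>lborel)
     = (\<integral>\<xi>. reg (\<rho> k) \<xi> * (iexp (\<xi> \<bullet> x) * ftr \<psi> (- \<xi>)) \<partial>lborel)" for k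
  proof -
    have "of_real K * (\<integral>z. u z * inv_fourier (reg (\<rho> k)) z \<partial>lborel)
      = (\<integral>z. of_real K * (u z * inv_fourier (reg (\<rho> k)) z) \<partial>lborel)" by (rule integral_mult_right_zero[symmetric])
    also have "\<dots> = (\<integral>z. u z * ft (reg (\<rho> k)) z \<partial>lborel)"
      unfolding inv_fourier_ft K_def[symmetric] using K by (simp add: mult_ac)
    also have "\<dots> = (\<integral>\<xi>. reg (\<rho> k) \<xi> * ft u \<xi> \<partial>lborel)"
      by (rule fourier_swap[OF integrable_reg[OF \<rho>(1)] u])
    finally show ?thesis unfolding ftu .
  qed
  have psi_fin: "(\<integral>\<^sup>+z. ennreal ((cmod (u z))\<^sup>2) \<partial>lborel) < \<infinity>"
  proof -
    obtain B where B: "B > 0" "\<And>x. \<bar>\<psi> x\<bar> \<le> B" using test_function_bounded[OF \<psi>] by blast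
    have "(\<integral>\<^sup>+z. ennreal ((cmod (u z))\<^sup>2) \<partial>lborel) \<le> (\<integral>\<^sup>+z. ennreal (norm (of_real B * u z)) \<partial>lborel)"
    proof (intro nn_integral_mono ennreal_leI)
      fix z
      show "(cmod (u z))\<^sup>2 \<le> norm (of_real B * u z)"
        using mult_right_mono[OF B(2)[of "x - z"], of "\<bar>\<psi> (x - z)\<bar>"] B(1) by (simp add: u_def power2_eq_square norm_mult abs_mult)
    qed
    also have "\<dots> < \<infinity>" using integrable_mult_right[OF u, of "of_real B"] by (simp only: integrable_iff_bounded)
    finally show ?thesis .
  qed
  have "(\<lambda>k. \<integral>z. u z * inv_fourier (reg (\<rho> k)) z \<partial>lborel) \<longlonglongrightarrow> (\<integral>z. u z * of_real (G z) \<partial>lborel)"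
  proof (rule integral_dominated_convergence[where w="\<lambda>z. norm (u z * of_real (G z)) + norm (u z * of_real (w z))"])
    show "integrable lborel (\<lambda>z. norm (u z * of_real (G z)) + norm (u z * of_real (w z)))"
      using psi_fin G_L2 w_fin
      by (intro Bochner_Integration.integrable_add integrable_norm integrable_product_AM_GM) auto
    show "AE z in lborel. (\<lambda>k. u z * inv_fourier (reg (\<rho> k)) z) \<longlonglongrightarrow> u z * of_real (G z)"
      using G_lim by eventually_elim (auto intro: tendsto_intros)
    fix k
    show "AE z in lborel. norm (u z * inv_fourier (reg (\<rho> k)) z) \<le> norm (u z * of_real (G z)) + norm (u z * of_real (w z))"
      using G_dom
    proof eventually_elim
      case (elim z)
      have "(1/2) ^ k * w z \<le> 1 * w z" by (intro mult_right_mono w_nonneg power_le_one) auto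
      then have "cmod (inv_fourier (reg (\<rho> k)) z - of_real (G z)) \<le> w z" using elim[rule_format, of k] by simp
      then have "cmod (inv_fourier (reg (\<rho> k)) z) \<le> \<bar>G z\<bar> + w z"
        using norm_triangle_sub[of "inv_fourier (reg (\<rho> k)) z" "of_real (G z)"] by simp
      from mult_left_mono[OF this norm_ge_zero[of "u z"]] show ?case
        using w_nonneg[of z] by (simp add: norm_mult distrib_left)
    qed
  qed measurable
  from tendsto_mult[OF tendsto_const[of "complex_of_real K"] this]
  have l1: "(\<lambda>k. \<integral>\<xi>. reg (\<rho> k) \<xi> * (iexp (\<xi> \<bullet> x) * ftr \<psi> (- \<xi>)) \<partial>lborel) \<longlonglongrightarrow> of_real K * (\<integral>z. u z * of_real (G z) \<partial>lborel)"
    unfolding parseval .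
  have l2: "(\<lambda>k. \<integral>\<xi>. reg (\<rho> k) \<xi> * (iexp (\<xi> \<bullet> x) * ftr \<psi> (- \<xi>)) \<partial>lborel) \<longlonglongrightarrow> (\<integral>\<xi>. h 0 \<xi> * (iexp (\<xi> \<bullet> x) * ftr \<psi> (- \<xi>)) \<partial>lborel)"
  proof (rule integral_dominated_convergence[where w="\<lambda>\<xi>. norm (h 0 \<xi> * ftr \<psi> (- \<xi>))"])
    show "integrable lborel (\<lambda>\<xi>. norm (h 0 \<xi> * ftr \<psi> (- \<xi>)))" by (intro integrable_norm integrable_h_ftr \<psi>)
    show "AE \<xi> in lborel. (\<lambda>k. reg (\<rho> k) \<xi> * (iexp (\<xi> \<bullet> x) * ftr \<psi> (- \<xi>))) \<longlonglongrightarrow> h 0 \<xi> * (iexp (\<xi> \<bullet> x) * ftr \<psi> (- \<xi>))"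
      by (intro AE_I2 tendsto_mult reg_tendsto \<rho> tendsto_const)
    fix k
    have "norm (reg (\<rho> k) \<xi> * (iexp (\<xi> \<bullet> x) * ftr \<psi> (- \<xi>))) \<le> norm (h 0 \<xi> * ftr \<psi> (- \<xi>))" for \<xi>
      using mult_right_mono[OF cmod_reg_le, of "\<rho> k" "norm (ftr \<psi> (- \<xi>))" \<xi>] \<rho>(1)[of k] by (simp add: norm_mult)
    then show "AE \<xi> in lborel. norm (reg (\<rho> k) \<xi> * (iexp (\<xi> \<bullet> x) * ftr \<psi> (- \<xi>))) \<le> norm (h 0 \<xi> * ftr \<psi> (- \<xi>))" by simp
  qed measurable
  have "complex_of_real (convolution G \<psi> x) = (\<integral>z. complex_of_real (G (x - z) * \<psi> z) \<partial>lborel)"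
    unfolding convolution_def by (rule integral_complex_of_real[symmetric])
  also have "\<dots> = (\<integral>z. u z * of_real (G z) \<partial>lborel)"
    unfolding u_def by (subst integral_lborel_affine[of _ "-1" x]) (auto simp: mult.commute)
  finally show ?thesis
    using LIMSEQ_unique[OF l1 l2] unfolding K_def by (simp add: mult_ac)
qed

lemma fundamental_solution_G:
  assumes q: "is_poly q"
  shows "fundamental_solution p q G"
  unfolding fundamental_solution_def
proof (intro allI impI ext)
  fix \<phi> :: "real^'n \<Rightarrow> real" and x
  assume \<phi>: "test_function \<phi>"
  note T = test_function_Dmulti[OF \<phi>]
  let ?K = "(2 * pi) ^ CARD('n)"
  let ?F = "\<lambda>\<xi>. ftr \<phi> (- \<xi>)"
  let ?P = "{\<alpha>. p \<alpha> \<noteq> 0}" and ?Q = "{\<alpha>. q \<alpha> \<noteq> 0}"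
  obtain \<alpha> where \<alpha>: "p \<alpha> \<noteq> 0" using p_nz by blast
  have symb: "(\<Sum>\<alpha>\<in>{\<alpha>. c \<alpha> \<noteq> 0}. of_real (c \<alpha>) * ftr (Dmulti \<alpha> \<phi>) (- \<xi>)) = poly_eval c (\<lambda>k. \<i> * of_real (\<xi> $ k)) * ?F \<xi>" for c \<xi>
    unfolding poly_eval_def ftr_Dmulti[OF \<phi>] by (simp add: sum_distrib_right mult.assoc)
  have "complex_of_real (?K * poly_diff_op p (convolution G \<phi>) x)
     = (\<Sum>\<alpha>\<in>?P. of_real (p \<alpha>) * complex_of_real (?K * convolution G (Dmulti \<alpha> \<phi>) x))"
    unfolding poly_diff_op_def convolution_Dmulti[OF locally_integrable_G \<phi>]
    by (simp add: sum_distrib_left mult_ac)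
  also have "\<dots> = (\<Sum>\<alpha>\<in>?P. \<integral>\<xi>. of_real (p \<alpha>) * (iexp (\<xi> \<bullet> x) * (h 0 \<xi> * ftr (Dmulti \<alpha> \<phi>) (- \<xi>))) \<partial>lborel)"
    unfolding convolution_parseval[OF T] by simp
  also have "\<dots> = (\<integral>\<xi>. (\<Sum>\<alpha>\<in>?P. of_real (p \<alpha>) * (iexp (\<xi> \<bullet> x) * (h 0 \<xi> * ftr (Dmulti \<alpha> \<phi>) (- \<xi>)))) \<partial>lborel)"
    by (intro Bochner_Integration.integral_sum[symmetric] integrable_mult_right ft_integrable integrable_h_ftr T)
  also have "\<dots> = (\<integral>\<xi>. iexp (\<xi> \<bullet> x) * (h 0 \<xi> * (poly_eval p (\<lambda>k. \<i> * of_real (\<xi> $ k)) * ?F \<xi>)) \<partial>lborel)"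
    unfolding symb[symmetric] by (simp add: sum_distrib_left mult_ac)
  also have "\<dots> = (\<integral>\<xi>. iexp (\<xi> \<bullet> x) * (poly_eval q (\<lambda>k. \<i> * of_real (\<xi> $ k)) * ?F \<xi>) \<partial>lborel)"
  proof (rule integral_cong_AE)
    have [measurable]: "\<phi> \<in> borel_measurable borel" using test_function_measurable[OF \<phi>] .
    show "(\<lambda>\<xi>. iexp (\<xi> \<bullet> x) * (h 0 \<xi> * (poly_eval p (\<lambda>k. \<i> * of_real (\<xi> $ k)) * ?F \<xi>))) \<in> borel_measurable lborel" by measurable
    show "(\<lambda>\<xi>. iexp (\<xi> \<bullet> x) * (poly_eval q (\<lambda>k. \<i> * of_real (\<xi> $ k)) * ?F \<xi>)) \<in> borel_measurable lborel" by measurable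
    \<comment> \<open>The division by \<open>p\<close> is undone here: \<open>h 0\<close> times the
      symbol of \<open>p\<close> is the symbol of \<open>q\<close> wherever the former symbol does
      not vanish.\<close>
    show "AE \<xi> in lborel. iexp (\<xi> \<bullet> x) * (h 0 \<xi> * (poly_eval p (\<lambda>k. \<i> * of_real (\<xi> $ k)) * ?F \<xi>))
      = iexp (\<xi> \<bullet> x) * (poly_eval q (\<lambda>k. \<i> * of_real (\<xi> $ k)) * ?F \<xi>)"
      using AE_poly_eval_nonzero[OF is_poly_p \<alpha>] by eventually_elim (simp add: symbol_ratio_def)
  qed
  also have "\<dots> = (\<integral>\<xi>. (\<Sum>\<alpha>\<in>?Q. of_real (q \<alpha>) * (iexp (\<xi> \<bullet> x) * ftr (Dmulti \<alpha> \<phi>) (- \<xi>))) \<partial>lborel)"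
    unfolding symb[symmetric] by (simp add: sum_distrib_left mult_ac)
  also have "\<dots> = (\<Sum>\<alpha>\<in>?Q. \<integral>\<xi>. of_real (q \<alpha>) * (iexp (\<xi> \<bullet> x) * ftr (Dmulti \<alpha> \<phi>) (- \<xi>)) \<partial>lborel)"
  proof (intro Bochner_Integration.integral_sum integrable_mult_right ft_integrable)
    fix \<alpha>
    show "integrable lborel (\<lambda>\<xi>. ftr (Dmulti \<alpha> \<phi>) (- \<xi>))"
      using integrable_lborel_affine[OF integrable_ftr[OF T], where c="-1" and t=0] by simp
  qed
  also have "\<dots> = (\<Sum>\<alpha>\<in>?Q. of_real (q \<alpha>) * complex_of_real (?K * Dmulti \<alpha> \<phi> x))"
    using test_function_inversion[OF T, of x] by simp
  also have "\<dots> = complex_of_real (?K * poly_diff_op q \<phi> x)"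
    unfolding poly_diff_op_def by (simp add: sum_distrib_left mult_ac)
  finally have "?K * poly_diff_op p (convolution G \<phi>) x = ?K * poly_diff_op q \<phi> x"
    unfolding of_real_eq_iff .
  then show "poly_diff_op p (convolution G \<phi>) x = poly_diff_op q \<phi> x" by simp
qed

end

subsection \<open>Characteristic functions of simple integrals\<close>

text \<open>An inequality rather than an equality, because outside the sets \<open>P i\<close> the
  integrand is only known to be nonnegative. It compares the finite sum in an exponent with an
  integral over the whole space.\<close>

lemma nn_integral_ge_sum_disjoint:
  fixes g :: "real \<Rightarrow> ennreal"
  assumes "finite I" "disjoint_family_on P I" and [measurable]: "\<And>i. i \<in> I \<Longrightarrow> P i \<in> sets N"
    and v: "\<And>i x. i \<in> I \<Longrightarrow> x \<in> P i \<Longrightarrow> F x = v i"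
  shows "(\<Sum>i\<in>I. g (v i) * emeasure N (P i)) \<le> (\<integral>\<^sup>+x. g (F x) \<partial>N)"
proof -
  have "(\<Sum>i\<in>I. g (v i) * emeasure N (P i)) = (\<integral>\<^sup>+x. (\<Sum>i\<in>I. g (v i) * indicator (P i) x) \<partial>N)"
    by (subst nn_integral_sum) (auto simp: nn_integral_cmult_indicator)
  also have "\<dots> \<le> (\<integral>\<^sup>+x. g (F x) \<partial>N)"
  proof (rule nn_integral_mono)
    fix x
    show "(\<Sum>i\<in>I. g (v i) * indicator (P i) x) \<le> g (F x)"
    proof (cases "\<exists>i\<in>I. x \<in> P i")
      case True
      then obtain i where i: "i \<in> I" "x \<in> P i" by blast
      have "indicator (P j) x = (0::ennreal)" if "j \<in> I - {i}" for j
        using that i assms(2) by (auto simp: disjoint_family_on_def indicator_def)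
      then have "(\<Sum>i\<in>I. g (v i) * indicator (P i) x) = g (v i)"
        using i assms(1) by (subst sum.remove[of I i]) auto
      then show ?thesis using v[OF i] by simp
    next
      case False
      then have "(\<Sum>i\<in>I. g (v i) * indicator (P i) x) = (\<Sum>i\<in>I. 0)"
        by (intro sum.cong) auto
      then show ?thesis by simp
    qed
  qed
  finally show ?thesis .
qed

text \<open>Points are grouped by the set of indices \<open>j\<close> with
  \<open>x \<in> B j\<close>, which yields the atoms of the generated algebra. That index set is
  coded as a number because independence in \<open>levy_basis\<close> is stated for families over
  \<open>nat\<close>. The empty index set is left out, which keeps all atoms bounded.\<close>

lemma common_atoms:
  fixes B :: "nat \<Rightarrow> (real^'n::finite) set"
  assumes B: "\<And>j. j < N \<Longrightarrow> bounded_borel (B j)"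
  obtains I P D where "finite (I :: nat set)" "\<And>i. i \<in> I \<Longrightarrow> bounded_borel (P i)" "disjoint_family_on P I"
    "\<And>i. D i \<subseteq> {..<N}" "\<And>j. j < N \<Longrightarrow> B j = (\<Union>i\<in>{i\<in>I. j \<in> D i}. P i)"
    "\<And>i x j. i \<in> I \<Longrightarrow> x \<in> P i \<Longrightarrow> j < N \<Longrightarrow> x \<in> B j \<longleftrightarrow> j \<in> D i"
proof -
  define J where "J x = {j. j < N \<and> x \<in> B j}" for x
  define I where "I = set_encode ` (Pow {..<N} - {{}})"
  define P where "P i = {x. set_encode (J x) = i}" for i
  define D where "D i = set_decode i \<inter> {..<N}" for i
  have J: "finite (J x)" "J x \<subseteq> {..<N}" for x by (auto simp: J_def)
  have PI: "set_decode i = J x" if "x \<in> P i" for x i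
    using that J(1)[of x] by (auto simp: P_def)
  show ?thesis
  proof (rule that[of I P D])
    show "finite I" by (simp add: I_def)
    show "disjoint_family_on P I" by (auto simp: disjoint_family_on_def P_def)
    show "D i \<subseteq> {..<N}" for i by (simp add: D_def)
    show "x \<in> B j \<longleftrightarrow> j \<in> D i" if "i \<in> I" "x \<in> P i" "j < N" for i x j
      using PI[OF that(2)] that(3) by (auto simp: D_def J_def)
    show "B j = (\<Union>i\<in>{i\<in>I. j \<in> D i}. P i)" if "j < N" for j
    proof (intro equalityI subsetI)
      fix x assume "x \<in> B j"
      then have "j \<in> J x" using that by (simp add: J_def)
      then have "set_encode (J x) \<in> {i\<in>I. j \<in> D i}"
        using J[of x] that by (auto simp: I_def D_def)
      then show "x \<in> (\<Union>i\<in>{i\<in>I. j \<in> D i}. P i)" by (auto simp: P_def)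
    next
      fix x assume "x \<in> (\<Union>i\<in>{i\<in>I. j \<in> D i}. P i)"
      then show "x \<in> B j" using PI that by (auto simp: D_def J_def)
    qed
    show "bounded_borel (P i)" if i: "i \<in> I" for i
    proof -
      obtain S where S: "S \<subseteq> {..<N}" "S \<noteq> {}" "i = set_encode S" using i by (auto simp: I_def)
      have fS: "finite S" using S finite_subset by blast
      have "P i = {x. J x = S}"
        unfolding P_def S(3) using J(1) fS by (metis set_encode_inverse)
      also have "\<dots> = (\<Inter>j\<in>{..<N}. if j \<in> S then B j else - B j)"
        using S(1) by (auto simp: J_def split: if_splits)
      finally have eq: "P i = (\<Inter>j\<in>{..<N}. if j \<in> S then B j else - B j)" .
      have "(\<Inter>j\<in>{..<N}. if j \<in> S then B j else - B j) \<in> sets borel"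
        using S B by (intro sets.finite_INT) (auto simp: bounded_borel_def intro!: borel_comp)
      moreover obtain j where "j \<in> S" using S by blast
      then have "P i \<subseteq> B j" "bounded (B j)" using eq S B by (auto simp: bounded_borel_def split: if_splits)
      ultimately show ?thesis
        unfolding bounded_borel_def using eq bounded_subset by auto
    qed
  qed
qed

lemma simple_eval_sum: "simple_eval s x = (\<Sum>j<length s. fst (s ! j) * indicator (snd (s ! j)) x)"
  unfolding simple_eval_def by (simp add: sum_list_sum_nth split_beta' atLeast0LessThan)

lemma simple_int_sum: "simple_int L s A \<omega> = (\<Sum>j<length s. fst (s ! j) * L (A \<inter> snd (s ! j)) \<omega>)"
  unfolding simple_int_def by (simp add: sum_list_sum_nth split_beta' atLeast0LessThan)

text \<open>Makes a difference of simple functions again a list, so that an estimate for one simple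
  integral covers the distance between two.\<close>

definition neg_simple :: "(real \<times> (real^'n::finite) set) list \<Rightarrow> (real \<times> (real^'n) set) list" where
  "neg_simple s = map (\<lambda>(c, B). (- c, B)) s"

lemma simple_eval_diff: "simple_eval (s @ neg_simple t) x = simple_eval s x - simple_eval t x"
  unfolding simple_eval_def neg_simple_def
  by (induction t) (auto simp: o_def split_beta')

lemma simple_int_diff: "simple_int L (s @ neg_simple t) A \<omega> = simple_int L s A \<omega> - simple_int L t A \<omega>"
  unfolding simple_int_def neg_simple_def
  by (induction t) (auto simp: o_def split_beta')

lemma bounded_borel_Int: "A \<in> sets lborel \<Longrightarrow> bounded_borel B \<Longrightarrow> bounded_borel (A \<inter> B)"
  by (auto simp: bounded_borel_def intro: bounded_subset)

lemma bounded_borel_empty: "bounded_borel {}"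
  by (simp add: bounded_borel_def)

locale levy = 
  fixes M :: "'w measure" and L :: "(real^'n::finite) set \<Rightarrow> 'w \<Rightarrow> real"
    and a \<gamma> :: real and \<nu> :: "real measure"
  assumes basis: "levy_basis M L a \<gamma> \<nu>"
begin

sublocale prob_space M
  using basis by (simp add: levy_basis_def)

lemma L_measurable [measurable]: "bounded_borel A \<Longrightarrow> L A \<in> borel_measurable M"
  using basis by (simp add: levy_basis_def)

lemma simple_int_measurable:
  assumes "A \<in> sets lborel" "\<forall>(c, B)\<in>set s. bounded_borel B"
  shows "simple_int L s A \<in> borel_measurable M"
proof -
  have "(\<lambda>\<omega>. \<Sum>j<length s. fst (s ! j) * L (A \<inter> snd (s ! j)) \<omega>) \<in> borel_measurable M"
    using assms nth_mem[of _ s] by (intro borel_measurable_sum borel_measurable_times L_measurable bounded_borel_Int) fastforce+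
  then show ?thesis unfolding simple_int_sum[abs_def] .
qed

lemma L_countably_additive:
  assumes "\<And>n. bounded_borel (A n)" "disjoint_family A" "bounded (\<Union>n. A n)"
  shows "AE \<omega> in M. (\<lambda>n. L (A n) \<omega>) sums L (\<Union>n. A n) \<omega>"
  using basis assms unfolding levy_basis_def by blast

text \<open>Countable additivity for a sequence of empty sets: a constant series converges only if
  its terms vanish.\<close>

lemma L_empty: "AE \<omega> in M. L {} \<omega> = 0"
proof -
  have "AE \<omega> in M. (\<lambda>n::nat. L {} \<omega>) sums L (\<Union>n::nat. {}) \<omega>"
    by (rule L_countably_additive) (auto simp: bounded_borel_empty disjoint_family_on_def)
  then show ?thesis by eventually_elim (auto dest!: sums_summable simp: summable_const_iff)
qed

text \<open>The family is padded with empty sets to a sequence, on which \<open>L {}\<close>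
  contributes nothing almost surely.\<close>

lemma L_finite_Union:
  fixes S :: "nat set"
  assumes "finite S" "\<And>i. i \<in> S \<Longrightarrow> bounded_borel (P i)" "disjoint_family_on P S"
  shows "AE \<omega> in M. L (\<Union>i\<in>S. P i) \<omega> = (\<Sum>i\<in>S. L (P i) \<omega>)"
proof -
  define A where "A n = (if n \<in> S then P n else {})" for n
  have U: "(\<Union>n. A n) = (\<Union>i\<in>S. P i)" by (auto simp: A_def split: if_splits)
  have "AE \<omega> in M. (\<lambda>n. L (A n) \<omega>) sums L (\<Union>n. A n) \<omega>"
  proof (rule L_countably_additive)
    show "bounded_borel (A n)" for n using assms by (auto simp: A_def bounded_borel_empty)
    show "disjoint_family A" using assms(3) by (auto simp: A_def disjoint_family_on_def)
    show "bounded (\<Union>n. A n)" unfolding U using assms by (intro bounded_UN) (auto simp: bounded_borel_def)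
  qed
  with L_empty show ?thesis
  proof eventually_elim
    case (elim \<omega>)
    have "(\<lambda>n. L (A n) \<omega>) sums (\<Sum>n\<in>S. L (A n) \<omega>)"
      using assms(1) elim(1) by (intro sums_finite) (auto simp: A_def)
    with elim(2) have "L (\<Union>n. A n) \<omega> = (\<Sum>n\<in>S. L (A n) \<omega>)" by (rule sums_unique2)
    then show ?case unfolding U by (simp add: A_def)
  qed
qed

abbreviation psi :: "real \<Rightarrow> complex" where "psi \<equiv> levy_exponent a \<gamma> \<nu>"

lemma char_L:
  assumes A: "bounded_borel A"
  shows "char (distr M borel (\<lambda>\<omega>. v * L A \<omega>)) z = exp (psi (z * v) * complex_of_real (measure lborel A))"
proof -
  have [measurable]: "L A \<in> borel_measurable M" using A by (rule L_measurable)
  have "char (distr M borel (\<lambda>\<omega>. v * L A \<omega>)) z = (\<integral>\<omega>. exp (\<i> * complex_of_real (z * v * L A \<omega>)) \<partial>M)"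
    unfolding char_def by (subst integral_distr) (auto simp: mult.assoc)
  also have "\<dots> = exp (psi (z * v) * complex_of_real (measure lborel A))"
    using basis A unfolding levy_basis_def by blast
  finally show ?thesis .
qed

text \<open>On common atoms the integral is a sum of independent terms, so \<open>J\<close> is a sum
  of values of \<open>psi\<close> weighted by volumes. Only its size is exported, against an
  arbitrary majorant \<open>g\<close>, and \<open>A\<close> is absent from the bound; the later
  estimates are thereby uniform over all measurable sets.\<close>

lemma char_simple_int:
  assumes A: "A \<in> sets lborel" and s: "\<forall>(c, B)\<in>set s. bounded_borel B"
  obtains J where "char (distr M borel (simple_int L s A)) z = exp J"
    "\<And>g. (\<And>u. ennreal (cmod (psi u)) \<le> g u) \<Longrightarrow> ennreal (cmod J) \<le> (\<integral>\<^sup>+x. g (z * simple_eval s x) \<partial>lborel)"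
proof -
  let ?N = "length s"
  have "bounded_borel (snd (s ! j))" if "j < ?N" for j
    using s nth_mem[OF that] by (auto simp: split_beta')
  from common_atoms[of ?N "\<lambda>j. snd (s ! j)", OF this]
  obtain I P D where IP: "finite (I :: nat set)" "\<And>i. i \<in> I \<Longrightarrow> bounded_borel (P i)" "disjoint_family_on P I"
    and D: "\<And>i. D i \<subseteq> {..<?N}" and U: "\<And>j. j < ?N \<Longrightarrow> snd (s ! j) = (\<Union>i\<in>{i\<in>I. j \<in> D i}. P i)"
    and mem: "\<And>i x j. i \<in> I \<Longrightarrow> x \<in> P i \<Longrightarrow> j < ?N \<Longrightarrow> x \<in> snd (s ! j) \<longleftrightarrow> j \<in> D i"
    by blast
  define v where "v i = (\<Sum>j\<in>D i. fst (s ! j))" for i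
  define Q where "Q i = A \<inter> P i" for i
  have Q: "bounded_borel (Q i)" if "i \<in> I" for i unfolding Q_def using bounded_borel_Int[OF A IP(2)[OF that]] .
  have Qd: "disjoint_family_on Q I" using IP(3) by (auto simp: disjoint_family_on_def Q_def)
  have finD: "finite (D i)" for i using D finite_subset by blast
  have restr: "(\<Sum>j<?N. if j \<in> D i then X j else 0) = (\<Sum>j\<in>D i. X j)" for i and X :: "nat \<Rightarrow> real"
    using D[of i] by (subst sum.inter_restrict[symmetric]) (auto simp: Int_absorb1)
  have eval: "simple_eval s x = v i" if "i \<in> I" "x \<in> P i" for i x
  proof -
    have "simple_eval s x = (\<Sum>j<?N. if j \<in> D i then fst (s ! j) else 0)"
      unfolding simple_eval_sum using mem[OF that] by (intro sum.cong) (auto simp: indicator_def)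
    also have "\<dots> = v i" unfolding v_def by (rule restr)
    finally show ?thesis .
  qed
  have "AE \<omega> in M. \<forall>j\<in>{..<?N}. L (A \<inter> snd (s ! j)) \<omega> = (\<Sum>i\<in>{i\<in>I. j \<in> D i}. L (Q i) \<omega>)"
  proof (intro AE_finite_allI)
    fix j assume j: "j \<in> {..<?N}"
    have "A \<inter> snd (s ! j) = (\<Union>i\<in>{i\<in>I. j \<in> D i}. Q i)" using U[of j] j by (auto simp: Q_def)
    moreover have "AE \<omega> in M. L (\<Union>i\<in>{i\<in>I. j \<in> D i}. Q i) \<omega> = (\<Sum>i\<in>{i\<in>I. j \<in> D i}. L (Q i) \<omega>)"
      using IP(1) Q Qd by (intro L_finite_Union) (auto simp: disjoint_family_on_def)
    ultimately show "AE \<omega> in M. L (A \<inter> snd (s ! j)) \<omega> = (\<Sum>i\<in>{i\<in>I. j \<in> D i}. L (Q i) \<omega>)" by simp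
  qed simp
  then have AEeq: "AE \<omega> in M. simple_int L s A \<omega> = (\<Sum>i\<in>I. v i * L (Q i) \<omega>)"
  proof eventually_elim
    case (elim \<omega>)
    have "simple_int L s A \<omega> = (\<Sum>j<?N. \<Sum>i\<in>{i\<in>I. j \<in> D i}. fst (s ! j) * L (Q i) \<omega>)"
      unfolding simple_int_sum using elim by (intro sum.cong) (auto simp: sum_distrib_left)
    also have "\<dots> = (\<Sum>j<?N. \<Sum>i\<in>I. if j \<in> D i then fst (s ! j) * L (Q i) \<omega> else 0)"
      using IP(1) by (intro sum.cong refl sum.mono_neutral_cong_left) auto
    also have "\<dots> = (\<Sum>i\<in>I. \<Sum>j<?N. if j \<in> D i then fst (s ! j) * L (Q i) \<omega> else 0)" by (rule sum.swap)
    also have "\<dots> = (\<Sum>i\<in>I. \<Sum>j\<in>D i. fst (s ! j) * L (Q i) \<omega>)"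
      by (simp only: restr)
    also have "\<dots> = (\<Sum>i\<in>I. v i * L (Q i) \<omega>)" by (simp add: v_def sum_distrib_right)
    finally show ?case .
  qed
  have [measurable]: "simple_int L s A \<in> borel_measurable M" by (rule simple_int_measurable[OF A s])
  have [measurable]: "i \<in> I \<Longrightarrow> L (Q i) \<in> borel_measurable M" for i using Q by simp
  have "indep_vars (\<lambda>_. borel) (\<lambda>i. L (Q i)) I"
    using basis IP(1) Q Qd unfolding levy_basis_def by blast
  then have ind: "indep_vars (\<lambda>_. borel) (\<lambda>i \<omega>. v i * L (Q i) \<omega>) I"
    by (rule indep_vars_compose2) simp
  define J where "J = (\<Sum>i\<in>I. psi (z * v i) * complex_of_real (measure lborel (Q i)))"
  show ?thesis
  proof (rule that[of J])
    have "char (distr M borel (simple_int L s A)) z = char (distr M borel (\<lambda>\<omega>. \<Sum>i\<in>I. v i * L (Q i) \<omega>)) z"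
      unfolding char_def using AEeq by (subst (1 2) integral_distr) (auto intro!: integral_cong_AE)
    also have "\<dots> = (\<Prod>i\<in>I. char (distr M borel (\<lambda>\<omega>. v i * L (Q i) \<omega>)) z)" by (rule char_distr_sum[OF ind])
    also have "\<dots> = exp J" unfolding J_def using IP(1) Q by (simp add: char_L exp_sum)
    finally show "char (distr M borel (simple_int L s A)) z = exp J" .
  next
    fix g :: "real \<Rightarrow> ennreal" assume g: "\<And>u. ennreal (cmod (psi u)) \<le> g u"
    have "ennreal (cmod J) \<le> (\<Sum>i\<in>I. ennreal (cmod (psi (z * v i)) * measure lborel (Q i)))"
      unfolding J_def by (subst sum_ennreal) (auto intro!: ennreal_leI order_trans[OF norm_sum] simp: norm_mult)
    also have "\<dots> \<le> (\<Sum>i\<in>I. g (z * v i) * emeasure lborel (P i))"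
    proof (rule sum_mono)
      fix i assume i: "i \<in> I"
      have "emeasure lborel (Q i) < \<infinity>" using Q[OF i] emeasure_bounded_finite[of "Q i"] by (simp add: bounded_borel_def)
      then have "ennreal (measure lborel (Q i)) = emeasure lborel (Q i)" by (simp add: emeasure_eq_ennreal_measure less_top)
      \<comment> \<open>Cutting an atom with \<open>A\<close> can only lower its volume; this is how
        \<open>A\<close> drops out.\<close>
      also have "\<dots> \<le> emeasure lborel (P i)"
        using IP(2)[OF i] by (intro emeasure_mono) (auto simp: Q_def bounded_borel_def)
      finally show "ennreal (cmod (psi (z * v i)) * measure lborel (Q i)) \<le> g (z * v i) * emeasure lborel (P i)"
        using g by (simp add: ennreal_mult mult_mono)
    qed
    also have "\<dots> \<le> (\<integral>\<^sup>+x. g (z * simple_eval s x) \<partial>lborel)"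
      using IP eval by (intro nn_integral_ge_sum_disjoint) (auto simp: bounded_borel_def)
    finally show "ennreal (cmod J) \<le> (\<integral>\<^sup>+x. g (z * simple_eval s x) \<partial>lborel)" .
  qed
qed

end

text \<open>The standard normal average of \<open>exp (i z Y)\<close> over \<open>z\<close> is \<open>exp (- Y\<^sup>2 / 2)\<close>.\<close>
lemma gaussian_average_char:
  assumes "prob_space M" and [measurable]: "Y \<in> borel_measurable M"
  shows "(\<integral>\<^sup>+\<omega>. ennreal (1 - exp (- (Y \<omega>)\<^sup>2 / 2)) \<partial>M)
    \<le> (\<integral>\<^sup>+z. ennreal (cmod (1 - char (distr M borel Y) z)) \<partial>std_normal_distribution)"
proof -
  let ?N = std_normal_distribution
  interpret prob_space M by fact
  have iY: "integrable M (\<lambda>\<omega>. exp (- (Y \<omega>)\<^sup>2 / 2))"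
    by (rule integrable_const_bound[of _ 1]) auto
  interpret N: prob_space ?N by (rule prob_space_normal_density) simp
  interpret pair_prob_space M ?N ..
  have int: "integrable (M \<Otimes>\<^sub>M ?N) (\<lambda>(\<omega>, z). iexp (z * Y \<omega>))"
    by (rule P.integrable_const_bound[of _ 1]) (auto simp: split_beta')
  have "complex_of_real (\<integral>\<omega>. exp (- (Y \<omega>)\<^sup>2 / 2) \<partial>M) = (\<integral>\<omega>. (\<integral>z. iexp (z * Y \<omega>) \<partial>?N) \<partial>M)"
  proof -
    have "(\<integral>z. iexp (z * Y \<omega>) \<partial>?N) = complex_of_real (exp (- (Y \<omega>)\<^sup>2 / 2))" for \<omega>
    proof -
      have "(\<integral>z. iexp (z * Y \<omega>) \<partial>?N) = char ?N (Y \<omega>)"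
        unfolding char_def by (simp add: mult.commute)
      then show ?thesis by (simp add: char_std_normal_distribution)
    qed
    then show ?thesis by simp
  qed
  also have "\<dots> = (\<integral>z. (\<integral>\<omega>. iexp (z * Y \<omega>) \<partial>M) \<partial>?N)"
    by (rule Fubini_integral[symmetric, OF int])
  also have "\<dots> = (\<integral>z. char (distr M borel Y) z \<partial>?N)"
  proof -
    have "char (distr M borel Y) z = (\<integral>\<omega>. iexp (z * Y \<omega>) \<partial>M)" for z
      unfolding char_def by (subst integral_distr) auto
    then show ?thesis by simp
  qed
  finally have eq: "complex_of_real (\<integral>\<omega>. exp (- (Y \<omega>)\<^sup>2 / 2) \<partial>M) = (\<integral>z. char (distr M borel Y) z \<partial>?N)" .
  interpret Y: real_distribution "distr M borel Y" by (rule prob_space.real_distribution_distr[OF assms(1)]) simp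
  have ic: "integrable ?N (char (distr M borel Y))"
    by (rule N.integrable_const_bound[of _ 1]) (auto simp: Y.cmod_char_le_1)
  have "(\<integral>\<^sup>+\<omega>. ennreal (1 - exp (- (Y \<omega>)\<^sup>2 / 2)) \<partial>M) = ennreal (\<integral>\<omega>. 1 - exp (- (Y \<omega>)\<^sup>2 / 2) \<partial>M)"
    using iY by (intro nn_integral_eq_integral) auto
  also have "(\<integral>\<omega>. 1 - exp (- (Y \<omega>)\<^sup>2 / 2) \<partial>M) = 1 - (\<integral>\<omega>. exp (- (Y \<omega>)\<^sup>2 / 2) \<partial>M)"
    using iY by (simp add: prob_space.prob_space[OF assms(1)])
  also have "\<dots> \<le> cmod (complex_of_real (1 - (\<integral>\<omega>. exp (- (Y \<omega>)\<^sup>2 / 2) \<partial>M)))"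
    unfolding norm_of_real by simp
  also have "complex_of_real (1 - (\<integral>\<omega>. exp (- (Y \<omega>)\<^sup>2 / 2) \<partial>M)) = (\<integral>z. 1 - char (distr M borel Y) z \<partial>?N)"
    using eq ic N.prob_space by simp
  finally have "(\<integral>\<^sup>+\<omega>. ennreal (1 - exp (- (Y \<omega>)\<^sup>2 / 2)) \<partial>M) \<le> ennreal (cmod (\<integral>z. 1 - char (distr M borel Y) z \<partial>?N))"
    by (simp add: ennreal_leI)
  also have "\<dots> \<le> (\<integral>\<^sup>+z. ennreal (cmod (1 - char (distr M borel Y) z)) \<partial>?N)"
    by (rule norm_integral_le_nn_integral)
  finally show ?thesis .
qed

text \<open>Along a fast subsequence almost every path converges. Fatou's lemma then bounds the
  distance of each \<open>Y n\<close> from the limit, and Markov's inequality turns this into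
  convergence in probability.\<close>

lemma conv_in_prob_of_Cauchy:
  assumes "prob_space M" and Y: "\<And>n. Y n \<in> borel_measurable M"
    and b: "b \<longlonglongrightarrow> (0::ennreal)"
    and le: "\<And>n m. (\<integral>\<^sup>+\<omega>. ennreal (1 - exp (- (Y n \<omega> - Y m \<omega>)\<^sup>2 / 2)) \<partial>M) \<le> b n + b m"
  shows "\<exists>Z. conv_in_prob M Y Z"
proof -
  interpret prob_space M by fact
  note Y [measurable]
  define D where "D x = 1 - exp (- x\<^sup>2 / 2)" for x :: real
  have D0: "D x \<ge> 0" for x by (simp add: D_def)
  have [measurable]: "D \<in> borel_measurable borel" unfolding D_def by measurable
  have Dmono: "D x \<le> D y" if "\<bar>x\<bar> \<le> \<bar>y\<bar>" for x y
    using that by (simp add: D_def abs_le_square_iff)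
  have Dpos: "D x > 0" if "x \<noteq> 0" for x using that by (simp add: D_def)
  \<comment> \<open>\<open>D x < c k\<close> forces \<open>\<bar>x\<bar> < (1/2) ^ k\<close>, which makes increments summable.\<close>
  define c where "c k = D ((1/2) ^ k)" for k :: nat
  have c: "c k > 0" for k unfolding c_def by (rule Dpos) simp
  have c1: "c k \<le> 1" for k by (simp add: c_def D_def)
  have cdec: "c (Suc k) \<le> c k" for k unfolding c_def by (rule Dmono) (auto simp: power_decreasing)
  have "\<exists>n. b n < ennreal (c k * (1/2) ^ k)" for k
  proof -
    have "eventually (\<lambda>n. b n < ennreal (c k * (1/2) ^ k)) sequentially"
      by (rule order_tendstoD(2)[OF b]) (simp add: c)
    then show ?thesis by (auto simp: eventually_sequentially)
  qed
  then obtain r where r: "\<And>k. b (r k) < ennreal (c k * (1/2) ^ k)" by metis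
  \<comment> \<open>Even after division by \<open>c k\<close> the expectations are summable, since
    \<open>b (r k)\<close> was chosen below \<open>c k * (1/2) ^ k\<close>. So almost surely the
    quotients tend to 0 and are eventually below 1.\<close>
  have "(\<integral>\<^sup>+\<omega>. (\<Sum>k. ennreal (D (Y (r (Suc k)) \<omega> - Y (r k) \<omega>) / c k)) \<partial>M)
    = (\<Sum>k. \<integral>\<^sup>+\<omega>. ennreal (1 / c k) * ennreal (D (Y (r (Suc k)) \<omega> - Y (r k) \<omega>)) \<partial>M)"
    using c D0 by (subst nn_integral_suminf) (auto simp flip: ennreal_mult' intro!: suminf_cong nn_integral_cong simp: less_imp_le)
  also have "\<dots> \<le> (\<Sum>k. ennreal (2 * (1/2) ^ k))"
  proof (intro suminf_le allI)
    fix k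
    have "(\<integral>\<^sup>+\<omega>. ennreal (D (Y (r (Suc k)) \<omega> - Y (r k) \<omega>)) \<partial>M) \<le> b (r (Suc k)) + b (r k)"
      unfolding D_def by (rule le)
    also have "\<dots> \<le> ennreal (c k * (1/2) ^ k) + ennreal (c k * (1/2) ^ k)"
    proof (intro add_mono)
      have "c (Suc k) * (1/2) ^ Suc k \<le> c k * (1/2) ^ k"
        using c[of k] c[of "Suc k"] by (intro mult_mono cdec power_decreasing) (auto simp: less_imp_le)
      then show "b (r (Suc k)) \<le> ennreal (c k * (1/2) ^ k)"
        using r[of "Suc k"] by (meson ennreal_leI less_imp_le order_trans)
    qed (use r in \<open>auto intro: less_imp_le\<close>)
    also have "\<dots> = ennreal (c k * (2 * (1/2) ^ k))"
      using c[of k] by (simp flip: ennreal_plus)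
    finally have "(\<integral>\<^sup>+\<omega>. ennreal (1 / c k) * ennreal (D (Y (r (Suc k)) \<omega> - Y (r k) \<omega>)) \<partial>M) \<le> ennreal (1 / c k) * ennreal (c k * (2 * (1/2) ^ k))"
      by (subst nn_integral_cmult) (auto intro: mult_left_mono)
    also have "\<dots> = ennreal (2 * (1/2) ^ k)" using c[of k] by (simp flip: ennreal_mult')
    finally show "(\<integral>\<^sup>+\<omega>. ennreal (1 / c k) * ennreal (D (Y (r (Suc k)) \<omega> - Y (r k) \<omega>)) \<partial>M) \<le> ennreal (2 * (1/2) ^ k)" .
  qed auto
  also have "\<dots> = ennreal (\<Sum>k. 2 * (1/2) ^ k)"
    by (intro suminf_ennreal2 summable_mult summable_geometric) auto
  also have "\<dots> < \<infinity>" by simp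
  finally have "AE \<omega> in M. (\<Sum>k. ennreal (D (Y (r (Suc k)) \<omega> - Y (r k) \<omega>) / c k)) \<noteq> \<infinity>"
    by (intro nn_integral_noteq_infinite) auto
  then have lim: "AE \<omega> in M. (\<lambda>k. Y (r k) \<omega>) \<longlonglongrightarrow> lim (\<lambda>k. Y (r k) \<omega>)"
  proof eventually_elim
    case (elim \<omega>)
    have "summable (\<lambda>k. D (Y (r (Suc k)) \<omega> - Y (r k) \<omega>) / c k)"
      using elim c D0 by (intro summable_suminf_not_top) (auto simp: less_imp_le)
    then have "(\<lambda>k. D (Y (r (Suc k)) \<omega> - Y (r k) \<omega>) / c k) \<longlonglongrightarrow> 0" by (rule summable_LIMSEQ_zero)
    then have "eventually (\<lambda>k. D (Y (r (Suc k)) \<omega> - Y (r k) \<omega>) / c k < 1) sequentially"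
      by (rule order_tendstoD) simp
    then have "eventually (\<lambda>k. norm (Y (r (Suc k)) \<omega> - Y (r k) \<omega>) \<le> (1/2) ^ k) sequentially"
    proof eventually_elim
      case (elim k)
      then have less: "D (Y (r (Suc k)) \<omega> - Y (r k) \<omega>) < D ((1/2) ^ k)" using c[of k] by (simp add: c_def field_simps)
      show ?case
      proof (rule ccontr)
        assume "\<not> ?case"
        then have "D ((1/2) ^ k) \<le> D (Y (r (Suc k)) \<omega> - Y (r k) \<omega>)" by (intro Dmono) auto
        with less show False by simp
      qed
    qed
    then have sm: "summable (\<lambda>k. Y (r (Suc k)) \<omega> - Y (r k) \<omega>)"
      by (rule summable_comparison_test_ev) (auto intro: summable_geometric)
    have "(\<lambda>n. (\<Sum>k<n. Y (r (Suc k)) \<omega> - Y (r k) \<omega>) + Y (r 0) \<omega>) \<longlonglongrightarrow> (\<Sum>k. Y (r (Suc k)) \<omega> - Y (r k) \<omega>) + Y (r 0) \<omega>"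
      by (intro tendsto_add summable_LIMSEQ sm tendsto_const)
    then have "convergent (\<lambda>k. Y (r k) \<omega>)"
      using sum_lessThan_telescope[of "\<lambda>k. Y (r k) \<omega>"] by (auto simp: convergent_def)
    then show ?case by (simp add: convergent_LIMSEQ_iff)
  qed
  define Z where "Z \<omega> = lim (\<lambda>k. Y (r k) \<omega>)" for \<omega>
  have [measurable]: "Z \<in> borel_measurable M" unfolding Z_def by measurable
  \<comment> \<open>The comparison uses the index \<open>k + n\<close> rather than \<open>k\<close>:
    then \<open>b (r (k + n)) \<le> (1/2) ^ n\<close> for every \<open>k\<close>, and the resulting
    bound tends to 0 with \<open>n\<close>.\<close>
  have DZ: "(\<integral>\<^sup>+\<omega>. ennreal (D (Y n \<omega> - Z \<omega>)) \<partial>M) \<le> b n + ennreal ((1/2) ^ n)" for n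
  proof (rule nn_integral_le_of_tendsto)
    show "(\<lambda>\<omega>. ennreal (D (Y n \<omega> - Y (r (k + n)) \<omega>))) \<in> borel_measurable M" for k by measurable
    show "AE \<omega> in M. (\<lambda>k. ennreal (D (Y n \<omega> - Y (r (k + n)) \<omega>))) \<longlonglongrightarrow> ennreal (D (Y n \<omega> - Z \<omega>))"
      using lim
    proof eventually_elim
      case (elim \<omega>)
      then have "(\<lambda>k. Y (r (k + n)) \<omega>) \<longlonglongrightarrow> Z \<omega>" unfolding Z_def by (rule LIMSEQ_ignore_initial_segment)
      then show ?case unfolding D_def by (intro tendsto_ennrealI tendsto_intros) auto
    qed
    fix k
    have "c (k + n) * (1/2) ^ (k + n) \<le> 1 * (1/2) ^ n"
      using c[of "k + n"] by (intro mult_mono c1 power_decreasing) (auto simp: less_imp_le)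
    then have "ennreal (c (k + n) * (1/2) ^ (k + n)) \<le> ennreal ((1/2) ^ n)"
      by (intro ennreal_leI) simp
    then have "b (r (k + n)) \<le> ennreal ((1/2) ^ n)"
      by (rule order_trans[OF less_imp_le[OF r]])
    then show "(\<integral>\<^sup>+\<omega>. ennreal (D (Y n \<omega> - Y (r (k + n)) \<omega>)) \<partial>M) \<le> b n + ennreal ((1/2) ^ n)"
      unfolding D_def by (intro order_trans[OF le] add_left_mono)
  qed
  have blim: "(\<lambda>n. b n + ennreal ((1/2) ^ n)) \<longlonglongrightarrow> 0"
  proof -
    have "(\<lambda>n. ennreal ((1/2) ^ n)) \<longlonglongrightarrow> ennreal 0"
      by (intro tendsto_ennrealI LIMSEQ_realpow_zero) auto
    from tendsto_add[OF b this] show ?thesis by simp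
  qed
  have "conv_in_prob M Y Z"
    unfolding conv_in_prob_def
  proof (intro conjI allI impI)
    fix e :: real assume e: "e > 0"
    have De: "D e > 0" using e by (intro Dpos) auto
    \<comment> \<open>Markov's inequality, as \<open>D\<close> grows with the modulus of its
      argument.\<close>
    have le_e: "ennreal (measure M {\<omega>\<in>space M. \<bar>Y n \<omega> - Z \<omega>\<bar> > e}) \<le> ennreal (1 / D e) * (b n + ennreal ((1/2) ^ n))" for n
    proof -
      let ?S = "{\<omega>\<in>space M. \<bar>Y n \<omega> - Z \<omega>\<bar> > e}"
      have "ennreal (measure M ?S) = (\<integral>\<^sup>+\<omega>. indicator ?S \<omega> \<partial>M)"
        by (simp add: emeasure_eq_measure)
      also have "\<dots> \<le> (\<integral>\<^sup>+\<omega>. ennreal (1 / D e) * ennreal (D (Y n \<omega> - Z \<omega>)) \<partial>M)"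
      proof (rule nn_integral_mono)
        fix \<omega>
        have "1 \<le> (1 / D e) * D (Y n \<omega> - Z \<omega>)" if "\<omega> \<in> ?S"
          using Dmono[of e "Y n \<omega> - Z \<omega>"] that e De by (simp add: field_simps)
        then have "\<omega> \<in> ?S \<Longrightarrow> 1 \<le> ennreal (1 / D e) * ennreal (D (Y n \<omega> - Z \<omega>))"
          using De D0 by (subst ennreal_mult[symmetric]) (auto simp: ennreal_1[symmetric] simp del: ennreal_1 intro!: ennreal_leI)
        then show "indicator ?S \<omega> \<le> ennreal (1 / D e) * ennreal (D (Y n \<omega> - Z \<omega>))"
          by (cases "\<omega> \<in> ?S") auto
      qed
      also have "\<dots> \<le> ennreal (1 / D e) * (b n + ennreal ((1/2) ^ n))"
        using DZ[of n] by (subst nn_integral_cmult) (auto intro: mult_left_mono)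
      finally show ?thesis .
    qed
    have "(\<lambda>n. ennreal (1 / D e) * (b n + ennreal ((1/2) ^ n))) \<longlonglongrightarrow> ennreal (1 / D e) * 0"
      by (intro ennreal_tendsto_cmult blim) simp
    then have "(\<lambda>n. ennreal (1 / D e) * (b n + ennreal ((1/2) ^ n))) \<longlonglongrightarrow> 0" by simp
    then have "(\<lambda>n. ennreal (measure M {\<omega>\<in>space M. \<bar>Y n \<omega> - Z \<omega>\<bar> > e})) \<longlonglongrightarrow> 0"
      by (rule tendsto_sandwich[OF always_eventually always_eventually tendsto_const, rotated 2]) (use le_e in auto)
    then show "(\<lambda>n. measure M {\<omega>\<in>space M. \<bar>Y n \<omega> - Z \<omega>\<bar> > e}) \<longlonglongrightarrow> 0"
      by (simp add: ennreal_tendsto_0_iff)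
  qed (use Y in auto)
  then show ?thesis by blast
qed

subsection \<open>Integrability in the sense of Rajput and Rosinski\<close>

text \<open>The hypothesis places \<open>J\<close> in the closed left half plane, which is convex
  and on which the derivative of \<open>exp\<close> has modulus at most 1.\<close>

lemma cmod_one_minus_exp: 
  assumes "cmod (exp J) \<le> 1" shows "cmod (1 - exp J) \<le> min 2 (cmod J)"
proof -
  have Re: "Re J \<le> 0" using assms by (simp add: norm_exp_eq_Re)
  have "cmod (exp J - exp 0) \<le> 1 * cmod (J - 0)"
  proof (rule field_differentiable_bound[of "{z. Re z \<le> 0}" exp exp])
    show "convex {z. Re z \<le> 0}" by (rule convex_halfspace_Re_le)
    show "(exp has_field_derivative exp z) (at z within {z. Re z \<le> 0})" for z :: complex
      by (rule DERIV_subset[OF DERIV_exp]) simp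
    show "cmod (exp z) \<le> 1" if "z \<in> {z. Re z \<le> 0}" for z using that by (simp add: norm_exp_eq_Re)
  qed (use Re in auto)
  moreover have "cmod (1 - exp J) \<le> 2"
    using norm_triangle_ineq4[of 1 "exp J"] assms unfolding norm_one by linarith
  ultimately show ?thesis by (simp add: norm_minus_commute)
qed

text \<open>A majorant for the integrand of the Levy-Khintchine formula: quadratic where the
  compensator acts, and elsewhere the smaller of the two elementary bounds for the modulus of
  \<open>exp (\<i> * x) - 1\<close>. It is monotone in \<open>\<bar>u\<bar>\<close>, a property the
  integrand can lack.\<close>

definition jump_bound :: "real \<Rightarrow> real \<Rightarrow> real" where
  "jump_bound r u = (if \<bar>r\<bar> \<le> 1 then (r * u)\<^sup>2 else min 2 \<bar>r * u\<bar>)"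

lemma jump_bound_mono:
  assumes "\<bar>u\<bar> \<le> \<bar>v\<bar>" shows "jump_bound r u \<le> jump_bound r v"
proof -
  have "\<bar>r * u\<bar> \<le> \<bar>r * v\<bar>" unfolding abs_mult by (intro mult_left_mono assms) simp
  moreover from this have "(r * u)\<^sup>2 \<le> (r * v)\<^sup>2" by (simp only: abs_le_square_iff)
  ultimately show ?thesis unfolding jump_bound_def by auto
qed

lemma jump_bound_le: "jump_bound r u \<le> (2 + u\<^sup>2) * min 1 (r\<^sup>2)"
proof (cases "\<bar>r\<bar> \<le> 1")
  case True
  then have "r\<^sup>2 \<le> 1" by (simp add: abs_square_le_1)
  then have 1: "min 1 (r\<^sup>2) = r\<^sup>2" by simp
  have 2: "jump_bound r u = u\<^sup>2 * r\<^sup>2" using True by (simp add: jump_bound_def power_mult_distrib mult.commute)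
  show ?thesis unfolding 1 2 by (intro mult_right_mono) auto
next
  case False
  then have "r\<^sup>2 \<ge> 1" using abs_square_le_1[of r] by linarith
  then show ?thesis using False by (simp add: jump_bound_def) (smt (verit) zero_le_power2)
qed

lemma jump_bound_measurable [measurable (raw)]:
  assumes [measurable]: "f \<in> borel_measurable M" "g \<in> borel_measurable M"
  shows "(\<lambda>x. jump_bound (f x) (g x)) \<in> borel_measurable M"
  unfolding jump_bound_def by measurable

lemma jump_bound_tendsto_0: "u \<longlonglongrightarrow> 0 \<Longrightarrow> (\<lambda>n. jump_bound r (u n)) \<longlonglongrightarrow> 0"
proof -
  assume u: "u \<longlonglongrightarrow> 0"
  have "(\<lambda>n. (r * u n)\<^sup>2) \<longlonglongrightarrow> (r * 0)\<^sup>2" "(\<lambda>n. min 2 \<bar>r * u n\<bar>) \<longlonglongrightarrow> min 2 \<bar>r * 0\<bar>"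
    by (intro tendsto_intros u)+
  then show ?thesis unfolding jump_bound_def by (cases "\<bar>r\<bar> \<le> 1") auto
qed

lemma jump_integrand_bound:
  "cmod (exp (\<i> * complex_of_real (x * z)) - 1 - \<i> * complex_of_real (x * z * indicator {-1..1} x)) \<le> jump_bound x z"
proof (cases "\<bar>x\<bar> \<le> 1")
  case True
  then have "x \<in> {-1..1}" by auto
  then have "cmod (exp (\<i> * complex_of_real (x * z)) - 1 - \<i> * complex_of_real (x * z * indicator {-1..1} x))
    = cmod (iexp (x * z) - (\<Sum>k\<le>1. (\<i> * (x * z)) ^ k / fact k))"
    by (simp add: diff_diff_eq)
  also have "\<dots> \<le> \<bar>x * z\<bar> ^ Suc 1 / fact (Suc 1)" by (rule iexp_approx1)
  also have "\<dots> = (x * z)\<^sup>2 / 2" using power2_abs[of "x * z"] by (simp add: numeral_2_eq_2)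
  also have "\<dots> \<le> (x * z)\<^sup>2" by simp
  finally show ?thesis using True by (simp add: jump_bound_def)
next
  case False
  then have i: "indicator {-1..1} x = (0::real)" by (auto simp: indicator_def)
  have "cmod (iexp (x * z) - 1) \<le> 2" using norm_triangle_ineq4[of "iexp (x * z)" 1] by simp
  moreover have "cmod (iexp (x * z) - 1) \<le> \<bar>x * z\<bar>"
    using iexp_approx1[of "x * z" 0] by simp
  ultimately show ?thesis using False by (simp add: jump_bound_def i)
qed

text \<open>Where \<open>\<bar>x\<bar> > 1 / (n + 1)\<close> the function \<open>min 1 (x^2)\<close>
  is bounded below, so such sets have finite mass. This gives access to Tonelli's theorem for \<nu>
  and the volume.\<close>

lemma levy_measure_sigma_finite:
  assumes "levy_measure \<nu>" shows "sigma_finite_measure \<nu>"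
proof
  have [measurable_cong]: "sets \<nu> = sets borel" and 0: "emeasure \<nu> {0} = 0" 
    and fin: "(\<integral>\<^sup>+x. ennreal (min 1 (x\<^sup>2)) \<partial>\<nu>) < \<infinity>"
    using assms by (auto simp: levy_measure_def)
  have sp: "space \<nu> = UNIV" using \<open>sets \<nu> = sets borel\<close> sets_eq_imp_space_eq by fastforce
  define A where "A n = {x::real. \<bar>x\<bar> > 1 / real (Suc n)}" for n
  have A: "A n \<in> sets \<nu>" for n unfolding A_def by measurable
  have fA: "emeasure \<nu> (A n) \<noteq> \<infinity>" for n
  proof -
    have "emeasure \<nu> (A n) = (\<integral>\<^sup>+x. indicator (A n) x \<partial>\<nu>)" using A by simp
    also have "\<dots> \<le> (\<integral>\<^sup>+x. ennreal ((real (Suc n))\<^sup>2) * ennreal (min 1 (x\<^sup>2)) \<partial>\<nu>)"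
    proof (rule nn_integral_mono)
      fix x
      have "1 \<le> (real (Suc n))\<^sup>2 * min 1 (x\<^sup>2)" if "x \<in> A n"
      proof -
        have "1 \<le> real (Suc n) * \<bar>x\<bar>" using that by (simp add: A_def field_simps)
        then have "1\<^sup>2 \<le> (real (Suc n) * \<bar>x\<bar>)\<^sup>2" by (intro power_mono) auto
        then have "1 \<le> (real (Suc n))\<^sup>2 * x\<^sup>2" by (simp add: power_mult_distrib)
        moreover have "1 \<le> (real (Suc n))\<^sup>2" by (intro one_le_power) simp
        ultimately show ?thesis by (simp add: min_def)
      qed
      then show "indicator (A n) x \<le> ennreal ((real (Suc n))\<^sup>2) * ennreal (min 1 (x\<^sup>2))"
        by (subst ennreal_mult[symmetric]) (auto simp: indicator_def)
    qed
    also have "\<dots> < \<infinity>" using fin by (subst nn_integral_cmult) (auto simp: ennreal_mult_less_top)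
    finally show ?thesis by simp
  qed
  have U: "\<Union> (insert {0} (range A)) = UNIV"
  proof -
    have "x \<in> \<Union> (insert {0} (range A))" for x :: real
    proof (cases "x = 0")
      case False
      then obtain n where "1 / real (Suc n) < \<bar>x\<bar>" using nat_approx_posE[of "\<bar>x\<bar>"] by auto
      then show ?thesis by (auto simp: A_def)
    qed simp
    then show ?thesis by blast
  qed
  show "\<exists>A. countable A \<and> A \<subseteq> sets \<nu> \<and> \<Union> A = space \<nu> \<and> (\<forall>a\<in>A. emeasure \<nu> a \<noteq> \<infinity>)"
    using A fA 0 U by (intro exI[of _ "insert {0} (range A)"]) (auto simp: sp \<open>sets \<nu> = sets borel\<close>)
qed

lemma simple_eval_measurable:
  assumes "\<forall>(c, B)\<in>set s. bounded_borel B" shows "simple_eval s \<in> borel_measurable borel"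
proof -
  have "(\<lambda>x. \<Sum>j<length s. fst (s ! j) * indicator (snd (s ! j)) x) \<in> borel_measurable borel"
    using assms nth_mem[of _ s] by (intro borel_measurable_sum borel_measurable_times borel_measurable_const borel_measurable_indicator) (fastforce simp: bounded_borel_def)
  then show ?thesis unfolding simple_eval_sum[abs_def] .
qed

text \<open>The factor 2 yields a dominating function that does not depend on \<open>n\<close>.
  Cutting the level sets to balls of radius \<open>n\<close> makes them admissible for
  \<open>L\<close>, and pointwise convergence survives because each point lies in all but finitely
  many of the balls.\<close>

lemma simple_function_approximation:
  fixes f :: "real^'n::finite \<Rightarrow> real"
  assumes f: "f \<in> borel_measurable borel"
  obtains s :: "nat \<Rightarrow> (real \<times> (real^'n) set) list" where "\<And>n. \<forall>(c, B)\<in>set (s n). bounded_borel B"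
    "\<And>x. (\<lambda>n. simple_eval (s n) x) \<longlonglongrightarrow> f x" "\<And>n x. \<bar>simple_eval (s n) x\<bar> \<le> 2 * \<bar>f x\<bar>"
proof -
  have "f \<in> borel_measurable lborel" using f by simp
  from borel_measurable_implies_sequence_metric[OF this, of 0] obtain F where
    F: "\<And>n. simple_function lborel (F n)" "\<And>x. (\<lambda>n. F n x) \<longlonglongrightarrow> f x" "\<And>n x. \<bar>F n x\<bar> \<le> 2 * \<bar>f x\<bar>"
    by (auto simp: dist_real_def)
  have fin: "finite (range (F n))" for n using F(1)[of n] by (simp add: simple_function_def)
  have "\<exists>vs. set vs = range (F n) \<and> distinct vs" for n using finite_distinct_list[OF fin] .
  then obtain vs where vs: "\<And>n. set (vs n) = range (F n)" "\<And>n. distinct (vs n)" by metis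
  define s where "s n = map (\<lambda>v. (v, F n -` {v} \<inter> cball 0 (real n))) (vs n)" for n
  have eval: "simple_eval (s n) x = F n x * indicator (cball 0 (real n)) x" for n x
  proof -
    have "simple_eval (s n) x = (\<Sum>v\<leftarrow>vs n. v * indicator (F n -` {v} \<inter> cball 0 (real n)) x)"
      unfolding simple_eval_def s_def by (simp add: o_def)
    also have "\<dots> = (\<Sum>v\<in>range (F n). v * indicator (F n -` {v} \<inter> cball 0 (real n)) x)"
      using vs by (simp add: sum_list_distinct_conv_sum_set)
    also have "\<dots> = (\<Sum>v\<in>range (F n). if v = F n x then F n x * indicator (cball 0 (real n)) x else 0)"
      by (intro sum.cong) (auto simp: indicator_def)
    also have "\<dots> = F n x * indicator (cball 0 (real n)) x" using fin[of n] by (subst sum.delta) auto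
    finally show ?thesis .
  qed
  show ?thesis
  proof (rule that[of s])
    show "\<forall>(c, B)\<in>set (s n). bounded_borel B" for n
    proof -
      have "F n \<in> borel_measurable borel" using borel_measurable_simple_function[OF F(1)[of n]] by simp
      then have "F n -` {v} \<in> sets borel" for v using measurable_sets[of "F n" borel borel "{v}"] by simp
      then show ?thesis by (auto simp: s_def bounded_borel_def)
    qed
    show "(\<lambda>n. simple_eval (s n) x) \<longlonglongrightarrow> f x" for x
    proof (rule Lim_transform_eventually[OF F(2)])
      obtain N :: nat where "norm x \<le> real N" using real_arch_simple by blast
      then show "eventually (\<lambda>n. F n x = simple_eval (s n) x) sequentially"
        unfolding eval eventually_sequentially by (intro exI[of _ N]) (auto simp: indicator_def)
    qed
    show "\<bar>simple_eval (s n) x\<bar> \<le> 2 * \<bar>f x\<bar>" for n x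
      unfolding eval using F(3)[of n x] by (auto simp: indicator_def)
  qed
qed

context levy
begin

lemma nu: "levy_measure \<nu>" and a_nonneg: "a \<ge> 0"
  using basis by (auto simp: levy_basis_def)

lemma sets_nu [measurable_cong]: "sets \<nu> = sets borel"
  using nu by (simp add: levy_measure_def)

sublocale nu: sigma_finite_measure \<nu>
  by (rule levy_measure_sigma_finite[OF nu])

text \<open>Dominates the modulus of \<open>psi\<close> and is monotone in
  \<open>\<bar>u\<bar>\<close>, so a difference can be compared with either of its terms. Values in
  \<open>ennreal\<close> let integrals be formed before finiteness is known.\<close>

definition psi_bound :: "real \<Rightarrow> ennreal" where
  "psi_bound u = ennreal (\<bar>\<gamma> * u\<bar> + a * u\<^sup>2) + (\<integral>\<^sup>+r. ennreal (jump_bound r u) \<partial>\<nu>)"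

lemma psi_bound_measurable [measurable]: "psi_bound \<in> borel_measurable borel"
  unfolding psi_bound_def by measurable

lemma psi_le: "ennreal (cmod (psi u)) \<le> psi_bound u"
proof -
  let ?j = "\<lambda>x. exp (\<i> * complex_of_real (x * u)) - 1 - \<i> * complex_of_real (x * u * indicator {-1..1} x)"
  have "cmod (psi u) \<le> cmod (\<i> * complex_of_real (\<gamma> * u) - complex_of_real (a * u\<^sup>2 / 2)) + cmod (\<integral>x. ?j x \<partial>\<nu>)"
    unfolding levy_exponent_def by (rule norm_triangle_ineq)
  also have "cmod (\<i> * complex_of_real (\<gamma> * u) - complex_of_real (a * u\<^sup>2 / 2)) \<le> \<bar>\<gamma> * u\<bar> + \<bar>a * u\<^sup>2 / 2\<bar>"
    by (rule order_trans[OF norm_triangle_ineq4]) (simp add: norm_mult norm_power abs_mult)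
  also have "\<bar>a * u\<^sup>2 / 2\<bar> \<le> a * u\<^sup>2" using a_nonneg by simp
  finally have "ennreal (cmod (psi u)) \<le> ennreal (\<bar>\<gamma> * u\<bar> + a * u\<^sup>2 + cmod (\<integral>x. ?j x \<partial>\<nu>))"
    by (simp add: ennreal_leI)
  also have "\<dots> = ennreal (\<bar>\<gamma> * u\<bar> + a * u\<^sup>2) + ennreal (cmod (\<integral>x. ?j x \<partial>\<nu>))"
    using a_nonneg by (intro ennreal_plus) auto
  also have "ennreal (cmod (\<integral>x. ?j x \<partial>\<nu>)) \<le> (\<integral>\<^sup>+x. ennreal (cmod (?j x)) \<partial>\<nu>)"
    by (rule norm_integral_le_nn_integral)
  also have "\<dots> \<le> (\<integral>\<^sup>+x. ennreal (jump_bound x u) \<partial>\<nu>)"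
    by (intro nn_integral_mono ennreal_leI jump_integrand_bound)
  finally show ?thesis unfolding psi_bound_def by (simp add: add_left_mono)
qed

lemma psi_bound_mono: "\<bar>u\<bar> \<le> \<bar>v\<bar> \<Longrightarrow> psi_bound u \<le> psi_bound v"
  unfolding psi_bound_def using a_nonneg
  by (intro add_mono ennreal_leI nn_integral_mono jump_bound_mono mult_left_mono)
     (auto simp: abs_mult abs_le_square_iff intro: mult_left_mono)

lemma jump_fin: "(\<integral>\<^sup>+r. ennreal (jump_bound r u) \<partial>\<nu>) < \<infinity>"
proof -
  have "(\<integral>\<^sup>+r. ennreal (jump_bound r u) \<partial>\<nu>) \<le> (\<integral>\<^sup>+r. ennreal (2 + u\<^sup>2) * ennreal (min 1 (r\<^sup>2)) \<partial>\<nu>)"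
    by (intro nn_integral_mono, subst ennreal_mult[symmetric]) (auto intro!: ennreal_leI jump_bound_le simp del: ennreal_plus)
  also have "\<dots> < \<infinity>" using nu by (subst nn_integral_cmult) (auto simp: ennreal_mult_less_top levy_measure_def)
  finally show ?thesis .
qed

lemma psi_bound_tendsto_0:
  assumes u: "u \<longlonglongrightarrow> 0" shows "(\<lambda>n. psi_bound (u n)) \<longlonglongrightarrow> 0"
proof -
  obtain U where U: "\<And>n. \<bar>u n\<bar> \<le> U"
    using convergent_imp_Bseq[OF convergentI[OF u]] unfolding Bseq_def by auto
  have "(\<lambda>n. \<integral>\<^sup>+r. ennreal (jump_bound r (u n)) \<partial>\<nu>) \<longlonglongrightarrow> (\<integral>\<^sup>+(r::real). 0 \<partial>\<nu>)"
  proof (rule nn_integral_dominated_convergence[where w="\<lambda>r. ennreal (jump_bound r U)"])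
    show "AE r in \<nu>. ennreal (jump_bound r (u n)) \<le> ennreal (jump_bound r U)" for n
      using order_trans[OF U abs_ge_self, of n] by (intro AE_I2 ennreal_leI jump_bound_mono) auto
    show "AE r in \<nu>. (\<lambda>n. ennreal (jump_bound r (u n))) \<longlonglongrightarrow> 0"
      using tendsto_ennrealI[OF jump_bound_tendsto_0[OF u]] by (intro AE_I2) simp
  qed (use jump_fin in auto)
  moreover have "(\<lambda>n. \<bar>\<gamma> * u n\<bar> + a * (u n)\<^sup>2) \<longlonglongrightarrow> \<bar>\<gamma> * 0\<bar> + a * 0\<^sup>2"
    by (intro tendsto_intros u)
  then have "(\<lambda>n. ennreal (\<bar>\<gamma> * u n\<bar> + a * (u n)\<^sup>2)) \<longlonglongrightarrow> ennreal 0"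
    by (intro tendsto_ennrealI) simp
  ultimately have "(\<lambda>n. ennreal (\<bar>\<gamma> * u n\<bar> + a * (u n)\<^sup>2) + (\<integral>\<^sup>+r. ennreal (jump_bound r (u n)) \<partial>\<nu>)) \<longlonglongrightarrow> ennreal 0 + (\<integral>\<^sup>+(r::real). 0 \<partial>\<nu>)"
    by (intro tendsto_add)
  then show ?thesis unfolding psi_bound_def by simp
qed

text \<open>By Tonelli's theorem the integral over the space is taken first, for a fixed jump size
  \<open>r\<close>. The result is a multiple of \<open>min 1 (r^2)\<close> plus, for large jumps, a
  multiple of \<open>ln \<bar>r\<bar> ^ d\<close>; these are the two quantities whose
  \<nu>-integrals are assumed finite.\<close>

lemma psi_bound_integral_finite:
  fixes f :: "real^'n \<Rightarrow> real"
  assumes [measurable]: "f \<in> borel_measurable borel"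
    and log: "(\<integral>\<^sup>+r. indicator {r. \<bar>r\<bar> > 1} r * ennreal (ln \<bar>r\<bar> ^ CARD('n)) \<partial>\<nu>) < \<infinity>"
    and \<kappa>: "\<kappa> > 0" and L1: "(\<integral>\<^sup>+x. ennreal (exp (\<kappa> * norm x) * \<bar>f x\<bar>) \<partial>lborel) < \<infinity>"
    and L2: "(\<integral>\<^sup>+x. ennreal ((f x)\<^sup>2) \<partial>lborel) < \<infinity>"
  shows "(\<integral>\<^sup>+x. psi_bound (c * f x) \<partial>lborel) < \<infinity>"
proof -
  interpret P: pair_sigma_finite "lborel :: (real^'n) measure" \<nu> ..
  let ?E = "\<integral>\<^sup>+x. ennreal (exp (\<kappa> * norm x) * \<bar>f x\<bar>) \<partial>lborel"
  let ?S = "\<integral>\<^sup>+x. ennreal ((f x)\<^sup>2) \<partial>lborel"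
  have fE: "(\<integral>\<^sup>+x. ennreal \<bar>f x\<bar> \<partial>lborel) \<le> ?E"
  proof (intro nn_integral_mono ennreal_leI)
    fix x :: "real^'n"
    show "\<bar>f x\<bar> \<le> exp (\<kappa> * norm x) * \<bar>f x\<bar>"
      using mult_right_mono[of 1 "exp (\<kappa> * norm x)" "\<bar>f x\<bar>"] \<kappa> by simp
  qed
  define V where "V = unit_ball_vol (real CARD('n))"
  have V: "V \<ge> 0" by (simp add: V_def)
  define A where "A = ennreal (c\<^sup>2) * ?S + ennreal \<bar>c\<bar> * ?E"
  have A: "A < \<infinity>" using L1 L2 by (simp add: A_def ennreal_mult_less_top)
  \<comment> \<open>Twice the volume of the ball of radius
    \<open>ln \<bar>r\<bar> / \<kappa>\<close>, with the power of the logarithm taken out.\<close>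
  define B where "B = 2 * V / \<kappa> ^ CARD('n)"
  have B: "B \<ge> 0" using V \<kappa> by (simp add: B_def)
  have inner: "(\<integral>\<^sup>+x. ennreal (jump_bound r (c * f x)) \<partial>lborel)
     \<le> A * ennreal (min 1 (r\<^sup>2)) + ennreal B * (indicator {r. \<bar>r\<bar> > 1} r * ennreal (ln \<bar>r\<bar> ^ CARD('n)))" for r
  proof (cases "\<bar>r\<bar> \<le> 1")
    case True
    then have r2: "r\<^sup>2 \<le> 1" by (simp add: abs_square_le_1)
    have "(\<integral>\<^sup>+x. ennreal (jump_bound r (c * f x)) \<partial>lborel) = (\<integral>\<^sup>+x. ennreal (c\<^sup>2 * r\<^sup>2) * ennreal ((f x)\<^sup>2) \<partial>lborel)"
      using True by (intro nn_integral_cong) (simp add: jump_bound_def power_mult_distrib mult_ac flip: ennreal_mult)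
    also have "\<dots> = ennreal (c\<^sup>2) * ?S * ennreal (r\<^sup>2)"
      by (subst nn_integral_cmult) (auto simp: ennreal_mult mult_ac)
    also have "\<dots> \<le> A * ennreal (r\<^sup>2)" unfolding A_def by (intro mult_right_mono) auto
    finally show ?thesis using True r2 by (simp add: min_absorb2)
  next
    case False
    then have r1: "\<bar>r\<bar> > 1" by simp
    have r2: "r\<^sup>2 \<ge> 1" using False abs_square_le_1[of r] by linarith
    \<comment> \<open>The radius at which \<open>exp (\<kappa> * norm x)\<close> reaches
      \<open>\<bar>r\<bar>\<close>: inside the ball the bound 2 is used, outside it the weight
      absorbs \<open>\<bar>r\<bar>\<close>.\<close>
    define R where "R = ln \<bar>r\<bar> / \<kappa>"
    have R: "R \<ge> 0" using r1 \<kappa> by (simp add: R_def)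
    have "(\<integral>\<^sup>+x. ennreal (jump_bound r (c * f x)) \<partial>lborel)
      \<le> (\<integral>\<^sup>+x. 2 * indicator (cball 0 R) x + ennreal \<bar>c\<bar> * ennreal (exp (\<kappa> * norm x) * \<bar>f x\<bar>) \<partial>lborel)"
    proof (rule nn_integral_mono)
      fix x :: "real^'n"
      show "ennreal (jump_bound r (c * f x)) \<le> 2 * indicator (cball 0 R) x + ennreal \<bar>c\<bar> * ennreal (exp (\<kappa> * norm x) * \<bar>f x\<bar>)"
      proof (cases "norm x \<le> R")
        case True
        have "ennreal (jump_bound r (c * f x)) \<le> ennreal 2" using False by (intro ennreal_leI) (simp add: jump_bound_def)
        also have "\<dots> \<le> 2 * indicator (cball 0 R) x + ennreal \<bar>c\<bar> * ennreal (exp (\<kappa> * norm x) * \<bar>f x\<bar>)"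
          using True by simp
        finally show ?thesis .
      next
        case out: False
        have "ln \<bar>r\<bar> \<le> \<kappa> * norm x" using out \<kappa> by (simp add: R_def field_simps)
        then have "\<bar>r\<bar> \<le> exp (\<kappa> * norm x)" using r1 by (metis exp_le_cancel_iff exp_ln less_trans zero_less_one)
        then have "\<bar>r\<bar> * \<bar>c * f x\<bar> \<le> exp (\<kappa> * norm x) * \<bar>c * f x\<bar>" by (intro mult_right_mono) auto
        moreover have "jump_bound r (c * f x) \<le> \<bar>r\<bar> * \<bar>c * f x\<bar>" using False by (simp add: jump_bound_def abs_mult)
        ultimately have "jump_bound r (c * f x) \<le> \<bar>c\<bar> * (exp (\<kappa> * norm x) * \<bar>f x\<bar>)" by (simp add: abs_mult mult_ac)
        then have "ennreal (jump_bound r (c * f x)) \<le> ennreal \<bar>c\<bar> * ennreal (exp (\<kappa> * norm x) * \<bar>f x\<bar>)"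
          by (subst ennreal_mult[symmetric]) (auto intro: ennreal_leI)
        then show ?thesis by (simp add: add_increasing)
      qed
    qed
    also have "\<dots> = 2 * emeasure lborel (cball (0::real^'n) R) + ennreal \<bar>c\<bar> * ?E"
    proof -
      have [measurable]: "cball (0::real^'n) R \<in> sets borel" by simp
      have "(\<integral>\<^sup>+(x::real^'n). 2 * indicator (cball 0 R) x \<partial>lborel) = 2 * emeasure lborel (cball (0::real^'n) R)"
        by (rule nn_integral_cmult_indicator) simp
      moreover have "(\<integral>\<^sup>+x. ennreal \<bar>c\<bar> * ennreal (exp (\<kappa> * norm x) * \<bar>f x\<bar>) \<partial>lborel) = ennreal \<bar>c\<bar> * ?E"
        by (rule nn_integral_cmult) measurable
      moreover have "(\<lambda>x::real^'n. 2 * indicator (cball 0 R) x :: ennreal) \<in> borel_measurable lborel"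
        "(\<lambda>x. ennreal \<bar>c\<bar> * ennreal (exp (\<kappa> * norm x) * \<bar>f x\<bar>)) \<in> borel_measurable lborel" by measurable
      ultimately show ?thesis by (simp only: nn_integral_add)
    qed
    also have "emeasure lborel (cball (0::real^'n) R) = ennreal (V * R ^ CARD('n))"
      using emeasure_cball[OF R, of "0::real^'n"] by (simp add: V_def)
    also have "2 * ennreal (V * R ^ CARD('n)) = ennreal B * ennreal (ln \<bar>r\<bar> ^ CARD('n))"
    proof -
      have "2 * ennreal (V * R ^ CARD('n)) = ennreal (2 * (V * R ^ CARD('n)))"
        using V R by (simp add: ennreal_mult)
      also have "2 * (V * R ^ CARD('n)) = B * ln \<bar>r\<bar> ^ CARD('n)" by (simp add: B_def R_def power_divide)
      also have "ennreal \<dots> = ennreal B * ennreal (ln \<bar>r\<bar> ^ CARD('n))" using B by (rule ennreal_mult')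
      finally show ?thesis .
    qed
    also have "ennreal B * ennreal (ln \<bar>r\<bar> ^ CARD('n)) + ennreal \<bar>c\<bar> * ?E \<le> ennreal B * ennreal (ln \<bar>r\<bar> ^ CARD('n)) + A"
      unfolding A_def by (intro add_left_mono) simp
    finally show ?thesis using r1 r2 by (simp add: min_absorb1 add.commute)
  qed
  have "(\<integral>\<^sup>+x. (\<integral>\<^sup>+r. ennreal (jump_bound r (c * f x)) \<partial>\<nu>) \<partial>lborel) = (\<integral>\<^sup>+r. (\<integral>\<^sup>+x. ennreal (jump_bound r (c * f x)) \<partial>lborel) \<partial>\<nu>)"
    by (rule P.Fubini'[symmetric]) measurable
  also have "\<dots> \<le> (\<integral>\<^sup>+r. A * ennreal (min 1 (r\<^sup>2)) + ennreal B * (indicator {r. \<bar>r\<bar> > 1} r * ennreal (ln \<bar>r\<bar> ^ CARD('n))) \<partial>\<nu>)"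
    by (intro nn_integral_mono inner)
  also have "\<dots> = A * (\<integral>\<^sup>+r. ennreal (min 1 (r\<^sup>2)) \<partial>\<nu>) + ennreal B * (\<integral>\<^sup>+r. indicator {r. \<bar>r\<bar> > 1} r * ennreal (ln \<bar>r\<bar> ^ CARD('n)) \<partial>\<nu>)"
    by (subst nn_integral_add) (auto simp: nn_integral_cmult)
  also have "\<dots> < \<infinity>" using A log nu by (auto simp: ennreal_mult_less_top levy_measure_def)
  finally have J: "(\<integral>\<^sup>+x. (\<integral>\<^sup>+r. ennreal (jump_bound r (c * f x)) \<partial>\<nu>) \<partial>lborel) < \<infinity>" .
  have "(\<integral>\<^sup>+x. ennreal (\<bar>\<gamma> * (c * f x)\<bar> + a * (c * f x)\<^sup>2) \<partial>lborel) = (\<integral>\<^sup>+x. ennreal \<bar>\<gamma> * c\<bar> * ennreal \<bar>f x\<bar> + ennreal (a * c\<^sup>2) * ennreal ((f x)\<^sup>2) \<partial>lborel)"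
    using a_nonneg by (intro nn_integral_cong) (simp add: abs_mult power_mult_distrib mult_ac flip: ennreal_mult ennreal_plus)
  also have "\<dots> = ennreal \<bar>\<gamma> * c\<bar> * (\<integral>\<^sup>+x. ennreal \<bar>f x\<bar> \<partial>lborel) + ennreal (a * c\<^sup>2) * ?S"
    by (subst nn_integral_add) (auto simp: nn_integral_cmult)
  also have "\<dots> < \<infinity>" using order_le_less_trans[OF fE L1] L2 by (auto simp: ennreal_mult_less_top)
  finally have D: "(\<integral>\<^sup>+x. ennreal (\<bar>\<gamma> * (c * f x)\<bar> + a * (c * f x)\<^sup>2) \<partial>lborel) < \<infinity>" .
  have "(\<integral>\<^sup>+x. psi_bound (c * f x) \<partial>lborel) = (\<integral>\<^sup>+x. ennreal (\<bar>\<gamma> * (c * f x)\<bar> + a * (c * f x)\<^sup>2) \<partial>lborel)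
     + (\<integral>\<^sup>+x. (\<integral>\<^sup>+r. ennreal (jump_bound r (c * f x)) \<partial>\<nu>) \<partial>lborel)"
    unfolding psi_bound_def by (rule nn_integral_add) measurable
  then show ?thesis using D J by simp
qed

text \<open>\<open>f\<close> is inserted between \<open>s\<close> and \<open>t\<close>, and
  monotonicity of \<open>psi_bound\<close> takes the place of subadditivity:
  \<open>\<bar>u - v\<bar>\<close> is at most twice the larger modulus, which is the 2 in its
  argument. The cap \<open>min 2\<close> keeps the averages over \<open>z\<close> finite.\<close>

lemma simple_int_distance:
  assumes A: "A \<in> sets lborel" and s: "\<forall>(c, B)\<in>set s. bounded_borel B" and t: "\<forall>(c, B)\<in>set t. bounded_borel B"
    and [measurable]: "simple_eval s \<in> borel_measurable borel" "simple_eval t \<in> borel_measurable borel" "f \<in> borel_measurable borel"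
  shows "(\<integral>\<^sup>+\<omega>. ennreal (1 - exp (- (simple_int L s A \<omega> - simple_int L t A \<omega>)\<^sup>2 / 2)) \<partial>M)
    \<le> (\<integral>\<^sup>+z. min 2 (\<integral>\<^sup>+x. psi_bound (2 * z * (simple_eval s x - f x)) \<partial>lborel) \<partial>std_normal_distribution)
    + (\<integral>\<^sup>+z. min 2 (\<integral>\<^sup>+x. psi_bound (2 * z * (simple_eval t x - f x)) \<partial>lborel) \<partial>std_normal_distribution)"
proof -
  let ?N = std_normal_distribution
  let ?d = "s @ neg_simple t"
  let ?E = "\<lambda>s z. \<integral>\<^sup>+x. psi_bound (2 * z * (simple_eval s x - f x)) \<partial>lborel"
  have d: "\<forall>(c, B)\<in>set ?d. bounded_borel B" using s t by (auto simp: neg_simple_def)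
  have [measurable]: "simple_int L ?d A \<in> borel_measurable M" by (rule simple_int_measurable[OF A d])
  interpret Y: real_distribution "distr M borel (simple_int L ?d A)" by (rule real_distribution_distr) simp
  have "(\<integral>\<^sup>+\<omega>. ennreal (1 - exp (- (simple_int L s A \<omega> - simple_int L t A \<omega>)\<^sup>2 / 2)) \<partial>M)
    = (\<integral>\<^sup>+\<omega>. ennreal (1 - exp (- (simple_int L ?d A \<omega>)\<^sup>2 / 2)) \<partial>M)"
    unfolding simple_int_diff ..
  also have "\<dots> \<le> (\<integral>\<^sup>+z. ennreal (cmod (1 - char (distr M borel (simple_int L ?d A)) z)) \<partial>?N)"
    by (rule gaussian_average_char) (auto intro: prob_space_axioms)
  also have "\<dots> \<le> (\<integral>\<^sup>+z. min 2 (?E s z) + min 2 (?E t z) \<partial>?N)"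
  proof (rule nn_integral_mono)
    fix z
    obtain J where J: "char (distr M borel (simple_int L ?d A)) z = exp J"
      "\<And>g. (\<And>u. ennreal (cmod (psi u)) \<le> g u) \<Longrightarrow> ennreal (cmod J) \<le> (\<integral>\<^sup>+x. g (z * simple_eval ?d x) \<partial>lborel)"
      using char_simple_int[OF A d] by blast
    have "cmod (exp J) \<le> 1" using Y.cmod_char_le_1[of z] unfolding J(1) .
    from cmod_one_minus_exp[OF this]
    have "ennreal (cmod (1 - exp J)) \<le> ennreal (min 2 (cmod J))" by (rule ennreal_leI)
    also have "\<dots> \<le> min 2 (ennreal (cmod J))"
      using ennreal_leI[of "min 2 (cmod J)" 2] by (intro min.boundedI) (auto intro: ennreal_leI)
    also have "ennreal (cmod J) \<le> (\<integral>\<^sup>+x. psi_bound (z * simple_eval ?d x) \<partial>lborel)"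
      by (rule J(2)[OF psi_le])
    also have "\<dots> \<le> (\<integral>\<^sup>+x. psi_bound (2 * z * (simple_eval s x - f x)) + psi_bound (2 * z * (simple_eval t x - f x)) \<partial>lborel)"
    proof (rule nn_integral_mono)
      fix x
      let ?u = "simple_eval s x - f x" and ?v = "simple_eval t x - f x"
      have eq: "simple_eval ?d x = ?u - ?v" by (simp add: simple_eval_diff)
      show "psi_bound (z * simple_eval ?d x) \<le> psi_bound (2 * z * ?u) + psi_bound (2 * z * ?v)"
      proof (cases "\<bar>?u\<bar> \<le> \<bar>?v\<bar>")
        case True
        then have "\<bar>?u - ?v\<bar> \<le> 2 * \<bar>?v\<bar>" by (intro order_trans[OF abs_triangle_ineq4]) simp
        then have "\<bar>z\<bar> * \<bar>?u - ?v\<bar> \<le> \<bar>z\<bar> * (2 * \<bar>?v\<bar>)" by (rule mult_left_mono) simp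
        then have "psi_bound (z * simple_eval ?d x) \<le> psi_bound (2 * z * ?v)"
          unfolding eq by (intro psi_bound_mono) (simp add: abs_mult)
        then show ?thesis by (simp add: add_increasing)
      next
        case False
        then have "\<bar>?u - ?v\<bar> \<le> 2 * \<bar>?u\<bar>" by (intro order_trans[OF abs_triangle_ineq4]) simp
        then have "\<bar>z\<bar> * \<bar>?u - ?v\<bar> \<le> \<bar>z\<bar> * (2 * \<bar>?u\<bar>)" by (rule mult_left_mono) simp
        then have "psi_bound (z * simple_eval ?d x) \<le> psi_bound (2 * z * ?u)"
          unfolding eq by (intro psi_bound_mono) (simp add: abs_mult)
        then show ?thesis by (simp add: add_increasing2)
      qed
    qed
    also have "\<dots> = ?E s z + ?E t z" by (rule nn_integral_add) measurable
    finally have "ennreal (cmod (1 - exp J)) \<le> min 2 (?E s z + ?E t z)" by (simp add: min.coboundedI2)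
    also have "\<dots> \<le> min 2 (?E s z) + min 2 (?E t z)"
      by (auto simp: min_def add_increasing add_increasing2)
    finally show "ennreal (cmod (1 - char (distr M borel (simple_int L ?d A)) z)) \<le> min 2 (?E s z) + min 2 (?E t z)"
      unfolding J(1) .
  qed
  also have "\<dots> = (\<integral>\<^sup>+z. min 2 (?E s z) \<partial>?N) + (\<integral>\<^sup>+z. min 2 (?E t z) \<partial>?N)"
    by (rule nn_integral_add) measurable
  finally show ?thesis .
qed

text \<open>One sequence of simple functions works for every measurable \<open>A\<close>, because
  the distance bound does not depend on \<open>A\<close>. Dominated convergence is used twice: over
  the space for fixed \<open>z\<close>, then over \<open>z\<close> with the cap 2 as
  majorant.\<close>

lemma rr_integrable:
  fixes f :: "real^'n \<Rightarrow> real"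
  assumes f [measurable]: "f \<in> borel_measurable borel"
    and log: "(\<integral>\<^sup>+r. indicator {r. \<bar>r\<bar> > 1} r * ennreal (ln \<bar>r\<bar> ^ CARD('n)) \<partial>\<nu>) < \<infinity>"
    and \<kappa>: "\<kappa> > 0" and L1: "(\<integral>\<^sup>+x. ennreal (exp (\<kappa> * norm x) * \<bar>f x\<bar>) \<partial>lborel) < \<infinity>"
    and L2: "(\<integral>\<^sup>+x. ennreal ((f x)\<^sup>2) \<partial>lborel) < \<infinity>"
  shows "\<exists>X. rr_has_integral M L f X"
proof -
  let ?N = std_normal_distribution
  obtain s :: "nat \<Rightarrow> (real \<times> (real^'n) set) list" where s: "\<And>n. \<forall>(c, B)\<in>set (s n). bounded_borel B"
    "\<And>x. (\<lambda>n. simple_eval (s n) x) \<longlonglongrightarrow> f x" "\<And>n x. \<bar>simple_eval (s n) x\<bar> \<le> 2 * \<bar>f x\<bar>"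
    using simple_function_approximation[OF f] by blast
  have [measurable]: "simple_eval (s n) \<in> borel_measurable borel" for n by (rule simple_eval_measurable[OF s(1)])
  define E where "E n z = (\<integral>\<^sup>+x. psi_bound (2 * z * (simple_eval (s n) x - f x)) \<partial>lborel)" for n z
  have [measurable]: "E n \<in> borel_measurable borel" for n unfolding E_def by measurable
  have E: "(\<lambda>n. E n z) \<longlonglongrightarrow> 0" for z
  proof -
    have "(\<lambda>n. E n z) \<longlonglongrightarrow> (\<integral>\<^sup>+(x::real^'n). 0 \<partial>lborel)"
      unfolding E_def
    \<comment> \<open>\<open>6 = 2 * 3\<close>: an approximation bounded by twice the modulus of
      \<open>f\<close> differs from \<open>f\<close> by at most
      \<open>3 * \<bar>f x\<bar>\<close>.\<close>
    proof (rule nn_integral_dominated_convergence[where w="\<lambda>x. psi_bound (6 * z * f x)"])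
      show "(\<integral>\<^sup>+x. psi_bound (6 * z * f x) \<partial>lborel) < \<infinity>"
        by (rule psi_bound_integral_finite[OF f log \<kappa> L1 L2])
      show "AE x in lborel. psi_bound (2 * z * (simple_eval (s n) x - f x)) \<le> psi_bound (6 * z * f x)" for n
      proof (intro AE_I2 psi_bound_mono)
        fix x
        have "\<bar>z\<bar> * \<bar>simple_eval (s n) x - f x\<bar> \<le> \<bar>z\<bar> * (3 * \<bar>f x\<bar>)"
          using s(3)[of n x] by (intro mult_left_mono) auto
        then show "\<bar>2 * z * (simple_eval (s n) x - f x)\<bar> \<le> \<bar>6 * z * f x\<bar>" by (simp add: abs_mult)
      qed
      show "AE x in lborel. (\<lambda>n. psi_bound (2 * z * (simple_eval (s n) x - f x))) \<longlonglongrightarrow> 0"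
      proof (intro AE_I2 psi_bound_tendsto_0)
        fix x
        have "(\<lambda>n. 2 * z * (simple_eval (s n) x - f x)) \<longlonglongrightarrow> 2 * z * (f x - f x)" by (intro tendsto_intros s)
        then show "(\<lambda>n. 2 * z * (simple_eval (s n) x - f x)) \<longlonglongrightarrow> 0" by simp
      qed
    qed measurable
    then show ?thesis by simp
  qed
  define b where "b n = (\<integral>\<^sup>+z. min 2 (E n z) \<partial>?N)" for n
  interpret N: prob_space ?N by (rule prob_space_normal_density) simp
  have "(\<lambda>n. \<integral>\<^sup>+z. min 2 (E n z) \<partial>?N) \<longlonglongrightarrow> (\<integral>\<^sup>+(z::real). 0 \<partial>?N)"
  proof (rule nn_integral_dominated_convergence[where w="\<lambda>_. 2"])
    show "AE z in ?N. (\<lambda>n. min 2 (E n z)) \<longlonglongrightarrow> 0"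
      using tendsto_min[OF tendsto_const E, of 2] by (intro AE_I2) (simp add: min_absorb2)
    have "emeasure ?N UNIV = 1" using N.emeasure_space_1 by simp
    then show "(\<integral>\<^sup>+z. 2 \<partial>?N) < \<infinity>" by simp
  qed auto
  then have b: "b \<longlonglongrightarrow> 0" unfolding b_def by simp
  have conv: "\<exists>Z. conv_in_prob M (\<lambda>n. simple_int L (s n) A) Z" if A: "A \<in> sets lborel" for A
  proof (rule conv_in_prob_of_Cauchy[OF _ _ b])
    show "simple_int L (s n) A \<in> borel_measurable M" for n by (rule simple_int_measurable[OF A s(1)])
    show "(\<integral>\<^sup>+\<omega>. ennreal (1 - exp (- (simple_int L (s n) A \<omega> - simple_int L (s m) A \<omega>)\<^sup>2 / 2)) \<partial>M) \<le> b n + b m" for n m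
      unfolding b_def E_def by (rule simple_int_distance[OF A s(1) s(1)]) measurable
  qed (rule prob_space_axioms)
  then obtain X where "conv_in_prob M (\<lambda>n. simple_int L (s n) UNIV) X" by force
  then show ?thesis
    unfolding rr_has_integral_def using s conv by blast
qed

end

theorem theorem5p3:
  fixes M :: "'w measure"
    and L :: "(real^'n::finite) set \<Rightarrow> 'w \<Rightarrow> real"
    and a \<gamma> :: real and \<nu> :: "real measure"
    and p q :: "('n \<Rightarrow> nat) \<Rightarrow> real"
    and \<epsilon> :: real
  assumes "levy_basis M L a \<gamma> \<nu>"
    and "(\<integral>\<^sup>+r. indicator {r. \<bar>r\<bar> > 1} r * ennreal (ln \<bar>r\<bar> ^ CARD('n)) \<partial>\<nu>) < \<infinity>"
    and "is_poly p" and "is_poly q" and "\<exists>\<alpha>. p \<alpha> \<noteq> 0"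
    and "\<epsilon> > 0"
    and "\<exists>C. \<forall>\<eta>::real^'n. norm \<eta> < \<epsilon> \<longrightarrow>
           (\<integral>\<^sup>+\<xi>. ennreal ((cmod (symbol_ratio q p \<eta> \<xi>))\<^sup>2) \<partial>lborel) \<le> ennreal C"
  shows "\<exists>G :: real^'n \<Rightarrow> real.
           inv_fourier_L2 (symbol_ratio q p 0) (\<lambda>x. complex_of_real (G x)) \<and>
           locally_integrable G \<and> fundamental_solution p q G \<and>
           (\<exists>X :: real^'n \<Rightarrow> 'w \<Rightarrow> real. \<forall>t. rr_has_integral M L (\<lambda>s. G (t - s)) (X t))"
proof -
  obtain C where C: "\<forall>\<eta>::real^'n. norm \<eta> < \<epsilon> \<longrightarrow>
       (\<integral>\<^sup>+\<xi>. ennreal ((cmod (symbol_ratio q p \<eta> \<xi>))\<^sup>2) \<partial>lborel) \<le> ennreal C"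
    using assms(7) by blast
  interpret S: tube_symbol p q \<epsilon> C
    using assms C by unfold_locales auto
  obtain G w \<rho> where "tube_kernel p q \<epsilon> C G w \<rho>"
  proof (rule S.fundamental_kernel_exists)
    fix G w :: "real^'n \<Rightarrow> real" and \<rho> :: "nat \<Rightarrow> real"
    assume *: "\<And>k. 0 < \<rho> k" "\<And>k. \<rho> k \<le> 1" "\<rho> \<longlonglongrightarrow> 0"
      "G \<in> borel_measurable borel" "w \<in> borel_measurable borel" "\<And>x. w x \<ge> 0"
      "(\<integral>\<^sup>+x. ennreal ((w x)\<^sup>2) \<partial>lborel) < \<infinity>"
      "AE x in lborel. (\<lambda>k. inv_fourier (S.reg (\<rho> k)) x) \<longlonglongrightarrow> of_real (G x)"
      "AE x in lborel. \<forall>k. cmod (inv_fourier (S.reg (\<rho> k)) x - of_real (G x)) \<le> (1/2) ^ k * w x"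
    show ?thesis
      by (rule that[of G w \<rho>], unfold_locales) (use * in auto)
  qed
  then interpret K: tube_kernel p q \<epsilon> C G w \<rho> .
  interpret B: levy M L a \<gamma> \<nu> by unfold_locales (rule assms(1))
  let ?\<kappa> = "K.rate / 2"
  have "\<exists>X. rr_has_integral M L (\<lambda>s. G (t - s)) X" for t
  proof (rule B.rr_integrable[OF _ assms(2), where \<kappa>="?\<kappa>"])
    show "?\<kappa> > 0" using K.rate_pos by simp
    \<comment> \<open>By the triangle inequality, reflection and translation by \<open>t\<close>
      cost only the constant \<open>exp (?\<kappa> * norm t)\<close>, so the decay of
      \<open>G\<close> about the origin serves every \<open>t\<close>.\<close>
    have "(\<integral>\<^sup>+x. ennreal (exp (?\<kappa> * norm x) * \<bar>G (t - x)\<bar>) \<partial>lborel)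
      \<le> (\<integral>\<^sup>+x. ennreal (exp (?\<kappa> * norm t)) * ennreal (exp (?\<kappa> * norm (t - x)) * \<bar>G (t - x)\<bar>) \<partial>lborel)"
    proof (rule nn_integral_mono)
      fix x
      have "?\<kappa> * norm x \<le> ?\<kappa> * (norm t + norm (t - x))"
        using norm_triangle_ineq4[of t "t - x"] K.rate_pos by (intro mult_left_mono) auto
      then have "exp (?\<kappa> * norm x) \<le> exp (?\<kappa> * norm t) * exp (?\<kappa> * norm (t - x))"
        by (simp add: distrib_left flip: exp_add)
      then have "exp (?\<kappa> * norm x) * \<bar>G (t - x)\<bar> \<le> exp (?\<kappa> * norm t) * (exp (?\<kappa> * norm (t - x)) * \<bar>G (t - x)\<bar>)"
        unfolding mult.assoc[symmetric] by (rule mult_right_mono) simp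
      then show "ennreal (exp (?\<kappa> * norm x) * \<bar>G (t - x)\<bar>)
         \<le> ennreal (exp (?\<kappa> * norm t)) * ennreal (exp (?\<kappa> * norm (t - x)) * \<bar>G (t - x)\<bar>)"
        by (subst ennreal_mult[symmetric]) (auto intro: ennreal_leI)
    qed
    also have "\<dots> = ennreal (exp (?\<kappa> * norm t)) * (\<integral>\<^sup>+x. ennreal (exp (?\<kappa> * norm (t - x)) * \<bar>G (t - x)\<bar>) \<partial>lborel)"
      by (rule nn_integral_cmult) measurable
    also have "(\<integral>\<^sup>+x. ennreal (exp (?\<kappa> * norm (t - x)) * \<bar>G (t - x)\<bar>) \<partial>lborel) = (\<integral>\<^sup>+x. ennreal (exp (?\<kappa> * norm x) * \<bar>G x\<bar>) \<partial>lborel)"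
      by (rule nn_integral_lborel_reflect[where f="\<lambda>x. ennreal (exp (?\<kappa> * norm x) * \<bar>G x\<bar>)"]) measurable
    also have "ennreal (exp (?\<kappa> * norm t)) * \<dots> < \<infinity>"
      using K.G_exp_L1 by (simp add: ennreal_mult_less_top)
    finally show "(\<integral>\<^sup>+x. ennreal (exp (?\<kappa> * norm x) * \<bar>G (t - x)\<bar>) \<partial>lborel) < \<infinity>" .
    have "(\<integral>\<^sup>+x. ennreal ((G (t - x))\<^sup>2) \<partial>lborel) = (\<integral>\<^sup>+x. ennreal ((G x)\<^sup>2) \<partial>lborel)"
      by (rule nn_integral_lborel_reflect[where f="\<lambda>x. ennreal ((G x)\<^sup>2)"]) measurable
    then show "(\<integral>\<^sup>+x. ennreal ((G (t - x))\<^sup>2) \<partial>lborel) < \<infinity>" using K.G_L2 by simp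
  qed measurable
  then obtain X where "\<And>t. rr_has_integral M L (\<lambda>s. G (t - s)) (X t)" by metis
  then show ?thesis
    using K.inv_fourier_L2_G K.locally_integrable_G K.fundamental_solution_G[OF assms(4)] by blast
qed

end
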